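(* There is an absolute constant $C$ such that for every $n\ge 2$, every family of $n$ $x$-monotone planar curves in which every two curves have at most one common point and no three curves share a common point has at most $C n^{4/3}(\log n)^{1/3}$ tangent pairs.
   Context: A curve is $x$-monotone if it is the graph of a continuous function defined on a closed interval of $\mathbb{R}$. Every two curves of a family are assumed to intersect in finitely many points. Two curves are tangent if they have precisely one common point and this point is not a crossing point. *)

theory Defs
  imports "HOL-Analysis.Analysis"
begin

text \<open>
  Curves are point sets in the plane. The domain may be any nonempty closed interval, so
  closed rays, the whole line and single points are allowed besides compact intervals.
\<close>

definition x_monotone_curve :: "(real \<times> real) set \<Rightarrow> bool" where
  "x_monotone_curve c \<longleftrightarrow>
     (\<exists>I f. I \<noteq> {} \<and> is_interval I \<and> closed I \<and> continuous_on I f \<and> c = (\<lambda>x. (x, f x)) ` I)"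

text \<open>The second curve \<open>d\<close> passes strictly above \<open>c\<close> over all of \<open>X\<close>; in particular both
  curves are defined over all of \<open>X\<close>.\<close>

definition below_over :: "real set \<Rightarrow> (real \<times> real) set \<Rightarrow> (real \<times> real) set \<Rightarrow> bool" where
  "below_over X c d \<longleftrightarrow> (\<forall>x\<in>X. \<exists>y z. (x, y) \<in> c \<and> (x, z) \<in> d \<and> y < z)"

text \<open>
  A common point is a crossing if one curve passes there from one side of the other curve to the
  other side. This forces the point to be interior to both curves: a common point that is an
  endpoint of one of them is never a crossing.
\<close>

definition crossing_point :: "(real \<times> real) set \<Rightarrow> (real \<times> real) set \<Rightarrow> real \<times> real \<Rightarrow> bool" where
  "crossing_point c d p \<longleftrightarrow> p \<in> c \<inter> d \<and>
     (\<exists>e>0. below_over {fst p - e<..<fst p} c d \<and> below_over {fst p<..<fst p + e} d c \<or>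
            below_over {fst p - e<..<fst p} d c \<and> below_over {fst p<..<fst p + e} c d)"

definition tangent :: "(real \<times> real) set \<Rightarrow> (real \<times> real) set \<Rightarrow> bool" where
  "tangent c d \<longleftrightarrow> (\<exists>p. c \<inter> d = {p} \<and> \<not> crossing_point c d p)"

definition tangent_pairs :: "(real \<times> real) set set \<Rightarrow> (real \<times> real) set set set" where
  "tangent_pairs F = {{c, d} | c d. c \<in> F \<and> d \<in> F \<and> c \<noteq> d \<and> tangent c d}"

end

theory Submission
  imports Defs
begin

text \<open>
  Sample all curves at finitely many abscissae, one just to the left of each tangency; there the
  two tangent curves are vertical neighbours. Cut the sampled picture into cells: horizontally into
  bands of about \<open>h\<close> consecutive levels, and every band vertically after every \<open>h\<close> curves entering
  it. For a suitable offset of the bands there are \<open>O(n\<^sup>2/h)\<close> curve pieces in total and at most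
  \<open>2 h\<close> in each cell.

  Order the pieces that pass through a cell by the place where they enter it. Between an initial part
  (touching from above) and the remaining pieces (touching from below) the parts of the pieces between
  their first and last touching do not cross, so there are only linearly many touchings; halving gives
  \<open>O(N log N)\<close> touchings among \<open>N\<close> passing pieces. No four passing pieces touch the same two pieces
  from the same side, so the \<open>E\<close> pieces that start or end inside the cell have \<open>O(E \<surd>h + N)\<close> touchings
  with passing ones. The touchings between two such pieces are bounded by induction on \<open>n\<close>. The sum
  \<open>n\<^sup>2 log n / h + n \<surd>h\<close> is smallest for \<open>h = (n log n)\<^bsup>2/3\<^esup>\<close>.
\<close>

section \<open>Touchings of noncrossing curves\<close>

text \<open>The obstacle is that curves may begin and end anywhere. A piece that enters and leaves a
  cell through its boundary has a place in a boundary order, which controls its crossings; a piece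
  whose curve begins or ends inside has none. But a curve has only two ends, so over all cells
  together there are at most \<open>2 * card F\<close> such pieces. Hence the recursion is run with
  a bound per curve: if families of at most \<open>2 * h\<close> curves have at most
  \<open>\<rho>\<close> touchings per curve, these pieces touch each other inside the cells at most
  \<open>2 * \<rho> * card F\<close> times. For large \<open>n\<close> the number
  \<open>2 * h\<close> is at most \<open>n / 64\<close>, the cube root makes \<open>\<rho>\<close> a
  quarter of the target per curve, and the induction closes with an unchanged constant. Sampling
  replaces topology by order: at the samples heights are distinct, two curves exchange their order
  at most once, a tangent pair never. A tangency at the left end of a curve has no sample; since no
  three curves meet, there is at most one such pair per curve, added at the end.\<close>

text \<open>Noncrossing curves: apart from the first touching on each of the two curves, a touching of
  \<open>a\<close> and \<open>b\<close> is charged to the curve between \<open>a\<close> and \<open>b\<close> that was the last one to end before it;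
  no curve is charged twice.\<close>

locale noncrossing_touchings =
  fixes U L :: "'s set" and Q :: "('s \<times> 's) set" and g :: "'s \<Rightarrow> nat \<Rightarrow> real"
    and tt :: "'s \<Rightarrow> 's \<Rightarrow> nat" and l r :: "'s \<Rightarrow> nat"
  assumes finite_UL: "finite U" "finite L" and disj_UL: "U \<inter> L = {}"
    and Q_sub: "Q \<subseteq> U \<times> L"
    and in_hull: "(a, b) \<in> Q \<Longrightarrow> l a \<le> tt a b \<and> tt a b \<le> r a \<and> l b \<le> tt a b \<and> tt a b \<le> r b"
    and first_low: "(a, b) \<in> Q \<Longrightarrow> \<exists>c. (c, b) \<in> Q \<and> tt c b = l b"
    and first_up: "(a, b) \<in> Q \<Longrightarrow> \<exists>c. (a, c) \<in> Q \<and> tt a c = l a"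
    and above: "(a, b) \<in> Q \<Longrightarrow> l a \<le> t \<Longrightarrow> t \<le> r a \<Longrightarrow> l b \<le> t \<Longrightarrow> t \<le> r b \<Longrightarrow> g b t < g a t"
    and adjacent: "(a, b) \<in> Q \<Longrightarrow> q \<in> U \<union> L \<Longrightarrow> q \<noteq> a \<Longrightarrow> q \<noteq> b \<Longrightarrow> l q \<le> tt a b \<Longrightarrow> tt a b \<le> r q
      \<Longrightarrow> g q (tt a b) < g b (tt a b) \<or> g a (tt a b) < g q (tt a b)"
    and noncross: "p \<in> U \<union> L \<Longrightarrow> q \<in> U \<union> L \<Longrightarrow> p \<noteq> q \<Longrightarrow> l p \<le> s \<Longrightarrow> s \<le> r p \<Longrightarrow> l q \<le> s \<Longrightarrow> s \<le> r q
      \<Longrightarrow> l p \<le> x \<Longrightarrow> x \<le> r p \<Longrightarrow> l q \<le> x \<Longrightarrow> x \<le> r q \<Longrightarrow> g p s < g q s \<Longrightarrow> g p x < g q x"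
    and g_neq: "p \<in> U \<union> L \<Longrightarrow> q \<in> U \<union> L \<Longrightarrow> p \<noteq> q \<Longrightarrow> l p \<le> s \<Longrightarrow> s \<le> r p \<Longrightarrow> l q \<le> s \<Longrightarrow> s \<le> r q \<Longrightarrow> g p s \<noteq> g q s"
begin

definition between :: "'s \<times> 's \<Rightarrow> 's set" where
  "between ab = {c \<in> U \<union> L. max (l (fst ab)) (l (snd ab)) \<le> r c \<and> r c < tt (fst ab) (snd ab) \<and> l c \<le> r c \<and>
     g (snd ab) (r c) < g c (r c) \<and> g c (r c) < g (fst ab) (r c)}"

text \<open>The witness comes from the partner that starts later. The curve it touches first is its
  vertical neighbour at that time and so lies between the pair; without crossings it would go on
  separating them, so it has to end before they touch.\<close>

lemma between_nonempty:
  assumes ab: "(a, b) \<in> Q" and "l a < tt a b" "l b < tt a b"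
  shows "between (a, b) \<noteq> {}"
proof -
  have UL: "a \<in> U" "b \<in> L" using ab Q_sub by auto
  note h = in_hull[OF ab]
  show ?thesis
  proof (cases "l a \<le> l b")
    case True
    obtain a1 where a1: "(a1, b) \<in> Q" "tt a1 b = l b" using first_low[OF ab] by blast
    note h1 = in_hull[OF a1(1)]
    have a1U: "a1 \<in> U" using a1 Q_sub by auto
    have ne: "a1 \<noteq> a" "b \<noteq> a" "b \<noteq> a1" using a1 assms UL a1U disj_UL by auto
    have "g b (l b) < g a (l b)" using above[OF ab] True h by auto
    then have 1: "g a1 (l b) < g a (l b)"
      using adjacent[OF a1(1), of a] UL ne True h a1 by fastforce
    have 2: "r a1 < tt a b"
    proof (rule ccontr)
      assume "\<not> ?thesis"
      then have in1: "l a1 \<le> tt a b" "tt a b \<le> r a1" using h h1 a1 by auto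
      have "g b (tt a b) < g a1 (tt a b)" using above[OF a1(1) in1] h by auto
      then have "g a (tt a b) < g a1 (tt a b)" using adjacent[OF ab, of a1] in1 a1U ne by fastforce
      moreover have "g a1 (tt a b) < g a (tt a b)"
        by (rule noncross[of a1 a "l b"]) (use in1 h h1 True ne UL a1U a1 1 in auto)
      ultimately show False by simp
    qed
    have "g a1 (r a1) < g a (r a1)"
      by (rule noncross[of a1 a "l b"]) (use h h1 True ne UL a1U a1 1 2 in auto)
    moreover have "g b (r a1) < g a1 (r a1)" using above[OF a1(1)] h h1 2 a1 by auto
    ultimately have "a1 \<in> between (a, b)" using a1U h1 a1 True 2 by (auto simp: between_def)
    then show ?thesis by blast
  next
    case False
    obtain b1 where b1: "(a, b1) \<in> Q" "tt a b1 = l a" using first_up[OF ab] by blast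
    note h1 = in_hull[OF b1(1)]
    have b1L: "b1 \<in> L" using b1 Q_sub by auto
    have ne: "b1 \<noteq> b" "b \<noteq> a" "a \<noteq> b1" using b1 assms UL b1L disj_UL by auto
    have "g b (l a) < g a (l a)" using above[OF ab] False h by auto
    then have 1: "g b (l a) < g b1 (l a)"
      using adjacent[OF b1(1), of b] UL ne False h b1 by fastforce
    have 2: "r b1 < tt a b"
    proof (rule ccontr)
      assume "\<not> ?thesis"
      then have in1: "l b1 \<le> tt a b" "tt a b \<le> r b1" using h h1 b1 by auto
      have "g b1 (tt a b) < g a (tt a b)" using above[OF b1(1) _ _ in1] h by auto
      then have "g b1 (tt a b) < g b (tt a b)" using adjacent[OF ab, of b1] in1 b1L ne by fastforce
      moreover have "g b (tt a b) < g b1 (tt a b)"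
        by (rule noncross[of b b1 "l a"]) (use in1 h h1 False ne UL b1L b1 1 in auto)
      ultimately show False by simp
    qed
    have "g b (r b1) < g b1 (r b1)"
      by (rule noncross[of b b1 "l a"]) (use h h1 False ne UL b1L b1 1 2 in auto)
    moreover have "g b1 (r b1) < g a (r b1)" using above[OF b1(1)] h h1 2 b1 by auto
    ultimately have "b1 \<in> between (a, b)" using b1L h1 b1 False 2 by (auto simp: between_def)
    then show ?thesis by blast
  qed
qed

text \<open>If \<open>a\<close> ran below \<open>a'\<close> when \<open>c\<close> ends, it would lie
  between \<open>a'\<close> and \<open>b'\<close> and would have to end before these touch. It would
  then be a candidate for \<open>(a', b')\<close> that ends later than \<open>c\<close>, because
  \<open>a\<close> lasts until its own touching. The same holds for \<open>b\<close> above
  \<open>b'\<close>, and exchanging the two pairs gives equality.\<close>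

lemma charge_unique:
  assumes ab: "(a, b) \<in> Q" "(a', b') \<in> Q" and c: "c \<in> between (a, b)" "c \<in> between (a', b')"
    and mx: "\<And>d. d \<in> between (a, b) \<Longrightarrow> r d \<le> r c" "\<And>d. d \<in> between (a', b') \<Longrightarrow> r d \<le> r c"
  shows "(a, b) = (a', b')"
proof -
  have *: "\<not> g a (r c) < g a' (r c)"
    if ab: "(a, b) \<in> Q" "(a', b') \<in> Q" and c: "c \<in> between (a, b)" "c \<in> between (a', b')"
    and mx: "\<And>d. d \<in> between (a', b') \<Longrightarrow> r d \<le> r c" for a b a' b'
  proof
    assume 1: "g a (r c) < g a' (r c)"
    note h = in_hull[OF ab(1)] in_hull[OF ab(2)]
    have UL: "a \<in> U" "b \<in> L" "a' \<in> U" "b' \<in> L" using ab Q_sub by auto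
    have c1: "l a \<le> r c" "l b \<le> r c" "r c < tt a b" "g c (r c) < g a (r c)"
      "l a' \<le> r c" "l b' \<le> r c" "r c < tt a' b'" "g b' (r c) < g c (r c)"
      using c by (auto simp: between_def)
    have ne: "a \<noteq> a'" "a \<noteq> b'" using 1 c1 by auto
    have 2: "r a < tt a' b'"
    proof (rule ccontr)
      assume "\<not> ?thesis"
      then have in1: "l a \<le> tt a' b'" "tt a' b' \<le> r a" using c1 by auto
      have "g a (tt a' b') < g a' (tt a' b')"
        by (rule noncross[of a a' "r c"]) (use in1 h c1 1 ne UL in auto)
      moreover have "g b' (tt a' b') < g a (tt a' b')"
        by (rule noncross[of b' a "r c"]) (use in1 h c1 1 ne UL in auto)
      ultimately show False using adjacent[OF ab(2), of a] in1 UL ne by force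
    qed
    have "g a (r a) < g a' (r a)"
      by (rule noncross[of a a' "r c"]) (use h c1 1 2 ne UL in auto)
    moreover have "g b' (r a) < g a (r a)"
      by (rule noncross[of b' a "r c"]) (use h c1 1 2 ne UL in auto)
    ultimately have "a \<in> between (a', b')" using UL c1 h 2 by (auto simp: between_def)
    then show False using mx[of a] c1 h by auto
  qed
  have **: "\<not> g b' (r c) < g b (r c)"
    if ab: "(a, b) \<in> Q" "(a', b') \<in> Q" and c: "c \<in> between (a, b)" "c \<in> between (a', b')"
    and mx: "\<And>d. d \<in> between (a', b') \<Longrightarrow> r d \<le> r c" for a b a' b'
  proof
    assume 1: "g b' (r c) < g b (r c)"
    note h = in_hull[OF ab(1)] in_hull[OF ab(2)]
    have UL: "a \<in> U" "b \<in> L" "a' \<in> U" "b' \<in> L" using ab Q_sub by auto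
    have c1: "l a \<le> r c" "l b \<le> r c" "r c < tt a b" "g b (r c) < g c (r c)"
      "l a' \<le> r c" "l b' \<le> r c" "r c < tt a' b'" "g c (r c) < g a' (r c)"
      using c by (auto simp: between_def)
    have ne: "b \<noteq> a'" "b \<noteq> b'" using 1 c1 by auto
    have 2: "r b < tt a' b'"
    proof (rule ccontr)
      assume "\<not> ?thesis"
      then have in1: "l b \<le> tt a' b'" "tt a' b' \<le> r b" using c1 by auto
      have "g b (tt a' b') < g a' (tt a' b')"
        by (rule noncross[of b a' "r c"]) (use in1 h c1 1 ne UL in auto)
      moreover have "g b' (tt a' b') < g b (tt a' b')"
        by (rule noncross[of b' b "r c"]) (use in1 h c1 1 ne UL in auto)
      ultimately show False using adjacent[OF ab(2), of b] in1 UL ne by force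
    qed
    have "g b (r b) < g a' (r b)"
      by (rule noncross[of b a' "r c"]) (use h c1 1 2 ne UL in auto)
    moreover have "g b' (r b) < g b (r b)"
      by (rule noncross[of b' b "r c"]) (use h c1 1 2 ne UL in auto)
    ultimately have "b \<in> between (a', b')" using UL c1 h 2 by (auto simp: between_def)
    then show False using mx[of b] c1 h by auto
  qed
  have UL: "a \<in> U" "b \<in> L" "a' \<in> U" "b' \<in> L" using ab Q_sub by auto
  note h = in_hull[OF ab(1)] in_hull[OF ab(2)]
  have c1: "l a \<le> r c" "l b \<le> r c" "r c < tt a b" "l a' \<le> r c" "l b' \<le> r c" "r c < tt a' b'"
    using c by (auto simp: between_def)
  have "a = a'"
    using *[OF ab c mx(2)] *[OF ab(2,1) c(2,1) mx(1)] g_neq[of a a' "r c"] UL h c1 by fastforce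
  moreover have "b = b'"
    using **[OF ab c mx(2)] **[OF ab(2,1) c(2,1) mx(1)] g_neq[of b b' "r c"] UL h c1 by fastforce
  ultimately show ?thesis by simp
qed

lemma same_time_touchings:
  assumes "(a, b) \<in> Q" "(a', b') \<in> Q" "tt a b = tt a' b'" "a = a' \<or> b = b'"
  shows "(a, b) = (a', b')"
proof -
  have UL: "a \<in> U" "b \<in> L" "a' \<in> U" "b' \<in> L" using assms Q_sub by auto
  note h = in_hull[OF assms(1)] in_hull[OF assms(2)]
  have ne: "a \<noteq> b" "a \<noteq> b'" "a' \<noteq> b" "a' \<noteq> b'" using UL disj_UL by auto
  let ?t = "tt a b"
  have 1: "g b ?t < g a ?t" "g b' ?t < g a' ?t" using above[OF assms(1)] above[OF assms(2)] h assms(3) by auto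
  have "b = b'" if "a = a'"
    using adjacent[OF assms(1), of b'] adjacent[OF assms(2), of b] UL h ne assms(3) that 1 by force
  moreover have "a = a'" if "b = b'"
    using adjacent[OF assms(1), of a'] adjacent[OF assms(2), of a] UL h ne assms(3) that 1 by force
  ultimately show ?thesis using assms(4) by auto
qed

lemma card_touchings: "card Q \<le> 2 * (card U + card L)"
proof -
  have fQ: "finite Q" using Q_sub finite_UL by (meson finite_SigmaI finite_subset)
  \<comment> \<open>First touchings of upper curves, first touchings of lower curves, and the rest,
    which is charged injectively to \<open>U \<union> L\<close>. This is the origin of the factor
    2.\<close>
  let ?A = "{ab \<in> Q. tt (fst ab) (snd ab) = l (fst ab)}"
  let ?B = "{ab \<in> Q. tt (fst ab) (snd ab) = l (snd ab)}"
  let ?R = "{ab \<in> Q. l (fst ab) < tt (fst ab) (snd ab) \<and> l (snd ab) < tt (fst ab) (snd ab)}"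
  have "Q \<subseteq> ?A \<union> ?B \<union> ?R" using in_hull by fastforce
  have "inj_on fst ?A"
  proof (rule inj_onI)
    fix x y assume "x \<in> ?A" "y \<in> ?A" "fst x = fst y"
    then show "x = y" using same_time_touchings[of "fst x" "snd x" "fst y" "snd y"] by (cases x, cases y) auto
  qed
  moreover have "fst ` ?A \<subseteq> U" using Q_sub by auto
  ultimately have A: "card ?A \<le> card U" using finite_UL card_inj_on_le by blast
  have "inj_on snd ?B"
  proof (rule inj_onI)
    fix x y assume "x \<in> ?B" "y \<in> ?B" "snd x = snd y"
    then show "x = y" using same_time_touchings[of "fst x" "snd x" "fst y" "snd y"] by (cases x, cases y) auto
  qed
  moreover have "snd ` ?B \<subseteq> L" using Q_sub by auto
  ultimately have B: "card ?B \<le> card L" using finite_UL card_inj_on_le by blast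
  have fb: "finite (between ab)" for ab using finite_UL by (auto simp: between_def)
  define w where "w ab = (SOME c. c \<in> between ab \<and> (\<forall>d\<in>between ab. r d \<le> r c))" for ab
  have w: "w ab \<in> between ab \<and> (\<forall>d\<in>between ab. r d \<le> r (w ab))" if "ab \<in> ?R" for ab
    unfolding w_def
  proof (rule someI_ex)
    have "between ab \<noteq> {}" using that between_nonempty[of "fst ab" "snd ab"] by auto
    then have "Max (r ` between ab) \<in> r ` between ab" using fb by simp
    then obtain c where "c \<in> between ab" "r c = Max (r ` between ab)" by auto
    then show "\<exists>c. c \<in> between ab \<and> (\<forall>d\<in>between ab. r d \<le> r c)" using fb by (intro exI[of _ c]) auto
  qed
  have "inj_on w ?R"
  proof (rule inj_onI)
    fix x y assume x: "x \<in> ?R" and y: "y \<in> ?R" and e: "w x = w y"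
    show "x = y"
      using charge_unique[of "fst x" "snd x" "fst y" "snd y" "w x"] w[OF x] w[OF y] x y e by (auto simp: prod_eq_iff)
  qed
  moreover have "w ` ?R \<subseteq> U \<union> L" using w by (auto simp: between_def)
  ultimately have "card ?R \<le> card (U \<union> L)" using finite_UL card_inj_on_le by blast
  then have R: "card ?R \<le> card U + card L" using card_Un_le order_trans by blast
  have "card Q \<le> card (?A \<union> ?B \<union> ?R)" using \<open>Q \<subseteq> _\<close> fQ by (intro card_mono) auto
  also have "\<dots> \<le> card ?A + card ?B + card ?R" by (meson add_mono_thms_linordered_semiring(3) card_Un_le order_trans)
  finally show ?thesis using A B R by simp
qed

end

section \<open>Sampled curves and cells\<close>

text \<open>
  Time is the index of a sampled abscissa, \<open>al c t\<close> says that the curve \<open>c\<close> is defined there and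
  \<open>H c t\<close> is its height. A pair \<open>(a, b) \<in> T\<close> stands for a tangency of \<open>a\<close> and \<open>b\<close> with \<open>a\<close> above,
  close to time \<open>\<tau> a b\<close>.
\<close>

locale touching_system =
  fixes F :: "'c set" and al :: "'c \<Rightarrow> nat \<Rightarrow> bool" and H :: "'c \<Rightarrow> nat \<Rightarrow> real"
    and T :: "('c \<times> 'c) set" and \<tau> :: "'c \<Rightarrow> 'c \<Rightarrow> nat" and K :: nat
  assumes finite_F: "finite F"
    and alive_bounded: "c \<in> F \<Longrightarrow> al c t \<Longrightarrow> t < K"
    and alive_between: "c \<in> F \<Longrightarrow> al c s \<Longrightarrow> al c t \<Longrightarrow> s \<le> x \<Longrightarrow> x \<le> t \<Longrightarrow> al c x"
    and height_inj: "c \<in> F \<Longrightarrow> d \<in> F \<Longrightarrow> c \<noteq> d \<Longrightarrow> al c t \<Longrightarrow> al d t \<Longrightarrow> H c t \<noteq> H d t"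
    and cross_once: "c \<in> F \<Longrightarrow> d \<in> F \<Longrightarrow> s < t \<Longrightarrow> t < x \<Longrightarrow> al c s \<Longrightarrow> al d s \<Longrightarrow> al c x \<Longrightarrow> al d x
      \<Longrightarrow> H c s < H d s \<Longrightarrow> H d t < H c t \<Longrightarrow> H c x < H d x \<Longrightarrow> False"
    and touch_in: "(a, b) \<in> T \<Longrightarrow> a \<in> F \<and> b \<in> F"
    and touch_alive: "(a, b) \<in> T \<Longrightarrow> al a (\<tau> a b) \<and> al b (\<tau> a b)"
    and touch_above: "(a, b) \<in> T \<Longrightarrow> al a t \<Longrightarrow> al b t \<Longrightarrow> H b t < H a t"
    and touch_adjacent: "(a, b) \<in> T \<Longrightarrow> c \<in> F \<Longrightarrow> al c (\<tau> a b) \<Longrightarrow> H b (\<tau> a b) < H c (\<tau> a b)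
      \<Longrightarrow> H c (\<tau> a b) < H a (\<tau> a b) \<Longrightarrow> False"
begin

text \<open>Reflection in the horizontal axis. It exchanges touching from above and touching from
  below, so that each one-sided statement has to be proved only once.\<close>

lemma flip: "touching_system F al (\<lambda>c t. - H c t) (T\<inverse>) (\<lambda>a b. \<tau> b a) K"
proof
  show "finite F" by (rule finite_F)
  show "t < K" if "c \<in> F" "al c t" for c t using alive_bounded that .
  show "al c x" if "c \<in> F" "al c s" "al c t" "s \<le> x" "x \<le> t" for c s t x using alive_between that .
  show "- H c t \<noteq> - H d t" if "c \<in> F" "d \<in> F" "c \<noteq> d" "al c t" "al d t" for c d t
    using height_inj[OF that] by simp
  show False if "c \<in> F" "d \<in> F" "s < t" "t < x" "al c s" "al d s" "al c x" "al d x"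
    "- H c s < - H d s" "- H d t < - H c t" "- H c x < - H d x" for c d s t x
    using cross_once[of d c s t x] that by simp
  show "a \<in> F \<and> b \<in> F" if "(a, b) \<in> T\<inverse>" for a b using touch_in that by blast
  show "al a (\<tau> b a) \<and> al b (\<tau> b a)" if "(a, b) \<in> T\<inverse>" for a b using touch_alive that by blast
  show "- H b t < - H a t" if "(a, b) \<in> T\<inverse>" "al a t" "al b t" for a b t using touch_above that by force
  show False if "(a, b) \<in> T\<inverse>" "c \<in> F" "al c (\<tau> b a)" "- H b (\<tau> b a) < - H c (\<tau> b a)"
    "- H c (\<tau> b a) < - H a (\<tau> b a)" for a b c
    using touch_adjacent[of b a c] that by simp
qed

end

text \<open>
  The strands in \<open>S\<close> are the pieces of the curves inside one cell: \<open>p\<close> is the part of the curve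
  \<open>cv p\<close> over the times from \<open>lo p\<close> to \<open>hi p\<close>. A curve may have several strands. The cell lies in band \<open>i\<close>.
\<close>

locale cell = touching_system F al H T \<tau> K
  for F :: "'c set" and al H T \<tau> K +
  fixes S :: "'s set" and cv :: "'s \<Rightarrow> 'c" and lo hi :: "'s \<Rightarrow> nat" and \<beta> :: "'c \<Rightarrow> nat \<Rightarrow> int" and i :: int
  assumes finite_S: "finite S"
    and cv_in: "p \<in> S \<Longrightarrow> cv p \<in> F"
    and lo_le_hi: "p \<in> S \<Longrightarrow> lo p \<le> hi p"
    and strand_alive: "p \<in> S \<Longrightarrow> lo p \<le> t \<Longrightarrow> t \<le> hi p \<Longrightarrow> al (cv p) t"
    and strand_band: "p \<in> S \<Longrightarrow> lo p \<le> t \<Longrightarrow> t \<le> hi p \<Longrightarrow> \<beta> (cv p) t = i"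
    and strand_unique: "p \<in> S \<Longrightarrow> q \<in> S \<Longrightarrow> cv p = cv q \<Longrightarrow> lo p \<le> t \<Longrightarrow> t \<le> hi p \<Longrightarrow> lo q \<le> t \<Longrightarrow> t \<le> hi q \<Longrightarrow> p = q"
    and band_mono: "c \<in> F \<Longrightarrow> d \<in> F \<Longrightarrow> al c t \<Longrightarrow> al d t \<Longrightarrow> \<beta> c t < \<beta> d t \<Longrightarrow> H c t < H d t"
begin

abbreviation "inn p t \<equiv> lo p \<le> t \<and> t \<le> hi p"
abbreviation "ht p t \<equiv> H (cv p) t"
abbreviation "tm a b \<equiv> \<tau> (cv a) (cv b)"

definition touch :: "'s \<Rightarrow> 's \<Rightarrow> bool" where
  "touch a b \<longleftrightarrow> a \<in> S \<and> b \<in> S \<and> (cv a, cv b) \<in> T \<and> inn a (tm a b) \<and> inn b (tm a b)"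

text \<open>A strand starts well if it starts on the left side of the cell or comes from another band,
  that is, unless its curve begins inside the cell.\<close>

definition good_start :: "'s \<Rightarrow> bool" where
  "good_start p \<longleftrightarrow> (\<forall>q\<in>S. lo p \<le> lo q) \<or> (0 < lo p \<and> al (cv p) (lo p - 1) \<and> \<beta> (cv p) (lo p - 1) \<noteq> i)"

definition good_end :: "'s \<Rightarrow> bool" where
  "good_end p \<longleftrightarrow> (\<forall>q\<in>S. hi q \<le> hi p) \<or> (al (cv p) (Suc (hi p)) \<and> \<beta> (cv p) (Suc (hi p)) \<noteq> i)"

definition from_above :: "'s \<Rightarrow> bool" where
  "from_above p \<longleftrightarrow> 0 < lo p \<and> al (cv p) (lo p - 1) \<and> i < \<beta> (cv p) (lo p - 1)"

definition from_below :: "'s \<Rightarrow> bool" where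
  "from_below p \<longleftrightarrow> 0 < lo p \<and> al (cv p) (lo p - 1) \<and> \<beta> (cv p) (lo p - 1) < i"

text \<open>The order along the boundary of the cell, read off from the strand that starts later: a
  later \<open>b\<close> must then rise from below, a later \<open>a\<close> must descend from
  above. For simultaneous starts the witness \<open>s\<close> can be the start itself or the moment
  before it, outside the band. In this form reflection merely exchanges \<open>a\<close> and
  \<open>b\<close>.\<close>

definition enters_before :: "'s \<Rightarrow> 's \<Rightarrow> bool" where
  "enters_before a b \<longleftrightarrow> (lo a < lo b \<longrightarrow> from_below b) \<and> (lo b < lo a \<longrightarrow> from_above a) \<and>
     (lo a = lo b \<longrightarrow> (\<exists>s\<le>lo a. al (cv a) s \<and> al (cv b) s \<and> ht b s < ht a s))"

text \<open>The bands of a cell are integers rather than natural numbers so that the reflection can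
  negate them.\<close>

lemma flip_cell: "cell F al (\<lambda>c t. - H c t) (T\<inverse>) (\<lambda>a b. \<tau> b a) K S cv lo hi (\<lambda>c t. - \<beta> c t) (- i)"
proof -
  interpret f: touching_system F al "\<lambda>c t. - H c t" "T\<inverse>" "\<lambda>a b. \<tau> b a" K by (rule flip)
  show ?thesis
  proof
    show "finite S" by (rule finite_S)
    show "cv p \<in> F" "lo p \<le> hi p" if "p \<in> S" for p using cv_in lo_le_hi that by auto
    show "al (cv p) t" "- \<beta> (cv p) t = - i" if "p \<in> S" "lo p \<le> t" "t \<le> hi p" for p t
      using strand_alive strand_band that by auto
    show "p = q" if "p \<in> S" "q \<in> S" "cv p = cv q" "lo p \<le> t" "t \<le> hi p" "lo q \<le> t" "t \<le> hi q" for p q t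
      using strand_unique that .
    show "- H c t < - H d t" if "c \<in> F" "d \<in> F" "al c t" "al d t" "- \<beta> c t < - \<beta> d t" for c d t
      using band_mono[of d c t] that by simp
  qed
qed

lemma cv_neq: "p \<in> S \<Longrightarrow> q \<in> S \<Longrightarrow> p \<noteq> q \<Longrightarrow> inn p t \<Longrightarrow> inn q t \<Longrightarrow> cv p \<noteq> cv q"
  using strand_unique by blast

lemma ht_neq: "p \<in> S \<Longrightarrow> q \<in> S \<Longrightarrow> p \<noteq> q \<Longrightarrow> inn p t \<Longrightarrow> inn q t \<Longrightarrow> ht p t \<noteq> ht q t"
  using cv_neq height_inj cv_in strand_alive by blast

lemma touch_cv_neq: "touch a b \<Longrightarrow> cv a \<noteq> cv b"
  unfolding touch_def using touch_above touch_alive by force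

lemma touch_above_strand: "touch a b \<Longrightarrow> al (cv a) t \<Longrightarrow> al (cv b) t \<Longrightarrow> ht b t < ht a t"
  unfolding touch_def using touch_above by blast

lemma touch_adj:
  assumes "touch a b" "q \<in> S" "q \<noteq> a" "q \<noteq> b" "inn q (tm a b)"
  shows "ht q (tm a b) < ht b (tm a b) \<or> ht a (tm a b) < ht q (tm a b)"
proof -
  have *: "a \<in> S" "b \<in> S" "inn a (tm a b)" "inn b (tm a b)" "(cv a, cv b) \<in> T" using assms(1) by (auto simp: touch_def)
  have "ht q (tm a b) \<noteq> ht a (tm a b)" "ht q (tm a b) \<noteq> ht b (tm a b)"
    using ht_neq assms * by blast+
  then show ?thesis
    using touch_adjacent[OF *(5), of "cv q"] cv_in[OF assms(2)] strand_alive[OF assms(2)] assms(5) by fastforce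
qed

text \<open>Just before the later strand starts, its curve is in a higher or lower band while the
  other strand is already in the cell. Bands are ordered like heights, so entering first means
  having been above.\<close>

lemma enters_before_order:
  assumes e: "enters_before a b" and "a \<in> S" "b \<in> S" and t: "inn a t" "inn b t"
  obtains s where "s \<le> t" "al (cv a) s" "al (cv b) s" "ht b s < ht a s"
proof -
  consider "lo a < lo b" | "lo b < lo a" | "lo a = lo b" by linarith
  then show thesis
  proof cases
    case 1
    then have f: "from_below b" using e by (simp add: enters_before_def)
    have "inn a (lo b - 1)" using 1 t by auto
    then have "al (cv a) (lo b - 1)" "\<beta> (cv a) (lo b - 1) = i" using strand_alive strand_band assms by blast+
    then have "ht b (lo b - 1) < ht a (lo b - 1)"
      using f band_mono[of "cv b" "cv a" "lo b - 1"] cv_in assms by (auto simp: from_below_def)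
    then show thesis using that[of "lo b - 1"] f \<open>al (cv a) _\<close> t by (auto simp: from_below_def)
  next
    case 2
    then have f: "from_above a" using e by (simp add: enters_before_def)
    have "inn b (lo a - 1)" using 2 t by auto
    then have "al (cv b) (lo a - 1)" "\<beta> (cv b) (lo a - 1) = i" using strand_alive strand_band assms by blast+
    then have "ht b (lo a - 1) < ht a (lo a - 1)"
      using f band_mono[of "cv b" "cv a" "lo a - 1"] cv_in assms by (auto simp: from_above_def)
    then show thesis using that[of "lo a - 1"] f \<open>al (cv b) _\<close> t by (auto simp: from_above_def)
  next
    case 3
    then obtain s where "s \<le> lo a" "al (cv a) s" "al (cv b) s" "ht b s < ht a s"
      using e by (auto simp: enters_before_def)
    then show thesis using that[of s] t by simp
  qed
qed

end

section \<open>Crossings after a touching across a cut of the entry order\<close>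

locale bipartition = cell F al H T \<tau> K S cv lo hi \<beta> i
  for F :: "'c set" and al H T \<tau> K and S :: "'s set" and cv lo hi \<beta> i +
  fixes U L :: "'s set"
  assumes U_sub: "U \<subseteq> S" and L_sub: "L \<subseteq> S" and disjoint: "U \<inter> L = {}"
    and order: "a \<in> U \<Longrightarrow> b \<in> L \<Longrightarrow> enters_before a b"
    and ends: "p \<in> U \<union> L \<Longrightarrow> good_end p"
begin

lemma flip_bipartition:
  "bipartition F al (\<lambda>c t. - H c t) (T\<inverse>) (\<lambda>a b. \<tau> b a) K S cv lo hi (\<lambda>c t. - \<beta> c t) (- i) L U"
proof -
  interpret f: cell F al "\<lambda>c t. - H c t" "T\<inverse>" "\<lambda>a b. \<tau> b a" K S cv lo hi "\<lambda>c t. - \<beta> c t" "- i" by (rule flip_cell)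
  have "f.enters_before b a" if "a \<in> U" "b \<in> L" for a b
    using order[OF that]
    unfolding enters_before_def f.enters_before_def from_below_def from_above_def f.from_below_def f.from_above_def
    by auto
  moreover have "f.good_end p" if "p \<in> L \<union> U" for p
    using ends[of p] that unfolding good_end_def f.good_end_def by auto
  ultimately show ?thesis
    by unfold_locales (use U_sub L_sub disjoint in auto)
qed

text \<open>Since \<open>b\<close> and \<open>b'\<close> exchange their order only once,
  \<open>b\<close> is below \<open>b'\<close> until \<open>s\<close>. If \<open>b'\<close> is in the
  cell when \<open>a\<close> touches \<open>b\<close>, adjacency puts it above \<open>a\<close>,
  although \<open>a\<close> had been above it; so \<open>a\<close> and \<open>b'\<close> have
  already crossed, and from then on \<open>a\<close> is trapped between \<open>b\<close> and
  \<open>b'\<close>: it can neither last until \<open>x\<close> nor leave the band. If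
  \<open>b'\<close> starts later, it comes from below and hence from below \<open>b\<close>. The
  time \<open>x\<close> may be one step after \<open>b'\<close> has left the cell, which
  \<open>up_low_cross\<close> needs.\<close>

lemma low_cross:
  assumes b: "b \<in> L" "b' \<in> L" and a: "a \<in> U" "touch a b"
    and p: "tm a b \<le> s" "s < x" and b': "inn b' s" "x \<le> Suc (hi b')" "al (cv b') x" and x: "x \<le> hi b"
    and h: "ht b s < ht b' s" "ht b' x < ht b x"
  shows False
proof -
  define p where "p = tm a b"
  have S: "a \<in> S" "b \<in> S" "b' \<in> S" using a b U_sub L_sub by auto
  note F = cv_in[OF S(1)] cv_in[OF S(2)] cv_in[OF S(3)]
  have pa: "inn a p" "inn b p" and T: "(cv a, cv b) \<in> T" using a(2) by (auto simp: touch_def p_def)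
  have ps: "p \<le> s" using p p_def by simp
  have bal: "al (cv b) y" if "p \<le> y" "y \<le> x" for y using that pa strand_alive[OF S(2), of y] x by auto
  have b'al: "al (cv b') y" if "lo b' \<le> y" "y \<le> x" for y
    using that b' strand_alive[OF S(3), of y] by (cases "y = x") auto
  have bb: "cv b \<noteq> cv b'" using h by auto
  have L1: "ht b y < ht b' y" if "y \<le> s" "al (cv b) y" "al (cv b') y" for y
  proof (rule ccontr)
    assume "\<not> ?thesis"
    then have *: "ht b' y < ht b y" using height_inj[OF F(2,3) bb] that by force
    then have "y < s" using h that by (cases "y = s") auto
    show False
      by (rule cross_once[OF F(3,2) \<open>y < s\<close> p(2)]) (use * h that b' bal ps p in auto)
  qed
  show False
  proof (cases "lo b' \<le> p")
    case True
    have b'p: "inn b' p" using True ps b' by auto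
    have ab': "a \<noteq> b'" using a b disjoint by auto
    have "b' \<noteq> b" using bb by auto
    have 1: "ht b p < ht b' p" using L1 ps bal b'al True p by auto
    then have 2: "ht a p < ht b' p" using touch_adj[OF a(2) S(3)] ab' \<open>b' \<noteq> b\<close> b'p unfolding p_def by auto
    obtain s0 where s0: "s0 \<le> p" "al (cv a) s0" "al (cv b') s0" "ht b' s0 < ht a s0"
      using enters_before_order[OF order[OF a(1) b(2)] S(1,3) pa(1) b'p] by blast
    then have "s0 < p" using 2 by (cases "s0 = p") auto
    have cab: "cv a \<noteq> cv b'" using 2 by auto
    have L2: "ht a y < ht b' y" if "p < y" "al (cv a) y" "al (cv b') y" for y
    proof (rule ccontr)
      assume "\<not> ?thesis"
      then have *: "ht b' y < ht a y" using height_inj[OF F(1,3) cab] that by force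
      show False
        by (rule cross_once[OF F(3,1) \<open>s0 < p\<close> that(1)]) (use * that s0 2 in auto)
    qed
    have at_x: "\<not> al (cv a) x"
    proof
      assume A: "al (cv a) x"
      have "ht b x < ht a x" using touch_above_strand[OF a(2)] A bal ps p by auto
      moreover have "ht a x < ht b' x" using L2 A b'(3) ps p by auto
      ultimately show False using h by auto
    qed
    then have hia: "hi a < x" using strand_alive[OF S(1), of x] pa ps p by force
    \<comment> \<open>\<open>b\<close> outlasts \<open>a\<close> in the cell, so \<open>a\<close>
      does not stop at the right side: at \<open>?y\<close> it is in another band, yet between two
      strands of this one.\<close>
    let ?y = "Suc (hi a)"
    have e: "al (cv a) ?y" "\<beta> (cv a) ?y \<noteq> i"
      using ends[of a] a(1) S(2) hia x unfolding good_end_def by force+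
    have "?y < x" using hia at_x e(1) by (cases "?y = x") auto
    then have y: "inn b ?y" "inn b' ?y" using pa x b' True by auto
    have "al (cv b) ?y" "al (cv b') ?y" "\<beta> (cv b) ?y = i" "\<beta> (cv b') ?y = i"
      using y strand_alive strand_band S by blast+
    then show False
      using e band_mono[of "cv a" "cv b" ?y] band_mono[of "cv b'" "cv a" ?y] F touch_above_strand[OF a(2), of ?y] L2[of ?y] pa
      by (smt (verit) le_imp_less_Suc linorder_neqE)
  next
    case False
    then have "from_below b'" using order[OF a(1) b(2)] pa by (auto simp: enters_before_def)
    then have e: "al (cv b') (lo b' - 1)" "\<beta> (cv b') (lo b' - 1) < i" by (auto simp: from_below_def)
    have "inn b (lo b' - 1)" using False pa b' p x by auto
    then have "al (cv b) (lo b' - 1)" "\<beta> (cv b) (lo b' - 1) = i" using strand_alive strand_band S by blast+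
    then show False using band_mono[of "cv b'" "cv b" "lo b' - 1"] F e L1[of "lo b' - 1"] b' by force
  qed
qed

text \<open>When \<open>a\<close> touches \<open>b1\<close>, adjacency places \<open>b\<close> below
  \<open>b1\<close>. Once \<open>a\<close> is below \<open>b\<close>, the curve of \<open>b1\<close>
  is lower still, unless \<open>b1\<close> has left through the bottom of the band before; either
  way \<open>b\<close> and \<open>b1\<close>, both in \<open>L\<close>, have exchanged their order,
  contrary to \<open>low_cross\<close>. If the two touchings come in the other order, reflection
  applies.\<close>

lemma up_low_cross:
  assumes a: "a \<in> U" "touch a b1" "b1 \<in> L" and b: "b \<in> L" "touch a1 b" "a1 \<in> U"
    and q: "tm a1 b \<le> tm a b1" "tm a b1 \<le> s" "s < x" and x: "x \<le> hi a" "x \<le> hi b"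
    and h: "ht b s < ht a s" "ht a x < ht b x"
  shows False
proof -
  define q where "q = tm a b1"
  have S: "a \<in> S" "b \<in> S" "b1 \<in> S" using a b U_sub L_sub by auto
  note F = cv_in[OF S(1)] cv_in[OF S(2)] cv_in[OF S(3)]
  have qa: "inn a q" "inn b1 q" using a(2) by (auto simp: touch_def q_def)
  have qs: "q \<le> s" using q q_def by simp
  have bp: "lo b \<le> tm a1 b" using b(2) by (auto simp: touch_def)
  have qb: "inn b q" using bp q x qs by (auto simp: q_def)
  have cab: "cv a \<noteq> cv b" using h by auto
  have aal: "al (cv a) y" "al (cv b) y" if "q \<le> y" "y \<le> x" for y
    using that qa qb strand_alive[OF S(1), of y] strand_alive[OF S(2), of y] x by auto
  have 1: "ht b q < ht a q"
  proof (rule ccontr)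
    assume "\<not> ?thesis"
    then have *: "ht a q < ht b q" using height_inj[OF F(1,2) cab] aal[of q] qs q by force
    then have "q < s" using h qs by (cases "q = s") auto
    show False by (rule cross_once[OF F(1,2) \<open>q < s\<close> q(3)]) (use aal qs q h * in auto)
  qed
  have "b \<noteq> b1" using touch_above_strand[OF a(2), of x] h aal[of x] qs q by force
  moreover have "b \<noteq> a" using cab by auto
  ultimately have 2: "ht b q < ht b1 q" using touch_adj[OF a(2) S(2)] qb 1 unfolding q_def by force
  \<comment> \<open>The witness is \<open>x\<close>, or the moment after \<open>b1\<close> has left
    the cell if that comes first.\<close>
  have "\<exists>z. q < z \<and> z \<le> x \<and> z \<le> Suc (hi b1) \<and> al (cv b1) z \<and> ht b1 z < ht b z"
  proof (cases "x \<le> hi b1")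
    case True
    have "al (cv b1) x" using strand_alive[OF S(3), of x] True qa q qs by auto
    then have "ht b1 x < ht a x" using touch_above_strand[OF a(2)] aal[of x] qs q by auto
    then have "ht b1 x < ht b x" using h by auto
    then show ?thesis using True q qs \<open>al (cv b1) x\<close> by (intro exI[of _ x]) auto
  next
    case False
    let ?y = "Suc (hi b1)"
    have e: "al (cv b1) ?y" "\<beta> (cv b1) ?y \<noteq> i"
      using ends[of b1] a(3) S(1) False x unfolding good_end_def by force+
    have y: "inn a ?y" "inn b ?y" using False qa qb x by auto
    have "al (cv a) ?y" "al (cv b) ?y" "\<beta> (cv a) ?y = i" "\<beta> (cv b) ?y = i"
      using y strand_alive strand_band S by blast+
    moreover have "ht b1 ?y < ht a ?y" using touch_above_strand[OF a(2)] e calculation by auto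
    ultimately have "ht b1 ?y < ht b ?y"
      using e band_mono[of "cv a" "cv b1" ?y] band_mono[of "cv b1" "cv b" ?y] F by (metis linorder_neqE order_less_asym)
    then show ?thesis using False qa e by (intro exI[of _ ?y]) auto
  qed
  then obtain z where z: "q < z" "z \<le> x" "z \<le> Suc (hi b1)" "al (cv b1) z" "ht b1 z < ht b z" by blast
  show False
    by (rule low_cross[OF b(1) a(3) b(3,2), of q z]) (use z q qa 2 x in \<open>auto simp: q_def\<close>)
qed

end

section \<open>Touchings between an initial part and the rest\<close>

context bipartition
begin

lemma up_cross:
  assumes "a \<in> U" "a' \<in> U" and "b \<in> L" "touch a b"
    and "tm a b \<le> s" "s < x" and "inn a' s" "x \<le> hi a'" and "x \<le> hi a"
    and "ht a' s < ht a s" "ht a x < ht a' x"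
  shows False
proof -
  interpret f: bipartition F al "\<lambda>c t. - H c t" "T\<inverse>" "\<lambda>a b. \<tau> b a" K S cv lo hi "\<lambda>c t. - \<beta> c t" "- i" L U
    by (rule flip_bipartition)
  have "f.touch b a" using assms by (auto simp: touch_def f.touch_def)
  moreover have "al (cv a') x" using strand_alive[of a' x] U_sub assms by auto
  ultimately show False
    using f.low_cross[of a a' b s x] assms by auto
qed

lemma up_low_cross':
  assumes a: "a \<in> U" "touch a b1" "b1 \<in> L" and b: "b \<in> L" "touch a1 b" "a1 \<in> U"
    and q: "tm a1 b \<le> s" "tm a b1 \<le> s" "s < x" and x: "x \<le> hi a" "x \<le> hi b"
    and h: "ht b s < ht a s" "ht a x < ht b x"
  shows False
proof (cases "tm a1 b \<le> tm a b1")
  case True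
  then show False using up_low_cross[OF a b True q(2,3) x h] by simp
next
  case False
  interpret f: bipartition F al "\<lambda>c t. - H c t" "T\<inverse>" "\<lambda>a b. \<tau> b a" K S cv lo hi "\<lambda>c t. - \<beta> c t" "- i" L U
    by (rule flip_bipartition)
  have "f.touch b a1" "f.touch b1 a" using a b by (auto simp: touch_def f.touch_def)
  then show False
    using f.up_low_cross[of b a1 a b1 s x] a b q x h False by auto
qed

definition touchings :: "('s \<times> 's) set" where
  "touchings = {(a, b). a \<in> U \<and> b \<in> L \<and> touch a b}"

text \<open>The extreme elements delimit the part of a strand between its first and its last
  touching across the cut. These parts, not the whole strands, are the curves to which
  \<open>noncrossing_touchings\<close> is applied.\<close>

definition times :: "'s \<Rightarrow> nat set" where
  "times p = {tm a b | a b. (a, b) \<in> touchings \<and> (p = a \<or> p = b)}"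

lemma finite_touchings: "finite touchings"
proof (rule finite_subset)
  show "touchings \<subseteq> S \<times> S" using U_sub L_sub by (auto simp: touchings_def)
qed (use finite_S in auto)

lemma finite_times: "finite (times p)"
proof (rule finite_subset)
  show "times p \<subseteq> (\<lambda>(a, b). tm a b) ` touchings" by (force simp: times_def)
qed (use finite_touchings in auto)

lemma times_inn: "t \<in> times p \<Longrightarrow> inn p t"
  by (auto simp: times_def touchings_def touch_def)

lemma active:
  assumes "p \<in> fst ` touchings \<union> snd ` touchings"
  shows "times p \<noteq> {}" "p \<in> U \<union> L" "p \<in> S"
  using assms U_sub L_sub by (fastforce simp: times_def touchings_def)+

lemma hull_inn:
  assumes "p \<in> fst ` touchings \<union> snd ` touchings" "Min (times p) \<le> t" "t \<le> Max (times p)"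
  shows "inn p t"
  using times_inn[of "Min (times p)" p] times_inn[of "Max (times p)" p] active(1)[OF assms(1)] finite_times[of p] assms
    Min_in[of "times p"] Max_in[of "times p"] by linarith

lemma hull_touch:
  assumes "p \<in> fst ` touchings \<union> snd ` touchings"
  obtains a b where "(a, b) \<in> touchings" "p = a \<or> p = b" "tm a b = Min (times p)"
  using Min_in[OF finite_times active(1)[OF assms]] by (fastforce simp: times_def)

lemma hulls_noncrossing:
  assumes p: "p \<in> fst ` touchings \<union> snd ` touchings" and q: "q \<in> fst ` touchings \<union> snd ` touchings"
    and s: "Min (times p) \<le> s" "s \<le> Max (times p)" "Min (times q) \<le> s" "s \<le> Max (times q)"
    and x: "Min (times p) \<le> x" "x \<le> Max (times p)" "Min (times q) \<le> x" "x \<le> Max (times q)"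
    and sx: "s < x" and h: "ht p s < ht q s" "ht q x < ht p x"
  shows False
proof -
  have S: "p \<in> S" "q \<in> S" using active p q by auto
  note inns = hull_inn[OF p s(1,2)] hull_inn[OF p x(1,2)] hull_inn[OF q s(3,4)] hull_inn[OF q x(3,4)]
  have als: "al (cv p) x" "al (cv p) s" "al (cv q) s" "al (cv q) x" using inns strand_alive S by blast+
  obtain a b where ab: "(a, b) \<in> touchings" "p = a \<or> p = b" "tm a b = Min (times p)"
    using hull_touch[OF p] .
  obtain c d where cd: "(c, d) \<in> touchings" "q = c \<or> q = d" "tm c d = Min (times q)"
    using hull_touch[OF q] .
  have UL: "a \<in> U" "b \<in> L" "touch a b" "c \<in> U" "d \<in> L" "touch c d" using ab cd by (auto simp: touchings_def)
  consider "p = a" "q = c" | "p = a" "q = d" | "p = b" "q = c" | "p = b" "q = d" using ab cd by blast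
  then show False
  proof cases
    case 1
    then show False
      using up_cross[of c a d s x] UL inns sx h s cd by auto
  next
    \<comment> \<open>An upper strand that is below a lower one has crossed it since they entered,
      and cannot cross back.\<close>
    case 2
    obtain s0 where s0: "s0 \<le> s" "al (cv p) s0" "al (cv q) s0" "ht q s0 < ht p s0"
      using enters_before_order[OF order[of p q] S inns(1,3)] 2 UL by blast
    then have "s0 < s" using h by (cases "s0 = s") auto
    then show False
      using cross_once[of "cv q" "cv p" s0 s x] s0 als h sx cv_in S by auto
  next
    case 3
    then show False
      using up_low_cross'[of c d b a s x] UL inns sx h s ab cd by auto
  next
    case 4
    then show False
      using low_cross[of b d a s x] UL inns sx h s ab als by auto
  qed
qed

lemma card_bipartite_touchings: "card touchings \<le> 2 * (card U + card L)"
proof -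
  let ?U = "fst ` touchings" and ?L = "snd ` touchings"
  have sub: "?U \<subseteq> U" "?L \<subseteq> L" by (auto simp: touchings_def)
  have fin: "finite U" "finite L" using U_sub L_sub finite_S finite_subset by blast+
  have mem: "a \<in> ?U \<union> ?L" "b \<in> ?U \<union> ?L" "touch a b" "a \<noteq> b" if "(a, b) \<in> touchings" for a b
    using that disjoint by (force simp: touchings_def)+
  have time: "tm a b \<in> times a" "tm a b \<in> times b" if "(a, b) \<in> touchings" for a b
    using that by (auto simp: times_def)
  interpret N: noncrossing_touchings ?U ?L touchings "\<lambda>p t. ht p t" "\<lambda>a b. tm a b" "\<lambda>p. Min (times p)" "\<lambda>p. Max (times p)"
  proof
    show "finite ?U" "finite ?L" using finite_touchings by auto
    show "?U \<inter> ?L = {}" using sub disjoint by blast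
    show "touchings \<subseteq> ?U \<times> ?L" by force
    show "Min (times a) \<le> tm a b \<and> tm a b \<le> Max (times a) \<and> Min (times b) \<le> tm a b \<and> tm a b \<le> Max (times b)"
      if "(a, b) \<in> touchings" for a b
      using time[OF that] finite_times by auto
    show "\<exists>c. (c, b) \<in> touchings \<and> tm c b = Min (times b)" if ab: "(a, b) \<in> touchings" for a b
    proof -
      have "b \<in> L" using ab by (auto simp: touchings_def)
      obtain c d where cd: "(c, d) \<in> touchings" "b = c \<or> b = d" "tm c d = Min (times b)"
        using hull_touch[OF mem(2)[OF ab]] .
      then have "b = d" using \<open>b \<in> L\<close> disjoint by (auto simp: touchings_def)
      then show ?thesis using cd by auto
    qed
    show "\<exists>c. (a, c) \<in> touchings \<and> tm a c = Min (times a)" if ab: "(a, b) \<in> touchings" for a b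
    proof -
      have "a \<in> U" using ab by (auto simp: touchings_def)
      obtain c d where cd: "(c, d) \<in> touchings" "a = c \<or> a = d" "tm c d = Min (times a)"
        using hull_touch[OF mem(1)[OF ab]] .
      then have "a = c" using \<open>a \<in> U\<close> disjoint by (auto simp: touchings_def)
      then show ?thesis using cd by auto
    qed
    show "ht b t < ht a t" if "(a, b) \<in> touchings" "Min (times a) \<le> t" "t \<le> Max (times a)"
      "Min (times b) \<le> t" "t \<le> Max (times b)" for a b t
    proof -
      have "al (cv a) t" "al (cv b) t" using hull_inn mem[OF that(1)] active that strand_alive by meson+
      then show ?thesis using touch_above_strand[OF mem(3)[OF that(1)]] by blast
    qed
    show "ht q (tm a b) < ht b (tm a b) \<or> ht a (tm a b) < ht q (tm a b)"
      if "(a, b) \<in> touchings" "q \<in> ?U \<union> ?L" "q \<noteq> a" "q \<noteq> b" "Min (times q) \<le> tm a b" "tm a b \<le> Max (times q)" for a b q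
      using touch_adj[OF mem(3)[OF that(1)] active(3)[OF that(2)] that(3,4) hull_inn[OF that(2,5,6)]] .
    show neq: "ht p s \<noteq> ht q s"
      if "p \<in> ?U \<union> ?L" "q \<in> ?U \<union> ?L" "p \<noteq> q" "Min (times p) \<le> s" "s \<le> Max (times p)" "Min (times q) \<le> s" "s \<le> Max (times q)"
      for p q s
      using ht_neq[OF active(3)[OF that(1)] active(3)[OF that(2)] that(3) hull_inn[OF that(1,4,5)] hull_inn[OF that(2,6,7)]] .
    show "ht p x < ht q x"
      if "p \<in> ?U \<union> ?L" "q \<in> ?U \<union> ?L" "p \<noteq> q"
        "Min (times p) \<le> s" "s \<le> Max (times p)" "Min (times q) \<le> s" "s \<le> Max (times q)"
        "Min (times p) \<le> x" "x \<le> Max (times p)" "Min (times q) \<le> x" "x \<le> Max (times q)" "ht p s < ht q s"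
      for p q s x
    proof (rule ccontr)
      assume "\<not> ?thesis"
      then have *: "ht q x < ht p x" using neq[OF that(1-3,8-11)] by simp
      consider "s = x" | "s < x" | "x < s" by linarith
      then show False
      proof cases
        case 2 then show False using hulls_noncrossing[OF that(1,2,4-11) 2 that(12) *] by simp
      next
        case 3 then show False using hulls_noncrossing[OF that(2,1,10,11,8,9,6,7,4,5) 3 * that(12)] by simp
      qed (use * that in auto)
    qed
  qed
  have "card touchings \<le> 2 * (card ?U + card ?L)" by (rule N.card_touchings)
  also have "\<dots> \<le> 2 * (card U + card L)" using sub fin by (meson add_mono card_mono mult_le_mono2)
  finally show ?thesis .
qed

end

section \<open>Touchings in a cell\<close>

lemma initial_part:
  fixes key :: "'a \<Rightarrow> 'k::linorder"
  assumes "finite A" "inj_on key A" "m \<le> card A"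
  shows "\<exists>B\<subseteq>A. card B = m \<and> (\<forall>a\<in>B. \<forall>b\<in>A - B. key a < key b)"
  using assms(3)
proof (induction m)
  case 0
  then show ?case by (intro exI[of _ "{}"]) auto
next
  case (Suc m)
  then obtain B where B: "B \<subseteq> A" "card B = m" "\<forall>a\<in>B. \<forall>b\<in>A - B. key a < key b" by auto
  have "A - B \<noteq> {}" using B Suc.prems by auto
  then have "Min (key ` (A - B)) \<in> key ` (A - B)" using assms(1) by simp
  then obtain c where c: "c \<in> A - B" "key c = Min (key ` (A - B))" by auto
  have "key c < key b" if "b \<in> A - insert c B" for b
  proof -
    have "key c \<le> key b" using c that assms(1) by auto
    moreover have "key c \<noteq> key b" using inj_onD[OF assms(2), of c b] c that by auto
    ultimately show ?thesis by simp
  qed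
  moreover have "card (insert c B) = Suc m" using B c assms(1) finite_subset by (metis DiffD2 card_insert_disjoint)
  ultimately show ?case using B c by (intro exI[of _ "insert c B"]) auto
qed

lemma four_increasing:
  fixes key :: "'a \<Rightarrow> 'k::linorder"
  assumes "finite A" "inj_on key A" "4 \<le> card A"
  shows "\<exists>a\<in>A. \<exists>b\<in>A. \<exists>c\<in>A. \<exists>d\<in>A. key a < key b \<and> key b < key c \<and> key c < key d"
proof -
  define xs where "xs = sorted_list_of_set (key ` A)"
  have len: "4 \<le> length xs" using assms by (simp add: xs_def card_image)
  have "sorted_wrt (<) xs" by (simp add: xs_def)
  then have lt: "xs ! 0 < xs ! 1" "xs ! 1 < xs ! 2" "xs ! 2 < xs ! 3"
    using len by (auto simp: sorted_wrt_iff_nth_less)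
  have "set xs = key ` A" using assms by (simp add: xs_def)
  then have "xs ! i \<in> key ` A" if "i < 4" for i using len that nth_mem[of i xs] by auto
  from this[of 0] this[of 1] this[of 2] this[of 3] obtain a b c d where
    "a \<in> A" "b \<in> A" "c \<in> A" "d \<in> A" "xs ! 0 = key a" "xs ! 1 = key b" "xs ! 2 = key c" "xs ! 3 = key d"
    by auto
  then show ?thesis using lt by metis
qed

text \<open>The Kovari-Sos-Turan count of pairs of distinct neighbours. A degree \<open>d\<close>
  above \<open>1 + s\<close> is paid for by \<open>d * (d - 1) / s\<close>; the free parameter
  \<open>s\<close> leaves the balancing of the two terms to the application.\<close>

lemma few_common_neighbours:
  fixes R :: "'a \<Rightarrow> 'b \<Rightarrow> bool" and s :: real
  assumes fin: "finite X" "finite Y" and s: "0 < s"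
    and common: "\<And>y y'. y \<in> Y \<Longrightarrow> y' \<in> Y \<Longrightarrow> y \<noteq> y' \<Longrightarrow> card {x \<in> X. R x y \<and> R x y'} \<le> m"
  shows "real (card {(x, y). x \<in> X \<and> y \<in> Y \<and> R x y}) \<le> real (card X) * (1 + s) + real m * (real (card Y))\<^sup>2 / s"
proof -
  define D where "D x = {y \<in> Y. R x y}" for x
  define d where "d x = real (card (D x))" for x
  have fD: "finite (D x)" for x using fin by (simp add: D_def)
  have "{(x, y). x \<in> X \<and> y \<in> Y \<and> R x y} = Sigma X D" by (auto simp: D_def)
  then have E: "real (card {(x, y). x \<in> X \<and> y \<in> Y \<and> R x y}) = (\<Sum>x\<in>X. d x)"
    using fin fD by (simp add: d_def)
  have pairs: "d x * (d x - 1) = (\<Sum>z\<in>Y \<times> Y. of_bool (fst z \<noteq> snd z \<and> R x (fst z) \<and> R x (snd z)))" for x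
  proof -
    have "(\<Sum>z\<in>Y \<times> Y. of_bool (fst z \<noteq> snd z \<and> R x (fst z) \<and> R x (snd z)) :: real) =
      real (card ((Y \<times> Y) \<inter> {z. fst z \<noteq> snd z \<and> R x (fst z) \<and> R x (snd z)}))"
      using fin by (subst sum_of_bool_eq) auto
    also have "(Y \<times> Y) \<inter> {z. fst z \<noteq> snd z \<and> R x (fst z) \<and> R x (snd z)} = D x \<times> D x - (\<lambda>y. (y, y)) ` D x"
      by (auto simp: D_def)
    also have "card \<dots> = card (D x) * card (D x) - card (D x)"
      using fD[of x] by (subst card_Diff_subset) (auto simp: card_cartesian_product card_image inj_on_def)
    also have "real \<dots> = d x * (d x - 1)"
      unfolding d_def by (cases "card (D x)") (auto simp: algebra_simps)
    finally show ?thesis by simp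
  qed
  have "(\<Sum>x\<in>X. d x * (d x - 1)) =
    (\<Sum>z\<in>Y \<times> Y. \<Sum>x\<in>X. of_bool (fst z \<noteq> snd z \<and> R x (fst z) \<and> R x (snd z)))"
    unfolding pairs by (rule sum.swap)
  also have "\<dots> \<le> (\<Sum>z\<in>Y \<times> Y. real m)"
  proof (rule sum_mono)
    fix z assume z: "z \<in> Y \<times> Y"
    have "(\<Sum>x\<in>X. of_bool (fst z \<noteq> snd z \<and> R x (fst z) \<and> R x (snd z)) :: real) =
      real (card (X \<inter> {x. fst z \<noteq> snd z \<and> R x (fst z) \<and> R x (snd z)}))"
      using fin by (subst sum_of_bool_eq) auto
    also have "\<dots> \<le> real m"
    proof (cases "fst z = snd z")
      case False
      have "X \<inter> {x. fst z \<noteq> snd z \<and> R x (fst z) \<and> R x (snd z)} = {x \<in> X. R x (fst z) \<and> R x (snd z)}"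
        using False by auto
      then show ?thesis using common[of "fst z" "snd z"] z False by auto
    qed auto
    finally show "(\<Sum>x\<in>X. of_bool (fst z \<noteq> snd z \<and> R x (fst z) \<and> R x (snd z)) :: real) \<le> real m" .
  qed
  also have "\<dots> = real m * (real (card Y))\<^sup>2" by (simp add: card_cartesian_product power2_eq_square)
  finally have sq: "(\<Sum>x\<in>X. d x * (d x - 1)) \<le> real m * (real (card Y))\<^sup>2" .
  have "d x \<le> 1 + s + d x * (d x - 1) / s" for x
  proof (cases "d x \<le> 1 + s")
    case True
    have "0 \<le> d x * (d x - 1)" unfolding pairs by (rule sum_nonneg) auto
    then show ?thesis using True s by (smt (verit) divide_nonneg_pos)
  next
    case False
    then have "d x * s \<le> d x * (d x - 1)" using s by (intro mult_left_mono) auto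
    then have "d x \<le> d x * (d x - 1) / s" using s by (simp add: pos_le_divide_eq)
    then show ?thesis using s by linarith
  qed
  then have "(\<Sum>x\<in>X. d x) \<le> (\<Sum>x\<in>X. 1 + s + d x * (d x - 1) / s)" by (rule sum_mono)
  also have "\<dots> = real (card X) * (1 + s) + (\<Sum>x\<in>X. d x * (d x - 1)) / s"
    by (simp add: sum.distrib sum_divide_distrib)
  also have "\<dots> \<le> real (card X) * (1 + s) + real m * (real (card Y))\<^sup>2 / s"
    using sq s by (simp add: divide_right_mono)
  finally show ?thesis using E by simp
qed

section \<open>Entry order and touchings with passing strands\<close>

context cell
begin

text \<open>A coordinate on the boundary, walked from the upper right over the left side to the
  lower right: negative on the upper side, where later starts come first, 0 on the left side,
  positive on the lower side. For a strand whose curve begins inside the cell the value is a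
  default; order and injectivity are claimed for good starts.\<close>

definition entry_pos :: "'s \<Rightarrow> int" where
  "entry_pos p = (if \<forall>q\<in>S. lo p \<le> lo q then 0 else if from_above p then - int (lo p) else int (lo p))"

text \<open>The arctangent term is less than \<open>1/2\<close> in absolute value and only breaks ties.\<close>

definition entry_key :: "'s \<Rightarrow> real" where
  "entry_key p = of_int (entry_pos p) - arctan (ht p (lo p)) / 4"

lemma arctan_quarter: "\<bar>arctan x / 4\<bar> < 1 / 2"
proof -
  have "pi / 2 < 2" using pi_less_4 by simp
  then show ?thesis using arctan_bounded[of x] by (simp add: abs_less_iff)
qed

lemma entry_key_less:
  assumes "entry_key p < entry_key q"
  shows "entry_pos p < entry_pos q \<or> entry_pos p = entry_pos q \<and> ht q (lo q) < ht p (lo p)"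
proof (cases "entry_pos p = entry_pos q")
  case True
  then show ?thesis using assms by (simp add: entry_key_def arctan_less_iff)
next
  case False
  have "of_int (entry_pos p) < (of_int (entry_pos q) :: real) + 1"
    using assms arctan_quarter[of "ht p (lo p)"] arctan_quarter[of "ht q (lo q)"] unfolding entry_key_def by linarith
  then show ?thesis using False by linarith
qed

lemma entry_key_eq:
  assumes "entry_key p = entry_key q"
  shows "entry_pos p = entry_pos q" "ht p (lo p) = ht q (lo q)"
proof -
  show *: "entry_pos p = entry_pos q"
    using assms arctan_quarter[of "ht p (lo p)"] arctan_quarter[of "ht q (lo q)"] unfolding entry_key_def by linarith
  show "ht p (lo p) = ht q (lo q)" using assms * by (simp add: entry_key_def arctan_eq_iff)
qed

lemma enters_before_key:
  assumes S: "p \<in> S" "q \<in> S" and st: "good_start p" "good_start q" and k: "entry_key p < entry_key q"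
  shows "enters_before p q"
proof -
  have inn: "inn p (lo p)" "inn q (lo q)" using lo_le_hi S by auto
  have al: "al (cv p) (lo p)" "al (cv q) (lo q)" using strand_alive S inn by blast+
  let ?Lp = "\<forall>r\<in>S. lo p \<le> lo r" and ?Lq = "\<forall>r\<in>S. lo q \<le> lo r"
  have np: "\<not> ?Lp \<Longrightarrow> from_above p \<or> from_below p" and nq: "\<not> ?Lq \<Longrightarrow> from_above q \<or> from_below q"
    using st unfolding good_start_def from_above_def from_below_def by auto
  have pos: "from_above p \<Longrightarrow> 0 < lo p" "from_below p \<Longrightarrow> 0 < lo p" "from_above q \<Longrightarrow> 0 < lo q" "from_below q \<Longrightarrow> 0 < lo q"
    by (auto simp: from_above_def from_below_def)
  have a: "from_below q" if "lo p < lo q"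
  proof -
    have "\<not> ?Lq" using that S by force
    moreover have "\<not> from_above q"
    proof
      assume f: "from_above q"
      then have "entry_pos q = - int (lo q)" using \<open>\<not> ?Lq\<close> by (auto simp: entry_pos_def)
      moreover have "entry_pos p \<ge> - int (lo p)" by (auto simp: entry_pos_def)
      moreover have "entry_pos p \<le> entry_pos q" using entry_key_less[OF k] by auto
      ultimately show False using that by linarith
    qed
    ultimately show ?thesis using nq by blast
  qed
  have b: "from_above p" if "lo q < lo p"
  proof -
    have "\<not> ?Lp" using that S by force
    moreover have False if "\<not> from_above p"
    proof -
      have "entry_pos p = int (lo p)" using that \<open>\<not> ?Lp\<close> by (auto simp: entry_pos_def)
      moreover have "entry_pos q \<le> int (lo q)" by (auto simp: entry_pos_def)
      moreover have "entry_pos p \<le> entry_pos q" using entry_key_less[OF k] by auto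
      ultimately show False using \<open>lo q < lo p\<close> by linarith
    qed
    ultimately show ?thesis by blast
  qed
  have c: "\<exists>s\<le>lo p. al (cv p) s \<and> al (cv q) s \<and> ht q s < ht p s" if e: "lo p = lo q"
  proof (cases "entry_pos p = entry_pos q")
    case True
    then have "ht q (lo q) < ht p (lo p)" using entry_key_less[OF k] by auto
    then show ?thesis using al e by auto
  next
    case False
    \<comment> \<open>With equal starts but different positions, one strand comes from above and the
      other from below, so one step earlier they are on the two sides of the band.\<close>
    then have lt: "entry_pos p < entry_pos q" using entry_key_less[OF k] by auto
    have "\<not> ?Lp" "\<not> ?Lq" using lt e by (auto simp: entry_pos_def split: if_splits)
    then have "from_above p" "\<not> from_above q" using lt e by (auto simp: entry_pos_def split: if_splits)
    then have f: "from_above p" "from_below q" using nq \<open>\<not> ?Lq\<close> by auto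
    then have "ht q (lo p - 1) < ht p (lo p - 1)"
      using band_mono[of "cv q" "cv p" "lo p - 1"] cv_in S e by (auto simp: from_above_def from_below_def)
    then show ?thesis using f e by (intro exI[of _ "lo p - 1"]) (auto simp: from_above_def from_below_def)
  qed
  show ?thesis unfolding enters_before_def using a b c by blast
qed

lemma inj_on_entry_key:
  assumes "A \<subseteq> S" "\<And>p. p \<in> A \<Longrightarrow> good_start p"
  shows "inj_on entry_key A"
proof (rule inj_onI)
  fix p q assume pq: "p \<in> A" "q \<in> A" and k: "entry_key p = entry_key q"
  have S: "p \<in> S" "q \<in> S" using assms pq by auto
  have lo: "lo p = lo q"
  proof (cases "entry_pos p = 0")
    case True
    have "\<forall>r\<in>S. lo x \<le> lo r" if "x \<in> A" "entry_pos x = 0" for x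
      using assms(2)[OF that(1)] that(2) by (auto simp: entry_pos_def good_start_def split: if_splits)
    from this[OF pq(1) True] this[OF pq(2)] show ?thesis using entry_key_eq[OF k] True S by (simp add: order_antisym)
  next
    case False
    then show ?thesis using entry_key_eq(1)[OF k] by (auto simp: entry_pos_def split: if_splits)
  qed
  then show "p = q" using entry_key_eq(2)[OF k] ht_neq[OF S, of "lo p"] lo_le_hi[OF S(1)] lo_le_hi[OF S(2)] by auto
qed

text \<open>Divide and conquer along the order in which the strands enter the cell: from above from right
  to left, from the left side downwards, from below from left to right.\<close>

lemma card_passing_touchings:
  assumes "A \<subseteq> S" "\<And>p. p \<in> A \<Longrightarrow> good_start p \<and> good_end p" "card A \<le> 2 ^ k"
  shows "card {(a, b). a \<in> A \<and> b \<in> A \<and> touch a b} \<le> 2 * k * card A"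
  using assms
proof (induction k arbitrary: A)
  case 0
  have fA: "finite A" using 0 finite_S finite_subset by blast
  have "\<not> touch a b" if "a \<in> A" "b \<in> A" for a b
  proof -
    have "a = b" using that 0(3) fA card_le_Suc0_iff_eq by auto
    then show ?thesis using touch_cv_neq by auto
  qed
  then have e: "{(a, b). a \<in> A \<and> b \<in> A \<and> touch a b} = {}" by auto
  show ?case unfolding e by simp
next
  case (Suc k)
  have fA: "finite A" using Suc.prems finite_S finite_subset by blast
  obtain B where B: "B \<subseteq> A" "card B = min (2 ^ k) (card A)" "\<forall>a\<in>B. \<forall>b\<in>A - B. entry_key a < entry_key b"
    using initial_part[OF fA inj_on_entry_key, of "min (2 ^ k) (card A)"] Suc.prems by auto
  define C where "C = A - B"
  have fB: "finite B" "finite C" using fA B finite_subset by (auto simp: C_def)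
  have cA: "card A = card B + card C" using B fA fB by (simp add: C_def card_Diff_subset card_mono)
  have "card C \<le> 2 ^ k" using cA B(2) Suc.prems(3) by auto
  have eb: "enters_before a b" if "a \<in> B" "b \<in> C" for a b
    using enters_before_key[of a b] B that Suc.prems by (auto simp: C_def)
  interpret bipartition F al H T \<tau> K S cv lo hi \<beta> i B C
  proof
    show "B \<subseteq> S" "C \<subseteq> S" "B \<inter> C = {}" using B Suc.prems(1) by (auto simp: C_def)
    show "enters_before a b" if "a \<in> B" "b \<in> C" for a b using eb that .
    show "good_end p" if "p \<in> B \<union> C" for p using Suc.prems(2)[of p] that B by (auto simp: C_def)
  qed
  \<comment> \<open>Touchings go only one way across the cut: a strand of \<open>B\<close> has at
    some time been above the strand of \<open>C\<close>, and touching partners never exchange their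
    order.\<close>
  have no: "\<not> touch c b" if cb: "c \<in> C" "b \<in> B" for b c
  proof
    assume t: "touch c b"
    then have inn: "c \<in> S" "b \<in> S" "inn c (tm c b)" "inn b (tm c b)" by (auto simp: touch_def)
    obtain s where "al (cv b) s" "al (cv c) s" "ht c s < ht b s"
      using enters_before_order[OF eb[OF cb(2,1)] inn(2,1,4,3)] by blast
    then show False using touch_above_strand[OF t, of s] by auto
  qed
  let ?P = "\<lambda>X. {(a, b). a \<in> X \<and> b \<in> X \<and> touch a b}"
  have "x \<in> B \<or> x \<in> C" if "x \<in> A" for x using that by (auto simp: C_def)
  then have "?P A \<subseteq> ?P B \<union> ?P C \<union> touchings"
    using no by (auto simp: touchings_def)
  moreover have fP: "finite (?P X)" if "finite X" for X
    by (rule finite_subset[of _ "X \<times> X"]) (use that in auto)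
  ultimately have "card (?P A) \<le> card (?P B \<union> ?P C \<union> touchings)"
    using fB finite_touchings by (intro card_mono) auto
  also have "\<dots> \<le> card (?P B) + card (?P C) + card touchings"
    by (meson add_mono_thms_linordered_semiring(3) card_Un_le order_trans)
  also have "\<dots> \<le> 2 * k * card B + 2 * k * card C + 2 * (card B + card C)"
  proof -
    have "card (?P B) \<le> 2 * k * card B" by (rule Suc.IH) (use Suc.prems B in auto)
    moreover have "card (?P C) \<le> 2 * k * card C"
      by (rule Suc.IH) (use Suc.prems B \<open>card C \<le> 2 ^ k\<close> in \<open>auto simp: C_def\<close>)
    ultimately show ?thesis using card_bipartite_touchings by linarith
  qed
  also have "\<dots> = 2 * Suc k * card A" using cA by (simp add: algebra_simps)
  finally show ?case .
qed

text \<open>At its own touching \<open>a'\<close> is the upper neighbour of \<open>b'\<close> and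
  thus below \<open>a\<close>. At the touchings of \<open>a\<close> before and after, adjacency
  makes \<open>a'\<close> pass above \<open>a\<close>. If \<open>a'\<close> is not in the cell then,
  it enters or leaves through the top, because it never gets below \<open>b\<close> or
  \<open>b''\<close>, and is again above \<open>a\<close>. So \<open>a\<close> and \<open>a'\<close>
  would exchange their order twice.\<close>

lemma no_interleaving:
  assumes a: "a \<in> S" "a' \<in> S" "a \<noteq> a'" and good: "good_start a'" "good_end a'"
    and t: "touch a b" "touch a b''" "tm a b < tm a' b'" "tm a' b' < tm a b''"
    and t': "touch a' b" "touch a' b''" "touch a' b'" and b': "b' = b \<or> b' = b''"
  shows False
proof -
  define s s' s'' where "s = tm a b" "s' = tm a' b'" "s'' = tm a b''"
  have lt: "s < s'" "s' < s''" using t by (auto simp: s_s'_s''_def)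
  have bS: "b \<in> S" "b'' \<in> S" "b' \<in> S" using t' by (auto simp: touch_def)
  have inn: "inn a s" "inn a s''" "inn b s" "inn b'' s''" "inn a' s'" "inn b' s'"
    using t t' by (auto simp: touch_def s_s'_s''_def)
  have as': "inn a s'" using inn lt by auto
  have cv: "cv a \<noteq> cv a'" using cv_neq[OF a as' inn(5)] .
  have "touch a b'" using b' t by auto
  have mid: "ht a' s' < ht a s'"
  proof -
    have "ht b' s' < ht a s'"
      using touch_above_strand[OF \<open>touch a b'\<close>] strand_alive a bS as' inn by blast
    moreover have "a \<noteq> b'" using touch_cv_neq[OF \<open>touch a b'\<close>] by auto
    ultimately show ?thesis using touch_adj[OF t'(3) a(1) a(3)] as' by (auto simp: s_s'_s''_def)
  qed
  have left: "\<exists>y<s'. al (cv a) y \<and> al (cv a') y \<and> ht a y < ht a' y"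
  proof (cases "lo a' \<le> s")
    case True
    then have i': "inn a' s" using lt inn by auto
    have "ht b s < ht a' s" using touch_above_strand[OF t'(1)] strand_alive a bS i' inn by blast
    moreover have "a' \<noteq> b" using touch_cv_neq[OF t'(1)] by auto
    ultimately have "ht a s < ht a' s"
      using touch_adj[OF t(1) a(2)] i' a(3) by (auto simp: s_s'_s''_def)
    then show ?thesis using lt strand_alive a i' inn by blast
  next
    case False
    then have e: "al (cv a') (lo a' - 1)" "\<beta> (cv a') (lo a' - 1) \<noteq> i"
      using good(1) a(1) inn unfolding good_start_def by force+
    have "lo a' \<le> hi b" using t'(1) by (auto simp: touch_def)
    then have y: "inn a (lo a' - 1)" "inn b (lo a' - 1)" "lo a' - 1 < s'" using False inn lt by auto
    have f: "al (cv a) (lo a' - 1)" "al (cv b) (lo a' - 1)" "\<beta> (cv a) (lo a' - 1) = i" "\<beta> (cv b) (lo a' - 1) = i"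
      using strand_alive strand_band a bS y by blast+
    have "ht b (lo a' - 1) < ht a' (lo a' - 1)" using touch_above_strand[OF t'(1)] e f by blast
    then have "i < \<beta> (cv a') (lo a' - 1)"
      using e f band_mono[of "cv a'" "cv b" "lo a' - 1"] cv_in a bS by (metis linorder_neqE order_less_asym)
    then have "ht a (lo a' - 1) < ht a' (lo a' - 1)"
      using e f band_mono[of "cv a" "cv a'" "lo a' - 1"] cv_in a by auto
    then show ?thesis using y e f by blast
  qed
  have right: "\<exists>y>s'. al (cv a) y \<and> al (cv a') y \<and> ht a y < ht a' y"
  proof (cases "s'' \<le> hi a'")
    case True
    then have i': "inn a' s''" using lt inn by auto
    have "ht b'' s'' < ht a' s''" using touch_above_strand[OF t'(2)] strand_alive a bS i' inn by blast
    moreover have "a' \<noteq> b''" using touch_cv_neq[OF t'(2)] by auto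
    ultimately have "ht a s'' < ht a' s''"
      using touch_adj[OF t(2) a(2)] i' a(3) by (auto simp: s_s'_s''_def)
    then show ?thesis using lt strand_alive a i' inn by blast
  next
    case False
    let ?y = "Suc (hi a')"
    from False have e: "al (cv a') ?y" "\<beta> (cv a') ?y \<noteq> i"
      using good(2) a(1) inn unfolding good_end_def by force+
    have "lo b'' \<le> hi a'" using t'(2) by (auto simp: touch_def)
    then have y: "inn a ?y" "inn b'' ?y" "s' < ?y" using False inn lt by auto
    have f: "al (cv a) ?y" "al (cv b'') ?y" "\<beta> (cv a) ?y = i" "\<beta> (cv b'') ?y = i"
      using strand_alive strand_band a bS y by blast+
    have "ht b'' ?y < ht a' ?y" using touch_above_strand[OF t'(2)] e f by blast
    then have "i < \<beta> (cv a') ?y"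
      using e f band_mono[of "cv a'" "cv b''" ?y] cv_in a bS by (metis linorder_neqE order_less_asym)
    then have "ht a ?y < ht a' ?y"
      using e f band_mono[of "cv a" "cv a'" ?y] cv_in a by auto
    then show ?thesis using y e f by blast
  qed
  obtain y z where "y < s'" "al (cv a) y" "al (cv a') y" "ht a y < ht a' y"
    "s' < z" "al (cv a) z" "al (cv a') z" "ht a z < ht a' z" using left right by blast
  then show False using cross_once[of "cv a" "cv a'" y s' z] mid cv_in a by auto
qed

text \<open>At a common time adjacency would place each of \<open>a\<close> and \<open>a'\<close>
  above the other.\<close>

lemma touch_times_neq:
  assumes "a \<noteq> a'" "touch a b" "touch a' b'" "touch a b'" "touch a' b"
  shows "tm a b \<noteq> tm a' b'"
proof
  assume e: "tm a b = tm a' b'"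
  let ?t = "tm a b"
  have S: "a \<in> S" "a' \<in> S" "b \<in> S" "b' \<in> S" using assms by (auto simp: touch_def)
  have inn: "inn a ?t" "inn b ?t" "inn a' ?t" "inn b' ?t" using assms(2,3) e by (auto simp: touch_def)
  then have al: "al (cv a) ?t" "al (cv b) ?t" "al (cv a') ?t" "al (cv b') ?t" using strand_alive S by blast+
  have "a \<noteq> b'" "a' \<noteq> b" using assms touch_cv_neq by auto
  then have "ht a ?t < ht a' ?t" "ht a' ?t < ht a ?t"
    using touch_adj[OF assms(2) S(2)] touch_adj[OF assms(3) S(1)] e inn assms(1)
      touch_above_strand[OF assms(5) al(3,2)] touch_above_strand[OF assms(4) al(1,4)] by auto
  then show False by simp
qed

text \<open>By \<open>no_interleaving\<close>, of four such strands each has both its touchings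
  before those of the next. Whichever of \<open>b\<close> and \<open>b'\<close> is being touched
  lies above the other, so the touchings of the two middle strands force \<open>b\<close> and
  \<open>b'\<close> to exchange their order twice. The outer two strands guarantee that
  \<open>b\<close> and \<open>b'\<close> are both in the cell all that while.\<close>

lemma common_touchings:
  assumes b: "b \<noteq> b'" and X: "X \<subseteq> S" "\<And>a. a \<in> X \<Longrightarrow> good_start a \<and> good_end a"
  shows "card {a \<in> X. touch a b \<and> touch a b'} \<le> 3"
proof (rule ccontr)
  let ?A = "{a \<in> X. touch a b \<and> touch a b'}"
  assume "\<not> ?thesis"
  then have c4: "4 \<le> card ?A" by simp
  have fin: "finite ?A" using X finite_S finite_subset by fastforce
  have inj: "inj_on (\<lambda>a. tm a b) ?A" using touch_times_neq by (intro inj_onI) blast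
  have key: "tm a b' < tm a' b" "tm a b < tm a' b'" "tm a b' < tm a' b'"
    if a: "a \<in> ?A" "a' \<in> ?A" and lt: "tm a b < tm a' b" for a a'
  proof -
    have ne: "a \<noteq> a'" using lt by auto
    have S: "a \<in> S" "a' \<in> S" and g: "good_start a" "good_end a" "good_start a'" "good_end a'" using a X by auto
    have t: "touch a b" "touch a b'" "touch a' b" "touch a' b'" using a by auto
    have n: "tm a b' \<noteq> tm a' b" "tm a b \<noteq> tm a' b'" "tm a b' \<noteq> tm a' b'"
      using touch_times_neq[OF ne] t by blast+
    show 1: "tm a b' < tm a' b"
      using no_interleaving[OF S ne g(3,4) t(1,2) lt _ t(3,4,3)] n by fastforce
    show 2: "tm a b < tm a' b'"
      using no_interleaving[OF S(2,1) ne[symmetric] g(1,2) t(4,3) _ lt t(2,1,1)] n by fastforce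
    show "tm a b' < tm a' b'"
      using no_interleaving[OF S ne g(3,4) t(1,2) 2 _ t(3,4,4)] n by fastforce
  qed
  obtain a1 a2 a3 a4 where A: "a1 \<in> ?A" "a2 \<in> ?A" "a3 \<in> ?A" "a4 \<in> ?A"
    and lt: "tm a1 b < tm a2 b" "tm a2 b < tm a3 b" "tm a3 b < tm a4 b"
    using four_increasing[OF fin inj c4] by (elim bexE conjE) (rule that)
  have lt': "tm a1 b' < tm a2 b'" "tm a2 b' < tm a3 b'" "tm a3 b' < tm a4 b'" using key A lt by blast+
  have S: "b \<in> S" "b' \<in> S" "a2 \<in> S" "a3 \<in> S" using A X by (auto simp: touch_def)
  have t: "touch a1 b" "touch a1 b'" "touch a2 b" "touch a2 b'" "touch a3 b" "touch a3 b'" "touch a4 b" "touch a4 b'" using A by auto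
  have innb: "inn b (tm a1 b)" "inn b (tm a4 b)" "inn b' (tm a1 b')" "inn b' (tm a4 b')" using t by (auto simp: touch_def)
  have k: "tm a1 b' < tm a2 b" "tm a2 b' < tm a3 b" "tm a3 b' < tm a4 b" "tm a1 b < tm a2 b'" "tm a2 b < tm a3 b'" "tm a3 b < tm a4 b'"
    using key A lt by blast+
  have inn: "inn b (tm a2 b)" "inn b (tm a3 b)" "inn b (tm a2 b')" "inn b (tm a3 b')"
     "inn b' (tm a2 b)" "inn b' (tm a3 b)" "inn b' (tm a2 b')" "inn b' (tm a3 b')"
    using innb lt lt' k by auto
  then have al: "al (cv b) (tm a2 b)" "al (cv b) (tm a3 b)" "al (cv b) (tm a2 b')" "al (cv b) (tm a3 b')"
     "al (cv b') (tm a2 b)" "al (cv b') (tm a3 b)" "al (cv b') (tm a2 b')" "al (cv b') (tm a3 b')"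
    using strand_alive S by blast+
  have below: "ht b' (tm a b) < ht b (tm a b)" if a: "touch a b" "touch a b'" "inn b' (tm a b)" for a
  proof -
    have "ht b' (tm a b) < ht a (tm a b)"
      using touch_above_strand[OF a(2)] strand_alive a S by (meson touch_def)
    moreover have "b' \<noteq> a" using touch_cv_neq[OF a(2)] by auto
    ultimately show ?thesis using touch_adj[OF a(1) S(2)] b a(3) by fastforce
  qed
  have below': "ht b (tm a b') < ht b' (tm a b')" if a: "touch a b" "touch a b'" "inn b (tm a b')" for a
  proof -
    have "ht b (tm a b') < ht a (tm a b')"
      using touch_above_strand[OF a(1)] strand_alive a S by (meson touch_def)
    moreover have "b \<noteq> a" using touch_cv_neq[OF a(1)] by auto
    ultimately show ?thesis using touch_adj[OF a(2) S(1)] b a(3) by fastforce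
  qed
  have h: "ht b' (tm a2 b) < ht b (tm a2 b)" "ht b (tm a2 b') < ht b' (tm a2 b')"
    "ht b' (tm a3 b) < ht b (tm a3 b)" "ht b (tm a3 b') < ht b' (tm a3 b')"
    using below below' t inn by blast+
  have "tm a2 b \<noteq> tm a2 b'" using h by auto
  then consider "tm a2 b < tm a2 b'" | "tm a2 b' < tm a2 b" by linarith
  then show False
  proof cases
    case 1
    show False by (rule cross_once[of "cv b'" "cv b", OF _ _ 1 k(2)]) (use cv_in S al h in auto)
  next
    case 2
    show False by (rule cross_once[of "cv b" "cv b'", OF _ _ 2 k(5)]) (use cv_in S al h in auto)
  qed
qed

lemma card_mixed_touchings:
  fixes s :: real
  assumes X: "X \<subseteq> S" "\<And>a. a \<in> X \<Longrightarrow> good_start a \<and> good_end a" and Y: "Y \<subseteq> S" and s: "0 < s"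
  shows "real (card {(a, b). a \<in> X \<and> b \<in> Y \<and> touch a b}) \<le> real (card X) * (1 + s) + 3 * (real (card Y))\<^sup>2 / s"
proof -
  have "finite X" "finite Y" using X Y finite_S finite_subset by blast+
  from few_common_neighbours[OF this s, of touch 3] common_touchings[OF _ X] show ?thesis by simp
qed

lemma card_mixed_touchings':
  fixes s :: real
  assumes X: "X \<subseteq> S" "\<And>a. a \<in> X \<Longrightarrow> good_start a \<and> good_end a" and Y: "Y \<subseteq> S" and s: "0 < s"
  shows "real (card {(a, b). a \<in> Y \<and> b \<in> X \<and> touch a b}) \<le> real (card X) * (1 + s) + 3 * (real (card Y))\<^sup>2 / s"
proof -
  interpret f: cell F al "\<lambda>c t. - H c t" "T\<inverse>" "\<lambda>a b. \<tau> b a" K S cv lo hi "\<lambda>c t. - \<beta> c t" "- i"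
    by (rule flip_cell)
  have eq: "f.touch a b \<longleftrightarrow> touch b a" for a b by (auto simp: touch_def f.touch_def)
  have "f.good_start a \<and> f.good_end a" if "a \<in> X" for a
    using X(2)[OF that] by (auto simp: good_start_def f.good_start_def good_end_def f.good_end_def)
  then have "real (card {(a, b). a \<in> X \<and> b \<in> Y \<and> touch b a}) \<le> real (card X) * (1 + s) + 3 * (real (card Y))\<^sup>2 / s"
    using f.card_mixed_touchings[OF X(1) _ Y s] by (simp add: eq)
  moreover have "card {(a, b). a \<in> Y \<and> b \<in> X \<and> touch a b} = card {(a, b). a \<in> X \<and> b \<in> Y \<and> touch b a}"
    by (rule bij_betw_same_card[of prod.swap]) (auto intro!: bij_betwI[where g = prod.swap])
  ultimately show ?thesis by simp
qed

end

section \<open>Decomposition into cells\<close>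

context cell
begin

text \<open>\<open>w\<close> plays the role of the square root of the number of strands. It is only
  an upper bound, so that one value serves all cells.\<close>

lemma card_cell_touchings:
  fixes w :: real
  defines "E \<equiv> {p \<in> S. \<not> (good_start p \<and> good_end p)}"
  assumes k: "card S \<le> 2 ^ k" and w: "0 < w" "real (card S) \<le> w\<^sup>2"
  shows "real (card {(a, b). touch a b}) \<le>
    (2 * real k + 2) * real (card S) + 8 * w * real (card E) + real (card {(a, b). a \<in> E \<and> b \<in> E \<and> touch a b})"
proof -
  define X where "X = {p \<in> S. good_start p \<and> good_end p}"
  have X: "X \<subseteq> S" "\<And>a. a \<in> X \<Longrightarrow> good_start a \<and> good_end a" and E: "E \<subseteq> S"
    by (auto simp: X_def E_def)
  have cX: "card X \<le> card S" using X finite_S card_mono by blast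
  let ?P = "\<lambda>A B. {(a, b). a \<in> A \<and> b \<in> B \<and> touch a b}"
  have fP: "finite (?P A B)" if "A \<subseteq> S" "B \<subseteq> S" for A B
    by (rule finite_subset[of _ "S \<times> S"]) (use that finite_S in auto)
  have split: "{(a, b). touch a b} = ?P X X \<union> ?P X E \<union> (?P E X \<union> ?P E E)"
    by (auto simp: touch_def X_def E_def)
  have "card {(a, b). touch a b} \<le> card (?P X X) + card (?P X E) + (card (?P E X) + card (?P E E))"
    unfolding split by (meson add_mono card_Un_le order_trans)
  moreover have "card (?P X X) \<le> 2 * k * card X"
    by (rule card_passing_touchings) (use X k cX in auto)
  then have "real (card (?P X X)) \<le> 2 * real k * real (card S)"
    using mult_le_mono2[OF cX, of "2 * k"] by (metis (no_types, lifting) dual_order.trans of_nat_le_iff of_nat_mult of_nat_numeral)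
  moreover have "real (card (?P X E)) \<le> real (card S) + 4 * w * real (card E)
    \<and> real (card (?P E X)) \<le> real (card S) + 4 * w * real (card E)"
  proof (cases "card E = 0")
    case True
    then have "E = {}" using E finite_S finite_subset card_0_eq by blast
    then show ?thesis using True by simp
  next
    case False
    \<comment> \<open>With \<open>card X \<le> w\<^sup>2\<close> this choice makes both terms of the
      double count of the order \<open>w * card E\<close>.\<close>
    define s where "s = real (card E) / w"
    have s: "0 < s" using False w by (simp add: s_def)
    have "real (card X) * s \<le> w\<^sup>2 * s" using cX w s by (intro mult_right_mono) auto
    also have "\<dots> = w * real (card E)" using w by (simp add: s_def power2_eq_square)
    finally have 1: "real (card X) * s \<le> w * real (card E)" .
    have 2: "3 * (real (card E))\<^sup>2 / s = 3 * w * real (card E)"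
      using False w by (simp add: s_def power2_eq_square)
    have "real (card X) * (1 + s) + 3 * (real (card E))\<^sup>2 / s \<le> real (card S) + 4 * w * real (card E)"
      unfolding 2 using 1 cX by (simp add: algebra_simps)
    then show ?thesis
      using card_mixed_touchings[OF X E s] card_mixed_touchings'[OF X E s] by linarith
  qed
  ultimately show ?thesis by (simp add: algebra_simps)
qed

end

context touching_system
begin

definition level :: "'c \<Rightarrow> nat \<Rightarrow> nat" where
  "level c t = card {d \<in> F. al d t \<and> H d t < H c t}"

lemma level_less:
  assumes "c \<in> F" "d \<in> F" "al c t" "al d t" "H c t < H d t"
  shows "level c t < level d t"
  unfolding level_def
proof (rule psubset_card_mono)
  show "finite {e \<in> F. al e t \<and> H e t < H d t}" using finite_F by simp
  have "c \<in> {e \<in> F. al e t \<and> H e t < H d t}" "c \<notin> {e \<in> F. al e t \<and> H e t < H c t}" using assms by auto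
  then show "{e \<in> F. al e t \<and> H e t < H c t} \<subset> {e \<in> F. al e t \<and> H e t < H d t}" using assms(5) by auto
qed

end

section \<open>Bands of levels, walls and strands\<close>

locale banded = touching_system F al H T \<tau> K
  for F :: "'c set" and al H T \<tau> K +
  fixes h off :: nat
  assumes h_pos: "0 < h"
begin

definition band :: "'c \<Rightarrow> nat \<Rightarrow> nat" where
  "band c t = (level c t + off) div h"

definition entries :: "('c \<times> nat) set" where
  "entries = {(c, t). c \<in> F \<and> al c t \<and> (t = 0 \<or> \<not> al c (t - 1) \<or> band c (t - 1) \<noteq> band c t)}"

definition entries_until :: "nat \<Rightarrow> nat \<Rightarrow> ('c \<times> nat) set" where
  "entries_until i t = {(c, s) \<in> entries. s \<le> t \<and> band c s = i}"

text \<open>Each band is cut by a wall whenever its number of entries passes a multiple of \<open>h\<close>.\<close>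

definition column :: "nat \<Rightarrow> nat \<Rightarrow> nat" where
  "column i t = card (entries_until i t) div h"

definition in_cell :: "nat \<times> nat \<Rightarrow> 'c \<Rightarrow> nat \<Rightarrow> bool" where
  "in_cell \<kappa> c t \<longleftrightarrow> c \<in> F \<and> al c t \<and> band c t = fst \<kappa> \<and> column (fst \<kappa>) t = snd \<kappa>"

definition strands :: "nat \<times> nat \<Rightarrow> ('c \<times> nat \<times> nat) set" where
  "strands \<kappa> = {(c, u, v). u \<le> v \<and> (\<forall>t\<in>{u..v}. in_cell \<kappa> c t) \<and> (u = 0 \<or> \<not> in_cell \<kappa> c (u - 1)) \<and> \<not> in_cell \<kappa> c (Suc v)}"

lemma band_less:
  assumes "c \<in> F" "d \<in> F" "al c t" "al d t" "band c t < band d t"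
  shows "H c t < H d t"
proof (rule ccontr)
  assume "\<not> ?thesis"
  then have "level d t \<le> level c t"
    unfolding level_def using finite_F by (intro card_mono) auto
  then have "band d t \<le> band c t" by (simp add: band_def div_le_mono)
  then show False using assms by simp
qed

lemma card_band: "card {c \<in> F. al c t \<and> band c t = i} \<le> h"
proof -
  let ?f = "\<lambda>c. level c t + off"
  have "inj_on ?f {c \<in> F. al c t \<and> band c t = i}"
  proof (rule inj_onI)
    fix c d assume "c \<in> {c \<in> F. al c t \<and> band c t = i}" "d \<in> {c \<in> F. al c t \<and> band c t = i}" "?f c = ?f d"
    then show "c = d" using level_less[of c d t] level_less[of d c t] height_inj[of c d t] by fastforce
  qed
  moreover have "?f ` {c \<in> F. al c t \<and> band c t = i} \<subseteq> {i * h..<i * h + h}"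
  proof
    fix y assume "y \<in> ?f ` {c \<in> F. al c t \<and> band c t = i}"
    then have "y div h = i" by (auto simp: band_def)
    then show "y \<in> {i * h..<i * h + h}" using div_mult_mod_eq[of y h] mod_less_divisor[OF h_pos, of y] by auto
  qed
  ultimately have "card {c \<in> F. al c t \<and> band c t = i} \<le> card {i * h..<i * h + h}"
    by (meson card_inj_on_le finite_atLeastLessThan)
  then show ?thesis by simp
qed

lemma finite_entries: "finite entries"
  by (rule finite_subset[of _ "F \<times> {..<K}"]) (use finite_F alive_bounded in \<open>auto simp: entries_def\<close>)

lemma finite_entries_until: "finite (entries_until i t)"
  by (rule finite_subset[OF _ finite_entries]) (auto simp: entries_until_def)

lemma column_mono: "s \<le> t \<Longrightarrow> column i s \<le> column i t"
  unfolding column_def using finite_entries_until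
  by (intro div_le_mono card_mono) (auto simp: entries_until_def)

lemma in_cell_unique: "in_cell \<kappa> c t \<Longrightarrow> in_cell \<kappa>' c t \<Longrightarrow> \<kappa> = \<kappa>'"
  by (auto simp: in_cell_def prod_eq_iff)

lemma strandD:
  assumes "(c, u, v) \<in> strands \<kappa>"
  shows "u \<le> v" "\<And>t. u \<le> t \<Longrightarrow> t \<le> v \<Longrightarrow> in_cell \<kappa> c t" "u = 0 \<or> \<not> in_cell \<kappa> c (u - 1)" "\<not> in_cell \<kappa> c (Suc v)"
  using assms by (auto simp: strands_def)

lemma strand_ends_in_cell:
  assumes "(c, u, v) \<in> strands \<kappa>"
  shows "in_cell \<kappa> c u" "in_cell \<kappa> c v"
  using assms by (auto simp: strands_def)

lemma strand_determined:
  assumes "(c, u, v) \<in> strands \<kappa>" "(c, u', v') \<in> strands \<kappa>'" "u \<le> t" "t \<le> v" "u' \<le> t" "t \<le> v'"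
  shows "\<kappa> = \<kappa>' \<and> u = u' \<and> v = v'"
proof -
  note s = strandD[OF assms(1)] and s' = strandD[OF assms(2)]
  have k: "\<kappa> = \<kappa>'" using in_cell_unique s(2) s'(2) assms by blast
  have "\<not> u < u'"
  proof
    assume "u < u'"
    then have "in_cell \<kappa> c (u' - 1)" using s(2)[of "u' - 1"] assms by auto
    then show False using s'(3) k \<open>u < u'\<close> by auto
  qed
  moreover have "\<not> u' < u"
  proof
    assume "u' < u"
    then have "in_cell \<kappa>' c (u - 1)" using s'(2)[of "u - 1"] assms by auto
    then show False using s(3) k \<open>u' < u\<close> by auto
  qed
  moreover have "\<not> v < v'"
    using s'(2)[of "Suc v"] s(4) k assms by auto
  moreover have "\<not> v' < v"
    using s(2)[of "Suc v'"] s'(4) k assms by auto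
  ultimately show ?thesis using k by simp
qed

lemma strand_exists:
  assumes "in_cell \<kappa> c t"
  shows "\<exists>u v. (c, u, v) \<in> strands \<kappa> \<and> u \<le> t \<and> t \<le> v"
proof -
  let ?P = "\<lambda>u. u \<le> t \<and> (\<forall>s\<in>{u..t}. in_cell \<kappa> c s)"
  let ?Q = "\<lambda>v. t \<le> v \<and> (\<forall>s\<in>{t..v}. in_cell \<kappa> c s)"
  define u where "u = (LEAST u. ?P u)"
  define v where "v = (GREATEST v. ?Q v)"
  have P: "?P t" and Q: "?Q t" using assms by auto
  have u: "?P u" unfolding u_def by (rule LeastI[of ?P, OF P])
  have bd: "y \<le> K" if "?Q y" for y
  proof -
    have "in_cell \<kappa> c y" using that by auto
    then show ?thesis using alive_bounded[of c y] by (auto simp: in_cell_def)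
  qed
  have v: "?Q v" unfolding v_def by (rule GreatestI_nat[of ?Q, OF Q bd])
  have "\<not> in_cell \<kappa> c (Suc v)"
  proof
    assume "in_cell \<kappa> c (Suc v)"
    then have "?Q (Suc v)" using v by (auto simp: le_Suc_eq)
    from Greatest_le_nat[of ?Q, OF this bd] show False by (simp add: v_def)
  qed
  moreover have "u = 0 \<or> \<not> in_cell \<kappa> c (u - 1)"
  proof (rule ccontr)
    assume a: "\<not> ?thesis"
    have "?P (u - 1)"
    proof (intro conjI ballI)
      show "u - 1 \<le> t" using u by auto
      fix s assume "s \<in> {u - 1..t}"
      then show "in_cell \<kappa> c s" using a u by (cases "s = u - 1") auto
    qed
    from Least_le[of ?P, OF this] have "u \<le> u - 1" by (simp only: u_def[symmetric])
    then show False using a by (cases u) auto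
  qed
  moreover have "in_cell \<kappa> c s" if "u \<le> s" "s \<le> v" for s
    using u v that by (cases "s \<le> t") auto
  ultimately show ?thesis using u v by (intro exI[of _ u] exI[of _ v]) (auto simp: strands_def)
qed

lemma finite_strands: "finite (strands \<kappa>)"
proof (rule finite_subset)
  show "strands \<kappa> \<subseteq> F \<times> {..<K} \<times> {..<K}"
  proof
    fix p assume p: "p \<in> strands \<kappa>"
    obtain c u v where e: "p = (c, u, v)" by (cases p)
    have "in_cell \<kappa> c u" "in_cell \<kappa> c v" using p by (auto simp: strands_def e)
    then show "p \<in> F \<times> {..<K} \<times> {..<K}" using alive_bounded by (auto simp: in_cell_def e)
  qed
qed (use finite_F in auto)

lemma strands_cell:
  "cell F al H T \<tau> K (strands \<kappa>) fst (\<lambda>p. fst (snd p)) (\<lambda>p. snd (snd p)) (\<lambda>c t. int (band c t)) (int (fst \<kappa>))"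
proof
  show "finite (strands \<kappa>)" by (rule finite_strands)
  fix p assume p: "p \<in> strands \<kappa>"
  obtain c u v where e: "p = (c, u, v)" by (cases p)
  note s = strandD[OF p[unfolded e]]
  show "fst p \<in> F" "fst (snd p) \<le> snd (snd p)" using s(1) s(2)[of u] by (auto simp: in_cell_def e)
  show "al (fst p) t" "int (band (fst p) t) = int (fst \<kappa>)" if "fst (snd p) \<le> t" "t \<le> snd (snd p)" for t
    using s(2) that by (auto simp: in_cell_def e)
  show "p = q" if "q \<in> strands \<kappa>" "fst p = fst q" "fst (snd p) \<le> t" "t \<le> snd (snd p)" "fst (snd q) \<le> t" "t \<le> snd (snd q)" for q t
    using strand_determined[of c u v \<kappa> "fst (snd q)" "snd (snd q)" \<kappa> t] that p e by (cases q) auto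
next
  show "H c t < H d t" if "c \<in> F" "d \<in> F" "al c t" "al d t" "int (band c t) < int (band d t)" for c d t
    using band_less that by simp
qed

section \<open>Counting the strands of one cell and of all cells\<close>

definition first_time :: "nat \<times> nat \<Rightarrow> nat" where
  "first_time \<kappa> = (LEAST t. column (fst \<kappa>) t = snd \<kappa>)"

lemma first_time:
  assumes "(c, u, v) \<in> strands \<kappa>"
  shows "first_time \<kappa> \<le> u" "column (fst \<kappa>) (first_time \<kappa>) = snd \<kappa>"
proof -
  have *: "column (fst \<kappa>) u = snd \<kappa>" using strand_ends_in_cell(1)[OF assms] by (simp add: in_cell_def)
  show "first_time \<kappa> \<le> u" unfolding first_time_def using * by (rule Least_le)
  show "column (fst \<kappa>) (first_time \<kappa>) = snd \<kappa>" unfolding first_time_def using * by (rule LeastI)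
qed

text \<open>\<open>first_time \<kappa>\<close> is the left side of the cell. After it the column
  stays the same, so a strand can start only because its curve enters the band.\<close>

lemma strand_entry:
  assumes s: "(c, u, v) \<in> strands \<kappa>" and lt: "first_time \<kappa> < u"
  shows "(c, u) \<in> entries"
proof -
  note d = strandD[OF s]
  have cu: "in_cell \<kappa> c u" using d by auto
  then have "column (fst \<kappa>) (u - 1) = snd \<kappa>"
    using column_mono[of "first_time \<kappa>" "u - 1" "fst \<kappa>"] column_mono[of "u - 1" u "fst \<kappa>"] first_time[OF s] lt
    by (auto simp: in_cell_def)
  then show ?thesis using d(3) cu by (auto simp: in_cell_def entries_def)
qed

lemma inj_on_strand_start: "inj_on (\<lambda>(\<kappa>, c, u, v). (c, u)) (Sigma I strands)"
proof (rule inj_onI)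
  fix x y assume x: "x \<in> Sigma I strands" and y: "y \<in> Sigma I strands"
    and e: "(\<lambda>(\<kappa>, c, u, v). (c, u :: nat)) x = (\<lambda>(\<kappa>, c, u, v). (c, u)) y"
  obtain \<kappa> c u v where x': "x = (\<kappa>, c, u, v)" by (cases x)
  obtain \<kappa>' v' where y': "y = (\<kappa>', c, u, v')" using e x' by (cases y) auto
  show "x = y"
    using strand_determined[of c u v \<kappa> u v' \<kappa>' u] strandD(1)[of c u v \<kappa>] strandD(1)[of c u v' \<kappa>'] x y x' y' by auto
qed

lemma inj_on_strand_start': "inj_on (\<lambda>(c, u, v). (c, u)) (strands \<kappa>)"
  using inj_on_strand_start[of "{\<kappa>}"] by (auto simp: inj_on_def)

lemma card_first_strands: "card {(c, u, v) \<in> strands \<kappa>. u = first_time \<kappa>} \<le> h"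
proof -
  let ?A = "{(c, u, v) \<in> strands \<kappa>. u = first_time \<kappa>}"
  have "inj_on fst ?A" using inj_on_strand_start'[of \<kappa>] by (auto simp: inj_on_def)
  moreover have "fst ` ?A \<subseteq> {c \<in> F. al c (first_time \<kappa>) \<and> band c (first_time \<kappa>) = fst \<kappa>}"
    by (auto simp: strands_def in_cell_def)
  ultimately have "card ?A \<le> card {c \<in> F. al c (first_time \<kappa>) \<and> band c (first_time \<kappa>) = fst \<kappa>}"
    using finite_F by (intro card_inj_on_le) auto
  then show ?thesis using card_band order_trans by blast
qed

text \<open>At most \<open>h\<close> strands start on the left side, since a band holds at most
  \<open>h\<close> curves at a time. Every other strand starts with an entry into the band after the
  first time, and the numbers of entries at two times of one column differ by less than
  \<open>h\<close>.\<close>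

lemma card_strands: "card (strands \<kappa>) \<le> 2 * h"
proof (cases "strands \<kappa> = {}")
  case False
  let ?A = "{(c, u, v) \<in> strands \<kappa>. u = first_time \<kappa>}" and ?B = "{(c, u, v) \<in> strands \<kappa>. first_time \<kappa> < u}"
  let ?i = "fst \<kappa>"
  \<comment> \<open>The last start of a strand: a time that certainly belongs to the column and by
    which all strands have been counted.\<close>
  define t1 where "t1 = Max ((\<lambda>(c, u, v). u) ` strands \<kappa>)"
  have "t1 \<in> (\<lambda>(c, u, v). u) ` strands \<kappa>" unfolding t1_def using finite_strands False by (intro Max_in) auto
  then obtain c u v where s: "(c, u, v) \<in> strands \<kappa>" "u = t1" by auto
  have t1: "u \<le> t1" if "(c, u, v) \<in> strands \<kappa>" for c u v
    unfolding t1_def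
  proof (rule Max_ge)
    show "finite ((\<lambda>(c, u, v). u) ` strands \<kappa>)" using finite_strands by simp
    show "u \<in> (\<lambda>(c, u, v). u) ` strands \<kappa>" using that by force
  qed
  have ct1: "column ?i t1 = snd \<kappa>" using strand_ends_in_cell[OF s(1)] s(2) by (auto simp: in_cell_def)
  let ?C = "entries_until ?i t1 - entries_until ?i (first_time \<kappa>)"
  have "inj_on (\<lambda>(c, u, v). (c, u)) ?B" by (rule inj_on_subset[OF inj_on_strand_start']) auto
  moreover have "(\<lambda>(c, u, v). (c, u)) ` ?B \<subseteq> ?C"
  proof
    fix y assume "y \<in> (\<lambda>(c, u, v). (c, u)) ` ?B"
    then obtain c u v where y: "y = (c, u)" "(c, u, v) \<in> strands \<kappa>" "first_time \<kappa> < u" by auto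
    have "band c u = ?i" using strand_ends_in_cell[OF y(2)] by (auto simp: in_cell_def)
    then show "y \<in> ?C" using y strand_entry[OF y(2,3)] t1[OF y(2)] by (auto simp: entries_until_def)
  qed
  ultimately have "card ?B \<le> card ?C" using finite_entries_until card_inj_on_le by blast
  also have "\<dots> = card (entries_until ?i t1) - card (entries_until ?i (first_time \<kappa>))"
    using finite_entries_until first_time(1)[OF s(1)] s(2) by (intro card_Diff_subset) (auto simp: entries_until_def)
  also have "\<dots> \<le> h"
  proof -
    let ?a = "card (entries_until ?i t1)" and ?b = "card (entries_until ?i (first_time \<kappa>))"
    have "?a div h = ?b div h"
      using ct1 first_time(2)[OF s(1)] by (simp add: column_def)
    moreover have "?a < ?a div h * h + h"
      using div_mult_mod_eq[of ?a h] mod_less_divisor[OF h_pos, of ?a] by linarith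
    moreover have "?b div h * h \<le> ?b" by simp
    ultimately have "?a < ?b div h * h + h" "?b div h * h \<le> ?b" by simp_all
    then show ?thesis by linarith
  qed
  finally have "card ?B \<le> h" .
  moreover have "strands \<kappa> \<subseteq> ?A \<union> ?B"
  proof
    fix p assume p: "p \<in> strands \<kappa>"
    obtain c u v where e: "p = (c, u, v)" by (cases p)
    show "p \<in> ?A \<union> ?B" using first_time(1)[of c u v \<kappa>] p e by auto
  qed
  then have "card (strands \<kappa>) \<le> card (?A \<union> ?B)"
    using finite_strands by (intro card_mono) (auto intro: finite_subset[OF _ finite_strands])
  then have "card (strands \<kappa>) \<le> card ?A + card ?B" using card_Un_le[of ?A ?B] by linarith
  ultimately show ?thesis using card_first_strands[of \<kappa>] by linarith
qed auto

definition cells :: "(nat \<times> nat) set" where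
  "cells = {\<kappa>. strands \<kappa> \<noteq> {}}"

lemma cells_bounded:
  assumes "\<kappa> \<in> cells"
  shows "\<exists>c t. (c, t) \<in> F \<times> {..<K} \<and> al c t \<and> band c t = fst \<kappa> \<and> column (fst \<kappa>) t = snd \<kappa>"
proof -
  obtain c u v where "(c, u, v) \<in> strands \<kappa>" using assms by (auto simp: cells_def)
  then have "in_cell \<kappa> c u" using strandD(1)[of c u v] strandD(2)[of c u v \<kappa> u] by simp
  then show ?thesis using alive_bounded[of c u] by (intro exI[of _ c] exI[of _ u]) (simp add: in_cell_def)
qed

lemma finite_cells: "finite cells"
proof (rule finite_subset)
  show "cells \<subseteq> (\<lambda>(c, t). (band c t, column (band c t) t)) ` (F \<times> {..<K})"
  proof
    fix \<kappa> assume "\<kappa> \<in> cells"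
    then obtain c t where ct: "(c, t) \<in> F \<times> {..<K}" "band c t = fst \<kappa>" "column (fst \<kappa>) t = snd \<kappa>"
      using cells_bounded by blast
    then have "\<kappa> = (\<lambda>(c, t). (band c t, column (band c t) t)) (c, t)" by simp
    then show "\<kappa> \<in> (\<lambda>(c, t). (band c t, column (band c t) t)) ` (F \<times> {..<K})" using ct(1) by (rule image_eqI)
  qed
qed (use finite_F in auto)

text \<open>Every column after the first of its band is paid for by \<open>h\<close> entries. Column
  numbers may jump when many curves enter at once, so the occupied columns are bounded through the
  largest column number.\<close>

lemma card_wall_cells: "h * card {\<kappa> \<in> cells. 0 < snd \<kappa>} \<le> card entries"
proof -
  let ?I = "fst ` cells"
  have sub: "{\<kappa> \<in> cells. 0 < snd \<kappa>} \<subseteq> Sigma ?I (\<lambda>i. {1..column i K})"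
  proof
    fix \<kappa> assume k: "\<kappa> \<in> {\<kappa> \<in> cells. 0 < snd \<kappa>}"
    obtain c t where ct: "t < K" "column (fst \<kappa>) t = snd \<kappa>" using cells_bounded[of \<kappa>] k by auto
    then have "snd \<kappa> \<le> column (fst \<kappa>) K" using column_mono[of t K "fst \<kappa>"] by simp
    then show "\<kappa> \<in> Sigma ?I (\<lambda>i. {1..column i K})" using k by (cases \<kappa>) force
  qed
  have "card {\<kappa> \<in> cells. 0 < snd \<kappa>} \<le> card (Sigma ?I (\<lambda>i. {1..column i K}))"
    using sub finite_cells by (intro card_mono) auto
  also have "\<dots> = (\<Sum>i\<in>?I. column i K)" using finite_cells by simp
  finally have "h * card {\<kappa> \<in> cells. 0 < snd \<kappa>} \<le> h * (\<Sum>i\<in>?I. column i K)" by simp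
  also have "\<dots> = (\<Sum>i\<in>?I. h * column i K)" by (simp add: sum_distrib_left)
  also have "\<dots> \<le> (\<Sum>i\<in>?I. card (entries_until i K))" by (intro sum_mono) (simp add: column_def)
  also have "\<dots> = card (\<Union>i\<in>?I. entries_until i K)"
    using finite_cells finite_entries_until by (subst card_UN_disjoint) (auto simp: entries_until_def)
  also have "\<dots> \<le> card entries" using finite_entries by (intro card_mono) (auto simp: entries_until_def)
  finally show ?thesis .
qed

text \<open>A strand starts with an entry into its band or on a wall. At most \<open>h\<close>
  strands start on a wall, and \<open>h\<close> times the number of cells behind a wall is at most
  the number of entries, so the walls at most double the count.\<close>

lemma sum_card_strands: "(\<Sum>\<kappa>\<in>cells. card (strands \<kappa>)) \<le> 2 * card entries"
proof -
  let ?S = "Sigma cells strands"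
  let ?A = "{x \<in> ?S. (\<lambda>(\<kappa>, c, u, v). (c, u)) x \<in> entries}"
  let ?W = "{\<kappa> \<in> cells. 0 < snd \<kappa>}"
  let ?B = "Sigma ?W (\<lambda>\<kappa>. {(c, u, v) \<in> strands \<kappa>. u = first_time \<kappa>})"
  have "inj_on (\<lambda>(\<kappa>, c, u, v). (c, u)) ?A" by (rule inj_on_subset[OF inj_on_strand_start[of cells]]) auto
  then have A: "card ?A \<le> card entries"
    by (rule card_inj_on_le) (use finite_entries in auto)
  have "card ?B = (\<Sum>\<kappa>\<in>?W. card {(c, u, v) \<in> strands \<kappa>. u = first_time \<kappa>})"
    using finite_cells finite_strands by (intro card_SigmaI) (auto intro: finite_subset[OF _ finite_strands])
  also have "\<dots> \<le> (\<Sum>\<kappa>\<in>?W. h)" by (intro sum_mono card_first_strands)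
  also have "\<dots> \<le> card entries" using card_wall_cells by (simp add: mult.commute)
  finally have B: "card ?B \<le> card entries" .
  have "?S \<subseteq> ?A \<union> ?B"
  proof
    fix x assume x: "x \<in> ?S"
    obtain \<kappa> c u v where e: "x = (\<kappa>, c, u, v)" by (cases x)
    then have s: "(c, u, v) \<in> strands \<kappa>" and k: "\<kappa> \<in> cells" using x by auto
    note d = strandD[OF s]
    have cu: "in_cell \<kappa> c u" using d by auto
    show "x \<in> ?A \<union> ?B"
    proof (cases "(c, u) \<in> entries")
      case True
      then show ?thesis using x e by auto
    next
      case False
      then have "u = first_time \<kappa>" using strand_entry[OF s] first_time(1)[OF s] by (cases "u = first_time \<kappa>") auto
      \<comment> \<open>Without an entry the curve was in the same band one step before, hence in a
        smaller column.\<close>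
      moreover have "0 < snd \<kappa>"
      proof -
        have f: "0 < u" "al c (u - 1)" "band c (u - 1) = fst \<kappa>"
          using False cu by (auto simp: entries_def in_cell_def)
        then have "column (fst \<kappa>) (u - 1) \<noteq> snd \<kappa>" using d(3) cu by (auto simp: in_cell_def)
        then show ?thesis using column_mono[of "u - 1" u "fst \<kappa>"] cu by (auto simp: in_cell_def)
      qed
      ultimately show ?thesis using s k e by auto
    qed
  qed
  moreover have "finite (?A \<union> ?B)" using finite_cells finite_strands
    by (intro finite_UnI finite_SigmaI) (auto intro: finite_subset[OF _ finite_strands])
  ultimately have "card ?S \<le> card (?A \<union> ?B)" by (intro card_mono)
  also have "\<dots> \<le> card ?A + card ?B" by (rule card_Un_le)
  finally have "card ?S \<le> 2 * card entries" using A B by simp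
  then show ?thesis using finite_cells finite_strands by simp
qed

section \<open>Ends of curves and the sum over all cells\<close>

definition ended :: "nat \<times> nat \<Rightarrow> ('c \<times> nat \<times> nat) set" where
  "ended \<kappa> = {(c, u, v) \<in> strands \<kappa>. u = 0 \<or> \<not> al c (u - 1) \<or> \<not> al c (Suc v)}"

text \<open>A curve appears once and disappears once, however it is cut into strands, so it has at
  most one strand of each of the two kinds.\<close>

lemma sum_card_ended: "(\<Sum>\<kappa>\<in>cells. card (ended \<kappa>)) \<le> 2 * card F"
proof -
  define A where "A = Sigma cells (\<lambda>\<kappa>. {(c, u, v) \<in> strands \<kappa>. u = 0 \<or> \<not> al c (u - 1)})"
  define B where "B = Sigma cells (\<lambda>\<kappa>. {(c, u, v) \<in> strands \<kappa>. \<not> al c (Suc v)})"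
  let ?f = "\<lambda>x. fst (snd x)"
  have dat: "c \<in> F" "al c u" "al c v" "u \<le> v" if s: "(c, u, v) \<in> strands \<kappa>" for \<kappa> c u v
  proof -
    show uv: "u \<le> v" using strandD(1)[OF s] .
    have "in_cell \<kappa> c u" "in_cell \<kappa> c v" using strandD(2)[OF s, of u] strandD(2)[OF s, of v] uv by simp_all
    then show "c \<in> F" "al c u" "al c v" by (auto simp: in_cell_def)
  qed
  have "inj_on ?f A"
  proof (rule inj_onI)
    fix x y assume x: "x \<in> A" and y: "y \<in> A" and e: "?f x = ?f y"
    obtain \<kappa> c u v where x': "x = (\<kappa>, c, u, v)" by (cases x)
    obtain \<kappa>' u' v' where y': "y = (\<kappa>', c, u', v')" using e x' by (cases y) auto
    have xs: "(c, u, v) \<in> strands \<kappa>" "u = 0 \<or> \<not> al c (u - 1)"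
      and ys: "(c, u', v') \<in> strands \<kappa>'" "u' = 0 \<or> \<not> al c (u' - 1)"
      using x y x' y' by (auto simp: A_def)
    note dx = dat[OF xs(1)] and dy = dat[OF ys(1)]
    have "u = u'"
      using alive_between[OF dx(1,2) dy(2), of "u' - 1"] ys(2) alive_between[OF dx(1) dy(2) dx(2), of "u - 1"] xs(2)
      by linarith
    then show "x = y" using strand_determined[OF xs(1) ys(1), of u] dx(4) dy(4) x' y' by simp
  qed
  then have A: "card A \<le> card F"
    by (rule card_inj_on_le) (use dat(1) finite_F in \<open>auto simp: A_def\<close>)
  have "inj_on ?f B"
  proof (rule inj_onI)
    fix x y assume x: "x \<in> B" and y: "y \<in> B" and e: "?f x = ?f y"
    obtain \<kappa> c u v where x': "x = (\<kappa>, c, u, v)" by (cases x)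
    obtain \<kappa>' u' v' where y': "y = (\<kappa>', c, u', v')" using e x' by (cases y) auto
    have xs: "(c, u, v) \<in> strands \<kappa>" "\<not> al c (Suc v)" and ys: "(c, u', v') \<in> strands \<kappa>'" "\<not> al c (Suc v')"
      using x y x' y' by (auto simp: B_def)
    note dx = dat[OF xs(1)] and dy = dat[OF ys(1)]
    have "\<not> v < v'" using alive_between[OF dx(1,3) dy(3), of "Suc v"] xs(2) by auto
    moreover have "\<not> v' < v" using alive_between[OF dx(1) dy(3) dx(3), of "Suc v'"] ys(2) by auto
    ultimately have "v = v'" by simp
    then show "x = y" using strand_determined[OF xs(1) ys(1), of v] dx(4) dy(4) x' y' by simp
  qed
  then have B: "card B \<le> card F"
    by (rule card_inj_on_le) (use dat(1) finite_F in \<open>auto simp: B_def\<close>)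
  have "Sigma cells ended = A \<union> B" unfolding A_def B_def ended_def by auto
  then have "card (Sigma cells ended) \<le> card A + card B" by (metis card_Un_le)
  moreover have "finite (ended \<kappa>)" for \<kappa> by (rule finite_subset[OF _ finite_strands]) (auto simp: ended_def)
  then have "card (Sigma cells ended) = (\<Sum>\<kappa>\<in>cells. card (ended \<kappa>))" using finite_cells by simp
  ultimately show ?thesis using A B by simp
qed

text \<open>Tangencies cut apart by the boundary of two bands. No cell contains them; the offset has
  to be chosen so that they are few.\<close>

definition separated :: "('c \<times> 'c) set" where
  "separated = {(a, b) \<in> T. band a (\<tau> a b) \<noteq> band b (\<tau> a b)}"

text \<open>The bound \<open>\<rho>\<close> is per curve because the ended strands are scattered:
  each cell applies it to its own curves, at most \<open>2 * h\<close> of them, and the results add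
  up.\<close>

lemma card_T_le:
  fixes w \<rho> :: real
  assumes k: "2 * h \<le> 2 ^ k" and w: "0 < w" "real (2 * h) \<le> w\<^sup>2"
    and rec: "\<And>G. G \<subseteq> F \<Longrightarrow> card G \<le> 2 * h \<Longrightarrow> real (card (T \<inter> G \<times> G)) \<le> \<rho> * real (card G)" and \<rho>: "0 \<le> \<rho>"
  shows "real (card T) \<le> real (card separated) + (4 * real k + 4) * real (card entries) + (16 * w + 2 * \<rho>) * real (card F)"
proof -
  have fT: "finite T" by (rule finite_subset[of _ "F \<times> F"]) (use touch_in finite_F in auto)
  define P where "P \<kappa> = {(p, q). cell.touch T \<tau> (strands \<kappa>) fst (\<lambda>p. fst (snd p)) (\<lambda>p. snd (snd p)) p q}" for \<kappa>
  have bound: "finite (P \<kappa>) \<and> real (card (P \<kappa>)) \<le> (2 * real k + 2) * real (card (strands \<kappa>)) + (8 * w + \<rho>) * real (card (ended \<kappa>))" for \<kappa>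
  proof -
    interpret C: cell F al H T \<tau> K "strands \<kappa>" fst "\<lambda>p. fst (snd p)" "\<lambda>p. snd (snd p)" "\<lambda>c t. int (band c t)" "int (fst \<kappa>)"
      by (rule strands_cell)
    let ?E = "{p \<in> strands \<kappa>. \<not> (C.good_start p \<and> C.good_end p)}"
    \<comment> \<open>If the curve is already in the band before the strand starts, the strand
      starts because the column changes. Columns never decrease, so no strand of the cell starts
      earlier; ends are treated in the same way.\<close>
    have E: "?E \<subseteq> ended \<kappa>"
    proof
      fix p assume p: "p \<in> ?E"
      obtain c u v where e: "p = (c, u, v)" by (cases p)
      have s: "(c, u, v) \<in> strands \<kappa>" using p e by auto
      note d = strandD[OF s]
      have cu: "in_cell \<kappa> c u" "in_cell \<kappa> c v" using d by auto
      have "C.good_start p" if "0 < u" "al c (u - 1)"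
      proof (cases "band c (u - 1) = fst \<kappa>")
        case False
        then show ?thesis using that by (simp add: C.good_start_def e)
      next
        case True
        then have "column (fst \<kappa>) (u - 1) \<noteq> snd \<kappa>" using d(3) that cu by (auto simp: in_cell_def)
        then have lt: "column (fst \<kappa>) (u - 1) < snd \<kappa>"
          using column_mono[of "u - 1" u "fst \<kappa>"] cu by (auto simp: in_cell_def)
        have "u \<le> u'" if s': "(c', u', v') \<in> strands \<kappa>" for c' u' v'
        proof (rule ccontr)
          assume "\<not> u \<le> u'"
          then have "column (fst \<kappa>) u' \<le> column (fst \<kappa>) (u - 1)" by (intro column_mono) auto
          then show False using lt strand_ends_in_cell[OF s'] by (auto simp: in_cell_def)
        qed
        then show ?thesis by (auto simp: C.good_start_def e)
      qed
      moreover have "C.good_end p" if "al c (Suc v)"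
      proof (cases "band c (Suc v) = fst \<kappa>")
        case False
        then show ?thesis using that by (simp add: C.good_end_def e)
      next
        case True
        then have "column (fst \<kappa>) (Suc v) \<noteq> snd \<kappa>" using d(4) that cu by (auto simp: in_cell_def)
        then have lt: "snd \<kappa> < column (fst \<kappa>) (Suc v)"
          using column_mono[of v "Suc v" "fst \<kappa>"] cu by (auto simp: in_cell_def)
        have "v' \<le> v" if s': "(c', u', v') \<in> strands \<kappa>" for c' u' v'
        proof (rule ccontr)
          assume "\<not> v' \<le> v"
          then have "column (fst \<kappa>) (Suc v) \<le> column (fst \<kappa>) v'" by (intro column_mono) auto
          then show False using lt strand_ends_in_cell[OF s'] by (auto simp: in_cell_def)
        qed
        then show ?thesis by (auto simp: C.good_end_def e)
      qed
      ultimately show "p \<in> ended \<kappa>" using p s e by (auto simp: ended_def)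
    qed
    have fin: "finite (ended \<kappa>)" by (rule finite_subset[OF _ finite_strands]) (auto simp: ended_def)
    have cE: "card ?E \<le> card (ended \<kappa>)" using E fin card_mono by blast
    let ?EE = "{(a, b). a \<in> ?E \<and> b \<in> ?E \<and> C.touch a b}"
    let ?G = "fst ` ?E"
    \<comment> \<open>A pair of curves has a single touching time, and this time determines the
      strand of each, so no touching is lost in passing from strands to curves.\<close>
    have "inj_on (\<lambda>(p, q). (fst p, fst q)) ?EE"
    proof (rule inj_onI)
      fix x y assume x: "x \<in> ?EE" and y: "y \<in> ?EE" and e: "(\<lambda>(p, q). (fst p, fst q)) x = (\<lambda>(p, q). (fst p, fst q)) y"
      obtain p q p' q' where xy: "x = (p, q)" "y = (p', q')" by (cases x, cases y)
      have t: "C.touch p q" "C.touch p' q'" and f: "fst p = fst p'" "fst q = fst q'" using x y e xy by auto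
      then show "x = y" using C.strand_unique[of p p'] C.strand_unique[of q q'] xy by (auto simp: C.touch_def)
    qed
    moreover have "(\<lambda>(p, q). (fst p, fst q)) ` ?EE \<subseteq> T \<inter> ?G \<times> ?G" by (auto simp: C.touch_def)
    ultimately have "card ?EE \<le> card (T \<inter> ?G \<times> ?G)" using fT card_inj_on_le by blast
    moreover have G: "card ?G \<le> card ?E" using finite_strands by (intro card_image_le) auto
    have "card ?E \<le> card (strands \<kappa>)" using finite_strands by (intro card_mono) auto
    then have "real (card (T \<inter> ?G \<times> ?G)) \<le> \<rho> * real (card ?G)"
      by (intro rec) (use G card_strands[of \<kappa>] C.cv_in in auto)
    moreover have "\<rho> * real (card ?G) \<le> \<rho> * real (card (ended \<kappa>))"
      using G cE \<rho> by (intro mult_left_mono) auto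
    ultimately have EE: "real (card ?EE) \<le> \<rho> * real (card (ended \<kappa>))" by linarith
    have "card (strands \<kappa>) \<le> 2 ^ k" using card_strands[of \<kappa>] k by linarith
    moreover have "real (card (strands \<kappa>)) \<le> w\<^sup>2"
    proof -
      have "real (card (strands \<kappa>)) \<le> real (2 * h)" using card_strands[of \<kappa>] by (rule of_nat_mono)
      then show ?thesis using w(2) by (rule order_trans)
    qed
    ultimately have "real (card (P \<kappa>)) \<le> (2 * real k + 2) * real (card (strands \<kappa>)) + 8 * w * real (card ?E) + real (card ?EE)"
      unfolding P_def by (intro C.card_cell_touchings w(1))
    moreover have "8 * w * real (card ?E) \<le> 8 * w * real (card (ended \<kappa>))" using cE w by simp
    moreover have "finite (P \<kappa>)"
      by (rule finite_subset[of _ "strands \<kappa> \<times> strands \<kappa>"]) (use finite_strands in \<open>auto simp: P_def C.touch_def\<close>)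
    ultimately show ?thesis using EE by (simp add: algebra_simps)
  qed
  have sub: "T \<subseteq> separated \<union> (\<Union>\<kappa>\<in>cells. (\<lambda>(p, q). (fst p, fst q)) ` P \<kappa>)"
  proof
    fix x assume x: "x \<in> T"
    obtain a b where e: "x = (a, b)" by (cases x)
    let ?t = "\<tau> a b"
    have T: "(a, b) \<in> T" "a \<in> F" "b \<in> F" "al a ?t" "al b ?t" using x e touch_in touch_alive by auto
    show "x \<in> separated \<union> (\<Union>\<kappa>\<in>cells. (\<lambda>(p, q). (fst p, fst q)) ` P \<kappa>)"
    proof (cases "band a ?t = band b ?t")
      case False
      then show ?thesis using T e by (auto simp: separated_def)
    next
      case True
      define \<kappa> where "\<kappa> = (band a ?t, column (band a ?t) ?t)"
      have "in_cell \<kappa> a ?t" "in_cell \<kappa> b ?t" using T True by (auto simp: in_cell_def \<kappa>_def)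
      then obtain u v u' v' where s: "(a, u, v) \<in> strands \<kappa>" "u \<le> ?t" "?t \<le> v" "(b, u', v') \<in> strands \<kappa>" "u' \<le> ?t" "?t \<le> v'"
        using strand_exists by meson
      interpret C: cell F al H T \<tau> K "strands \<kappa>" fst "\<lambda>p. fst (snd p)" "\<lambda>p. snd (snd p)" "\<lambda>c t. int (band c t)" "int (fst \<kappa>)"
        by (rule strands_cell)
      have "((a, u, v), (b, u', v')) \<in> P \<kappa>" using s T by (auto simp: P_def C.touch_def)
      then have "(a, b) \<in> (\<lambda>(p, q). (fst p, fst q)) ` P \<kappa>" by force
      moreover have "\<kappa> \<in> cells" using s by (auto simp: cells_def)
      ultimately show ?thesis using e by blast
    qed
  qed
  have fs: "finite separated" by (rule finite_subset[OF _ fT]) (auto simp: separated_def)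
  have "card T \<le> card (separated \<union> (\<Union>\<kappa>\<in>cells. (\<lambda>(p, q). (fst p, fst q)) ` P \<kappa>))"
    using sub fs finite_cells bound by (intro card_mono) auto
  also have "\<dots> \<le> card separated + card (\<Union>\<kappa>\<in>cells. (\<lambda>(p, q). (fst p, fst q)) ` P \<kappa>)" by (rule card_Un_le)
  also have "card (\<Union>\<kappa>\<in>cells. (\<lambda>(p, q). (fst p, fst q)) ` P \<kappa>) \<le> (\<Sum>\<kappa>\<in>cells. card ((\<lambda>(p, q). (fst p, fst q)) ` P \<kappa>))"
    by (rule card_UN_le[OF finite_cells])
  also have "\<dots> \<le> (\<Sum>\<kappa>\<in>cells. card (P \<kappa>))" using bound by (intro sum_mono card_image_le) auto
  finally have "real (card T) \<le> real (card separated) + (\<Sum>\<kappa>\<in>cells. real (card (P \<kappa>)))"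
    by (metis add_left_mono of_nat_add of_nat_le_iff of_nat_sum)
  also have "(\<Sum>\<kappa>\<in>cells. real (card (P \<kappa>))) \<le>
    (\<Sum>\<kappa>\<in>cells. (2 * real k + 2) * real (card (strands \<kappa>)) + (8 * w + \<rho>) * real (card (ended \<kappa>)))"
    using bound by (intro sum_mono) auto
  also have "\<dots> = (2 * real k + 2) * real (\<Sum>\<kappa>\<in>cells. card (strands \<kappa>)) + (8 * w + \<rho>) * real (\<Sum>\<kappa>\<in>cells. card (ended \<kappa>))"
    by (simp add: sum.distrib sum_distrib_left)
  also have "\<dots> \<le> (2 * real k + 2) * real (2 * card entries) + (8 * w + \<rho>) * real (2 * card F)"
    using sum_card_strands sum_card_ended w \<rho> by (intro add_mono mult_left_mono of_nat_mono) auto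
  finally show ?thesis by (simp add: algebra_simps)
qed

end

section \<open>Choice of the offset\<close>

text \<open>A boundary falls between the levels \<open>l\<close> and \<open>Suc l\<close> only if
  \<open>h\<close> divides \<open>Suc (l + r)\<close>, and two such offsets would differ by a
  multiple of \<open>h\<close>.\<close>

lemma card_offsets_Suc:
  fixes h l :: nat
  assumes "0 < h"
  shows "card {r. r < h \<and> (l + r) div h \<noteq> (Suc l + r) div h} \<le> 1"
proof -
  let ?A = "{r. r < h \<and> (l + r) div h \<noteq> (Suc l + r) div h}"
  have dv: "h dvd Suc (l + r)" if "r \<in> ?A" for r
  proof -
    have "Suc (l + r) mod h = 0" using that div_Suc[of "l + r" h] by (auto split: if_splits)
    then show ?thesis by (rule mod_0_imp_dvd)
  qed
  have "\<not> r < s" if "r \<in> ?A" "s \<in> ?A" for r s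
  proof
    assume "r < s"
    have "h dvd Suc (l + s) - Suc (l + r)" using dv that by (intro dvd_diff_nat)
    then have "h dvd s - r" by simp
    then show False using \<open>r < s\<close> that by (auto dest: dvd_imp_le)
  qed
  then have "r = s" if "r \<in> ?A" "s \<in> ?A" for r s using that by (meson linorder_neqE_nat)
  then have "\<forall>r\<in>?A. \<forall>s\<in>?A. r = s" by blast
  moreover have "finite ?A" by simp
  ultimately have "card ?A \<le> Suc 0" by (simp only: card_le_Suc0_iff_eq)
  then show ?thesis by simp
qed

lemma card_offsets:
  fixes h l l' :: nat
  assumes h: "0 < h" and "l \<le> l'"
  shows "card {r. r < h \<and> (l + r) div h \<noteq> (l' + r) div h} \<le> l' - l"
  using assms(2)
proof (induction rule: dec_induct)
  case (step m)
  have "{r. r < h \<and> (l + r) div h \<noteq> (Suc m + r) div h} \<subseteq>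
    {r. r < h \<and> (l + r) div h \<noteq> (m + r) div h} \<union> {r. r < h \<and> (m + r) div h \<noteq> (Suc m + r) div h}" by auto
  then have "card {r. r < h \<and> (l + r) div h \<noteq> (Suc m + r) div h} \<le>
    card ({r. r < h \<and> (l + r) div h \<noteq> (m + r) div h} \<union> {r. r < h \<and> (m + r) div h \<noteq> (Suc m + r) div h})"
    by (intro card_mono) auto
  also have "\<dots> \<le> (m - l) + 1"
    using card_Un_le add_mono[OF step.IH card_offsets_Suc[OF h, of m]] order_trans by blast
  finally show ?case using step.hyps by simp
qed simp

lemma exists_le_average:
  fixes f :: "'a \<Rightarrow> nat"
  assumes "finite A" "A \<noteq> {}"
  shows "\<exists>a\<in>A. card A * f a \<le> sum f A"
proof -
  have "Min (f ` A) \<in> f ` A" using assms by simp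
  then obtain a where a: "a \<in> A" "f a = Min (f ` A)" by auto
  have "of_nat (card A) * f a \<le> sum f A" using a assms by (intro sum_bounded_below) auto
  then have "card A * f a \<le> sum f A" by simp
  then show ?thesis using a(1) by blast
qed

lemma card_le_card_symdiff:
  assumes "finite X" "finite Y"
  shows "card X \<le> card Y + card {x \<in> X \<union> Y. (x \<in> X) \<noteq> (x \<in> Y)}"
proof -
  have "card X \<le> card (Y \<union> {x \<in> X \<union> Y. (x \<in> X) \<noteq> (x \<in> Y)})" using assms by (intro card_mono) auto
  then show ?thesis using card_Un_le order_trans by blast
qed

context touching_system
begin

lemma T_sub: "T \<subseteq> F \<times> F"
  using touch_in by auto

lemma card_T_square: "card T \<le> (card F)\<^sup>2"
proof -
  have "card T \<le> card (F \<times> F)" using T_sub finite_F by (intro card_mono) auto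
  then show ?thesis by (simp add: card_cartesian_product power2_eq_square)
qed

lemma subsystem:
  assumes "G \<subseteq> F"
  shows "touching_system G al H (T \<inter> G \<times> G) \<tau> K"
proof
  show "finite G" using assms finite_F finite_subset by blast
  show "t < K" if "c \<in> G" "al c t" for c t using alive_bounded that assms by blast
  show "al c x" if "c \<in> G" "al c s" "al c t" "s \<le> x" "x \<le> t" for c s t x using alive_between that assms by blast
  show "H c t \<noteq> H d t" if "c \<in> G" "d \<in> G" "c \<noteq> d" "al c t" "al d t" for c d t
    using height_inj that assms by blast
  show False if "c \<in> G" "d \<in> G" "s < t" "t < x" "al c s" "al d s" "al c x" "al d x"
    "H c s < H d s" "H d t < H c t" "H c x < H d x" for c d s t x
    using cross_once[of c d s t x] that assms by blast
  show "a \<in> G \<and> b \<in> G" if "(a, b) \<in> T \<inter> G \<times> G" for a b using that by blast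
  show "al a (\<tau> a b) \<and> al b (\<tau> a b)" if "(a, b) \<in> T \<inter> G \<times> G" for a b using touch_alive that by blast
  show "H b t < H a t" if "(a, b) \<in> T \<inter> G \<times> G" "al a t" "al b t" for a b t using touch_above that by blast
  show False if "(a, b) \<in> T \<inter> G \<times> G" "c \<in> G" "al c (\<tau> a b)" "H b (\<tau> a b) < H c (\<tau> a b)"
    "H c (\<tau> a b) < H a (\<tau> a b)" for a b c
    using touch_adjacent[of a b c] that assms by blast
qed

section \<open>Changes of level and the average over all offsets\<close>

definition steps :: "('c \<times> nat) set" where
  "steps = {(c, t). c \<in> F \<and> al c t \<and> 0 < t \<and> al c (t - 1)}"

definition births :: "('c \<times> nat) set" where
  "births = {(c, t). c \<in> F \<and> al c t \<and> (t = 0 \<or> \<not> al c (t - 1))}"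

definition is_below :: "'c \<Rightarrow> nat \<Rightarrow> 'c \<Rightarrow> bool" where
  "is_below c t d \<longleftrightarrow> al d t \<and> H d t < H c t"

lemma finite_steps: "finite steps"
  by (rule finite_subset[of _ "F \<times> {..<K}"]) (use finite_F alive_bounded in \<open>auto simp: steps_def\<close>)

lemma finite_births: "finite births"
  by (rule finite_subset[of _ "F \<times> {..<K}"]) (use finite_F alive_bounded in \<open>auto simp: births_def\<close>)

lemma card_births: "card births \<le> card F"
proof -
  have *: "\<not> t < t'" if "(c, t) \<in> births" "(c, t') \<in> births" for c t t'
  proof
    assume "t < t'"
    then have "t \<le> t' - 1" by linarith
    then have "al c (t' - 1)" using alive_between[of c t t' "t' - 1"] that by (auto simp: births_def)
    then show False using that \<open>t < t'\<close> by (auto simp: births_def)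
  qed
  have "inj_on fst births"
  proof (rule inj_onI)
    fix x y assume xy: "x \<in> births" "y \<in> births" "fst x = fst y"
    obtain c t t' where e: "x = (c, t)" "y = (c, t')" using xy(3) by (cases x, cases y) auto
    show "x = y" using *[of c t t'] *[of c t' t] xy(1,2) unfolding e by force
  qed
  then show ?thesis by (rule card_inj_on_le) (use finite_F in \<open>auto simp: births_def\<close>)
qed

text \<open>There are three kinds of change, each of which happens at most once: \<open>d\<close>
  appears, \<open>d\<close> disappears, or both are present and exchange their order.\<close>

lemma card_changes:
  assumes c: "c \<in> F" and d: "d \<in> F"
  shows "card {t. (c, t) \<in> steps \<and> is_below c (t - 1) d \<noteq> is_below c t d} \<le> 3"
proof -
  let ?Z = "{t. (c, t) \<in> steps \<and> is_below c (t - 1) d \<noteq> is_below c t d}"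
  let ?B = "{t \<in> ?Z. al d t \<and> \<not> al d (t - 1)}" and ?D = "{t \<in> ?Z. \<not> al d t \<and> al d (t - 1)}"
    and ?X = "{t \<in> ?Z. al d t \<and> al d (t - 1)}"
  have "?Z \<subseteq> {..<K}" using alive_bounded by (auto simp: steps_def)
  then have fZ: "finite ?Z" by (rule finite_subset) simp
  have le1: "card A \<le> 1" if "finite A" "\<And>s t. s \<in> A \<Longrightarrow> t \<in> A \<Longrightarrow> \<not> s < (t :: nat)" for A
  proof -
    have "s = t" if "s \<in> A" "t \<in> A" for s t using \<open>\<And>s t. s \<in> A \<Longrightarrow> t \<in> A \<Longrightarrow> \<not> s < t\<close> that by (meson linorder_neqE_nat)
    then show ?thesis using card_le_Suc0_iff_eq[OF \<open>finite A\<close>] by simp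
  qed
  have "card ?B \<le> 1"
  proof (rule le1)
    fix s t assume "s \<in> ?B" "t \<in> ?B"
    then show "\<not> s < t" using alive_between[OF d, of s t "t - 1"] by (cases t) auto
  qed (rule finite_subset[OF _ fZ], auto)
  moreover have "card ?D \<le> 1"
  proof (rule le1)
    fix s t assume "s \<in> ?D" "t \<in> ?D"
    then show "\<not> s < t" using alive_between[OF d, of "s - 1" "t - 1" s] by (cases t) auto
  qed (rule finite_subset[OF _ fZ], auto)
  moreover have "card ?X \<le> 1"
  proof (rule le1)
    fix s t assume s: "s \<in> ?X" and t: "t \<in> ?X"
    have al: "al c s" "al c (s - 1)" "al c t" "al c (t - 1)" "al d s" "al d (s - 1)" "al d t" "al d (t - 1)" "0 < s" "0 < t"
      and ch: "(H d (s - 1) < H c (s - 1)) \<noteq> (H d s < H c s)" "(H d (t - 1) < H c (t - 1)) \<noteq> (H d t < H c t)"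
      using s t by (auto simp: steps_def is_below_def)
    have "c \<noteq> d" using ch by auto
    note ne = height_inj[OF c d this al(1,5)] height_inj[OF c d this al(2,6)] height_inj[OF c d this al(3,7)] height_inj[OF c d this al(4,8)]
    show "\<not> s < t"
    proof
      assume lt: "s < t"
      have s1: "s - 1 < s" "t - 1 < t" using al by auto
      show False
      proof (cases "H d s < H c s")
        case True
        then have a: "H c (s - 1) < H d (s - 1)" using ch ne by auto
        show False
        proof (cases "H c t < H d t")
          case True
          then show False using cross_once[OF c d s1(1) lt] \<open>H d s < H c s\<close> a al by auto
        next
          case False
          then have "H d t < H c t" "H c (t - 1) < H d (t - 1)" using ch ne by auto
          then have "s \<noteq> t - 1" using True by auto
          then have "s < t - 1" using lt by auto
          then show False
            using cross_once[OF d c _ s1(2)] True \<open>H d t < H c t\<close> \<open>H c (t - 1) < H d (t - 1)\<close> al by auto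
        qed
      next
        case False
        then have a: "H d (s - 1) < H c (s - 1)" "H c s < H d s" using ch ne by auto
        show False
        proof (cases "H d t < H c t")
          case True
          then show False using cross_once[OF d c s1(1) lt] a al by auto
        next
          case False
          then have "H c t < H d t" "H d (t - 1) < H c (t - 1)" using ch ne by auto
          then have "s \<noteq> t - 1" using a by auto
          then have "s < t - 1" using lt by auto
          then show False
            using cross_once[OF c d _ s1(2)] a \<open>H c t < H d t\<close> \<open>H d (t - 1) < H c (t - 1)\<close> al by auto
        qed
      qed
    qed
  qed (rule finite_subset[OF _ fZ], auto)
  moreover have "card ?Z \<le> card ?B + card ?D + card ?X"
  proof -
    have "?Z \<subseteq> ?B \<union> ?D \<union> ?X"
    proof
      fix t assume "t \<in> ?Z"
      then show "t \<in> ?B \<union> ?D \<union> ?X" by (cases "al d t"; cases "al d (t - 1)") (auto simp: is_below_def)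
    qed
    moreover have "finite (?B \<union> ?D \<union> ?X)" by (rule finite_subset[OF _ fZ]) blast
    ultimately have "card ?Z \<le> card (?B \<union> ?D \<union> ?X)" by (intro card_mono)
    then show ?thesis
      using card_Un_le[of "?B \<union> ?D" ?X] card_Un_le[of ?B ?D] by linarith
  qed
  ultimately show ?thesis by linarith
qed

text \<open>The level moves by at most the number of curves that change between being below
  \<open>c\<close> and not, and each level passed meets a band boundary for at most one
  offset.\<close>

lemma level_change:
  "card {r. r < h \<and> (level c s + r) div h \<noteq> (level c t + r) div h} \<le> card {d \<in> F. is_below c s d \<noteq> is_below c t d}"
  if "0 < h" for h
proof -
  have lev: "level c u = card {d \<in> F. is_below c u d}" for u by (simp add: level_def is_below_def)
  have diff: "level c u \<le> level c v + card {d \<in> F. is_below c u d \<noteq> is_below c v d}" for u v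
  proof -
    let ?X = "{d \<in> F. is_below c u d}" and ?Y = "{d \<in> F. is_below c v d}"
    have "{x \<in> ?X \<union> ?Y. (x \<in> ?X) \<noteq> (x \<in> ?Y)} = {d \<in> F. is_below c u d \<noteq> is_below c v d}" by auto
    then show ?thesis using card_le_card_symdiff[of ?X ?Y] finite_F unfolding lev by simp
  qed
  have sym: "{d \<in> F. is_below c t d \<noteq> is_below c s d} = {d \<in> F. is_below c s d \<noteq> is_below c t d}"
    "{r. r < h \<and> (level c s + r) div h \<noteq> (level c t + r) div h} = {r. r < h \<and> (level c t + r) div h \<noteq> (level c s + r) div h}"
    by auto
  show ?thesis
  proof (cases "level c s \<le> level c t")
    case True
    then show ?thesis using card_offsets[OF that True] diff[of t s] unfolding sym(1) by linarith
  next
    case False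
    then have "level c t \<le> level c s" by simp
    then show ?thesis using card_offsets[OF that] diff[of s t] unfolding sym(2) by force
  qed
qed

lemma touch_level:
  assumes "(a, b) \<in> T"
  shows "level a (\<tau> a b) = Suc (level b (\<tau> a b))"
proof -
  let ?t = "\<tau> a b"
  have ab: "a \<in> F" "b \<in> F" "al a ?t" "al b ?t" "H b ?t < H a ?t"
    using touch_in touch_alive touch_above assms by blast+
  have "d = b \<or> H d ?t < H b ?t" if "d \<in> F" "al d ?t" "H d ?t < H a ?t" for d
    using touch_adjacent[OF assms that(1,2)] height_inj[OF that(1) ab(2)] that ab by fastforce
  then have "{d \<in> F. al d ?t \<and> H d ?t < H a ?t} = insert b {d \<in> F. al d ?t \<and> H d ?t < H b ?t}"
    using ab by fastforce
  then show ?thesis unfolding level_def using finite_F by simp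
qed

text \<open>An average over \<open>h\<close> offsets. Tangent curves are on consecutive levels, so
  each tangency is separated by at most one offset, which gives at most
  \<open>(card F)\<^sup>2\<close> in total. Each ordered pair of curves has at most three changes,
  which gives \<open>3 * (card F)\<^sup>2\<close> changes of band. The first appearances count for
  every offset, hence the term \<open>h * card F\<close>.\<close>

lemma good_offset:
  assumes h: "0 < h"
  shows "\<exists>r. h * (card (banded.separated F al H T \<tau> h r) + card (banded.entries F al H h r))
    \<le> h * card F + 4 * (card F)\<^sup>2"
proof -
  let ?n = "card F"
  have b: "banded F al H T \<tau> K h" by unfold_locales (rule h)
  define moved where "moved r = {(c, t) \<in> steps. (level c (t - 1) + r) div h \<noteq> (level c t + r) div h}" for r
  have ent: "card (banded.entries F al H h r) \<le> ?n + card (moved r)" for r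
  proof -
    interpret banded F al H T \<tau> K h r by (rule b)
    have "entries \<subseteq> births \<union> moved r"
      by (auto simp: entries_def births_def moved_def steps_def band_def)
    moreover have "finite (moved r)" by (rule finite_subset[OF _ finite_steps]) (auto simp: moved_def)
    ultimately have "card entries \<le> card (births \<union> moved r)" using finite_births by (intro card_mono) auto
    then show ?thesis using card_Un_le[of births "moved r"] card_births by linarith
  qed
  have sep: "card (banded.separated F al H T \<tau> h r) = card {(a, b) \<in> T. (level a (\<tau> a b) + r) div h \<noteq> (level b (\<tau> a b) + r) div h}" for r
  proof -
    interpret banded F al H T \<tau> K h r by (rule b)
    show ?thesis by (simp add: separated_def band_def)
  qed
  have fT: "finite T" using T_sub finite_F by (meson finite_SigmaI finite_subset)
  have swap: "(\<Sum>r<h. card {x \<in> X. P r x}) = (\<Sum>x\<in>X. card {r. r < h \<and> P r x})" if "finite X" for X :: "'z set" and P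
  proof -
    have "(\<Sum>r<h. card {x \<in> X. P r x}) = (\<Sum>r<h. \<Sum>x\<in>X. of_bool (P r x))"
      using that by (intro sum.cong refl) (simp add: sum_of_bool_eq Collect_conj_eq Int_commute)
    also have "\<dots> = (\<Sum>x\<in>X. \<Sum>r<h. of_bool (P r x))" by (rule sum.swap)
    also have "\<dots> = (\<Sum>x\<in>X. card {r. r < h \<and> P r x})"
      by (intro sum.cong refl) (simp add: sum_of_bool_eq lessThan_def Collect_conj_eq)
    finally show ?thesis .
  qed
  have "(\<Sum>r<h. card {(a, b) \<in> T. (level a (\<tau> a b) + r) div h \<noteq> (level b (\<tau> a b) + r) div h})
    = (\<Sum>x\<in>T. card {r. r < h \<and> (level (fst x) (\<tau> (fst x) (snd x)) + r) div h \<noteq> (level (snd x) (\<tau> (fst x) (snd x)) + r) div h})"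
    unfolding swap[OF fT, symmetric] by (simp add: case_prod_unfold)
  also have "\<dots> \<le> (\<Sum>x\<in>T. 1)"
  proof (rule sum_mono)
    fix x assume "x \<in> T"
    then obtain a b where x: "x = (a, b)" "(a, b) \<in> T" by (cases x) auto
    show "card {r. r < h \<and> (level (fst x) (\<tau> (fst x) (snd x)) + r) div h \<noteq> (level (snd x) (\<tau> (fst x) (snd x)) + r) div h} \<le> 1"
      using card_offsets_Suc[OF h, of "level b (\<tau> a b)"] touch_level[OF x(2)] x(1) by (simp add: eq_commute)
  qed
  also have "\<dots> \<le> ?n\<^sup>2" using card_T_square by simp
  finally have S: "(\<Sum>r<h. card (banded.separated F al H T \<tau> h r)) \<le> ?n\<^sup>2" by (simp add: sep)
  have "(\<Sum>r<h. card (moved r)) = (\<Sum>x\<in>steps. card {r. r < h \<and> (level (fst x) (snd x - 1) + r) div h \<noteq> (level (fst x) (snd x) + r) div h})"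
    unfolding swap[OF finite_steps, symmetric] by (simp add: moved_def case_prod_unfold)
  also have "\<dots> \<le> (\<Sum>x\<in>steps. card {d \<in> F. is_below (fst x) (snd x - 1) d \<noteq> is_below (fst x) (snd x) d})"
    by (intro sum_mono level_change h)
  also have "\<dots> = card (Sigma steps (\<lambda>x. {d \<in> F. is_below (fst x) (snd x - 1) d \<noteq> is_below (fst x) (snd x) d}))"
    using finite_steps finite_F by simp
  \<comment> \<open>The changes counted per step of a curve are regrouped per pair of curves, where
    \<open>card_changes\<close> applies.\<close>
  also have "\<dots> = card (Sigma (F \<times> F) (\<lambda>(c, d). {t. (c, t) \<in> steps \<and> is_below c (t - 1) d \<noteq> is_below c t d}))"
    by (rule bij_betw_same_card[of "\<lambda>((c, t), d). ((c, d), t)"],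
        rule bij_betwI[where g = "\<lambda>((c, d), t). ((c, t), d)"]) (auto simp: steps_def)
  also have "\<dots> = (\<Sum>x\<in>F \<times> F. card (case x of (c, d) \<Rightarrow> {t. (c, t) \<in> steps \<and> is_below c (t - 1) d \<noteq> is_below c t d}))"
  proof (rule card_SigmaI)
    have "finite {t. (c, t) \<in> steps \<and> Q t}" for c Q
      by (rule finite_subset[of _ "snd ` steps"]) (use finite_steps in force)+
    then show "\<forall>x\<in>F \<times> F. finite (case x of (c, d) \<Rightarrow> {t. (c, t) \<in> steps \<and> is_below c (t - 1) d \<noteq> is_below c t d})"
      by auto
  qed (use finite_F in auto)
  also have "\<dots> \<le> (\<Sum>x\<in>F \<times> F. 3)" using card_changes by (intro sum_mono) auto
  also have "\<dots> = 3 * ?n\<^sup>2" by (simp add: card_cartesian_product power2_eq_square)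
  finally have M: "(\<Sum>r<h. card (moved r)) \<le> 3 * ?n\<^sup>2" .
  have "(\<Sum>r<h. card (banded.separated F al H T \<tau> h r) + card (banded.entries F al H h r))
    \<le> (\<Sum>r<h. card (banded.separated F al H T \<tau> h r) + (?n + card (moved r)))"
    using ent by (intro sum_mono) auto
  also have "\<dots> \<le> h * ?n + 4 * ?n\<^sup>2" using S M by (simp add: sum.distrib)
  finally have tot: "(\<Sum>r<h. card (banded.separated F al H T \<tau> h r) + card (banded.entries F al H h r)) \<le> h * ?n + 4 * ?n\<^sup>2" .
  have "\<exists>r\<in>{..<h}. card {..<h} * (card (banded.separated F al H T \<tau> h r) + card (banded.entries F al H h r))
    \<le> (\<Sum>r<h. card (banded.separated F al H T \<tau> h r) + card (banded.entries F al H h r))"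
    by (rule exists_le_average) (use h in auto)
  then show ?thesis using tot by (auto intro: order_trans)
qed

lemma card_T_recursion:
  fixes w \<rho> :: real
  assumes h: "0 < h" and k: "2 * h \<le> 2 ^ k" and w: "0 < w" "real (2 * h) \<le> w\<^sup>2"
    and rec: "\<And>G. G \<subseteq> F \<Longrightarrow> card G \<le> 2 * h \<Longrightarrow> real (card (T \<inter> G \<times> G)) \<le> \<rho> * real (card G)" and \<rho>: "0 \<le> \<rho>"
  shows "real (card T) \<le> (4 * real k + 4) * (real (card F) + 4 * (real (card F))\<^sup>2 / real h) + (16 * w + 2 * \<rho>) * real (card F)"
proof -
  obtain r where r: "h * (card (banded.separated F al H T \<tau> h r) + card (banded.entries F al H h r))
    \<le> h * card F + 4 * (card F)\<^sup>2" using good_offset[OF h] by blast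
  interpret banded F al H T \<tau> K h r by unfold_locales (rule h)
  have "real (h * (card separated + card entries)) \<le> real (h * card F + 4 * (card F)\<^sup>2)"
    using r by (rule of_nat_mono)
  then have "real h * (real (card separated) + real (card entries)) \<le> real h * real (card F) + 4 * (real (card F))\<^sup>2"
    by simp
  then have *: "real (card separated) + real (card entries) \<le> real (card F) + 4 * (real (card F))\<^sup>2 / real h"
    using h by (simp add: field_simps)
  have "real (card separated) + (4 * real k + 4) * real (card entries)
    \<le> (4 * real k + 4) * (real (card separated) + real (card entries))" by (simp add: algebra_simps)
  also have "\<dots> \<le> (4 * real k + 4) * (real (card F) + 4 * (real (card F))\<^sup>2 / real h)"
    using * by (intro mult_left_mono) auto
  finally show ?thesis using card_T_le[OF k w rec \<rho>] by linarith
qed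

end

section \<open>The bound for sampled curves\<close>

text \<open>The factor 256 leaves \<open>2 * h \<le> n / 64\<close> after \<open>h\<close> has been
  rounded up, and 64 has cube root 4. It arises as \<open>4096 powr (2/3)\<close> from
  \<open>ln n \<le> sqrt n / 4096\<close>.\<close>

lemma parameters_eventually:
  "\<exists>N. \<forall>n\<ge>N. 256 * (real n * ln (real n)) powr (2/3) \<le> real n \<and> 1 \<le> ln (real n)"
proof -
  have "\<forall>\<^sub>F n in sequentially. ln (real n) / real n powr (1/2) < 1 / 4096"
    using order_tendstoD(2)[OF lim_ln_over_power[of "1/2"], of "1/4096"] by simp
  moreover have "\<forall>\<^sub>F n in sequentially. exp 1 \<le> real n"
    by (rule eventually_sequentiallyI[of "nat \<lceil>exp 1 :: real\<rceil>"]) linarith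
  ultimately have "\<forall>\<^sub>F n in sequentially. 256 * (real n * ln (real n)) powr (2/3) \<le> real n \<and> 1 \<le> ln (real n)"
  proof eventually_elim
    case (elim n)
    have n: "0 < real n" using elim(2) exp_gt_zero[of "1::real"] by linarith
    have L: "1 \<le> ln (real n)" using elim(2) n by (simp add: ln_ge_iff)
    have "ln (real n) \<le> real n powr (1/2) / 4096" using elim(1) n by (simp add: field_simps)
    then have "real n * ln (real n) \<le> real n * (real n powr (1/2) / 4096)" using n by (intro mult_left_mono) auto
    also have "\<dots> = real n powr (3/2) / 4096" using n by (simp add: powr_mult_base)
    finally have "(real n * ln (real n)) powr (2/3) \<le> (real n powr (3/2) / 4096) powr (2/3)"
      using n L by (intro powr_mono2) auto
    also have "\<dots> = real n / 4096 powr (2/3)" using n by (simp add: powr_divide powr_powr)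
    also have "(4096::real) powr (2/3) = (16 powr 3) powr (2/3)" by simp
    also have "\<dots> = 256" unfolding powr_powr by simp
    finally show ?case using L by simp
  qed
  then show ?thesis by (auto simp: eventually_sequentially)
qed

lemma exists_power_of_2:
  assumes "0 < m"
  shows "\<exists>k. m \<le> 2 ^ k \<and> real k \<le> log 2 (real m) + 1"
proof -
  define k where "k = nat \<lceil>log 2 (real m)\<rceil>"
  have l: "0 \<le> log 2 (real m)" using assms by (simp add: zero_le_log_cancel_iff)
  have "real m = 2 powr log 2 (real m)" using assms by simp
  also have "\<dots> \<le> 2 powr real k" using l unfolding k_def by (intro powr_mono) linarith+
  also have "\<dots> = real (2 ^ k)" by (simp add: powr_realpow)
  finally have "m \<le> 2 ^ k" by (simp only: of_nat_le_iff)
  moreover have "real k \<le> log 2 (real m) + 1" using l unfolding k_def by linarith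
  ultimately show ?thesis by blast
qed

lemma card_touchings_bound:
  "\<exists>C::real. 0 \<le> C \<and> (\<forall>(F :: 'c set) al H T \<tau> K. touching_system F al H T \<tau> K \<longrightarrow> 2 \<le> card F \<longrightarrow>
     real (card T) \<le> C * (real (card F) * (real (card F) * ln (real (card F))) powr (1/3)))"
proof -
  obtain N where N: "\<And>n. N \<le> n \<Longrightarrow> 256 * (real n * ln (real n)) powr (2/3) \<le> real n \<and> 1 \<le> ln (real n)"
    using parameters_eventually by blast
  \<comment> \<open>\<open>(real N)\<^sup>2\<close> covers the families below the threshold by the
    trivial bound. The number 224 solves \<open>112 + C / 2 \<le> C\<close>: one level of the
    recursion costs 80 for the passing strands and 32 for the mixed touchings, and passes on half of
    \<open>C\<close>.\<close>
  define C where "C = 224 + (real N)\<^sup>2"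
  have C0: "224 \<le> C" "0 \<le> C" "(real N)\<^sup>2 \<le> C" by (auto simp: C_def)
  have "real (card T) \<le> C * (real (card F) * (real (card F) * ln (real (card F))) powr (1/3))"
    if "touching_system F al H T \<tau> K" "2 \<le> card F" for F :: "'c set" and al H T \<tau> K
    using that
  proof (induction "card F" arbitrary: F T rule: less_induct)
    case less
    interpret touching_system F al H T \<tau> K by (rule less.prems(1))
    define n where "n = card F"
    define L where "L = ln (real n)"
    define Y where "Y = (real n * L) powr (1/3)"
    have n2: "2 \<le> real n" using less.prems(2) by (simp add: n_def)
    have ln2: "1/2 \<le> ln (2::real)" using ln2_ge_two_thirds by linarith
    have L0: "1/2 \<le> L" unfolding L_def using n2 ln2 ln_mono[of 2 "real n"] by linarith
    have nL: "1 \<le> real n * L" using mult_mono[of 2 "real n" "1/2" L] n2 L0 by simp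
    have Y1: "1 \<le> Y" unfolding Y_def using nL by (intro ge_one_powr_ge_zero) auto
    show ?case
    proof (cases "N \<le> n")
      case False
      have "card T \<le> n\<^sup>2" using card_T_square by (simp add: n_def)
      then have "real (card T) \<le> (real n)\<^sup>2" by (metis of_nat_le_iff of_nat_power)
      also have "\<dots> \<le> (real N)\<^sup>2" using False by (intro power_mono) auto
      also have "\<dots> \<le> C * 1" using C0 by simp
      also have "\<dots> \<le> C * (real n * Y)" using mult_mono[of 1 "real n" 1 Y] n2 Y1 C0 by (intro mult_left_mono) auto
      finally show ?thesis by (simp add: n_def Y_def L_def)
    next
      case True
      \<comment> \<open>\<open>X\<close> is the ideal \<open>h\<close> before rounding. Its square
        root \<open>Y\<close> is the target number of touchings per curve up to the constant, and
        \<open>2 * Y\<close> bounds \<open>w\<close>.\<close>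
      define X where "X = (real n * L) powr (2/3)"
      have XY: "X = Y\<^sup>2" unfolding X_def Y_def using nL by (simp add: power2_eq_square flip: powr_add)
      have Y3: "Y * Y\<^sup>2 = real n * L"
      proof -
        have "Y * Y\<^sup>2 = (real n * L) powr (1/3) * (real n * L) powr (2/3)" unfolding XY[symmetric] by (simp add: X_def Y_def)
        also have "\<dots> = (real n * L) powr (1/3 + 2/3)" by (rule powr_add[symmetric])
        finally show ?thesis using nL by simp
      qed
      have X1: "1 \<le> X" unfolding XY using Y1 by (simp add: one_le_power)
      have big: "256 * X \<le> real n" "1 \<le> L" using N[OF True] by (auto simp: X_def L_def)
      define h where "h = nat \<lceil>X\<rceil>"
      have h: "0 < h" "X \<le> real h" "real h \<le> 2 * X" using X1 unfolding h_def by linarith+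
      obtain k where k: "2 * h \<le> 2 ^ k" "real k \<le> log 2 (real (2 * h)) + 1"
        using exists_power_of_2[of "2 * h"] h by auto
      have h2n: "real (2 * h) \<le> real n / 64" using h big by simp
      have "log 2 (real (2 * h)) \<le> log 2 (real n)"
        using h2n h n2 by (subst log_le_cancel_iff) auto
      also have "\<dots> = L / ln 2" by (simp add: log_def L_def)
      also have "\<dots> \<le> L / (1/2)" using ln2 big by (intro divide_left_mono) auto
      finally have k3: "real k \<le> 3 * L" using k(2) big by simp
      define w where "w = sqrt (real (2 * h))"
      have w: "0 < w" "real (2 * h) \<le> w\<^sup>2" using h by (auto simp: w_def)
      have w2: "w \<le> 2 * Y"
      proof -
        have "real (2 * h) \<le> (2 * Y)\<^sup>2" using h unfolding XY by (simp add: power_mult_distrib)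
        then show ?thesis unfolding w_def using Y1 by (intro real_le_lsqrt) auto
      qed
      define \<rho> where "\<rho> = C * (real (2 * h) * L) powr (1/3)"
      have \<rho>0: "0 \<le> \<rho>" using C0 by (simp add: \<rho>_def)
      have rec: "real (card (T \<inter> G \<times> G)) \<le> \<rho> * real (card G)" if G: "G \<subseteq> F" "card G \<le> 2 * h" for G
      proof (cases "2 \<le> card G")
        case True
        have "real (card G) < real n" using G h2n n2 by linarith
        then have lt: "card G < card F" by (simp add: n_def)
        have "real (card (T \<inter> G \<times> G)) \<le> C * (real (card G) * (real (card G) * ln (real (card G))) powr (1/3))"
          by (rule less.hyps[OF lt subsystem[OF G(1)] True])
        also have "\<dots> \<le> C * (real (card G) * (real (2 * h) * L) powr (1/3))"
        proof -
          have "ln (real (card G)) \<le> L" unfolding L_def using True lt by (intro ln_mono) (auto simp: n_def)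
          moreover have "0 \<le> ln (real (card G))" using True by simp
          moreover have "real (card G) \<le> real (2 * h)" using G(2) by (rule of_nat_mono)
          ultimately have "real (card G) * ln (real (card G)) \<le> real (2 * h) * L" by (intro mult_mono) auto
          then have "(real (card G) * ln (real (card G))) powr (1/3) \<le> (real (2 * h) * L) powr (1/3)"
            using \<open>0 \<le> ln (real (card G))\<close> by (intro powr_mono2) auto
          then show ?thesis using C0 by (intro mult_left_mono) auto
        qed
        finally show ?thesis by (simp add: \<rho>_def mult_ac)
      next
        \<comment> \<open>The induction hypothesis starts at two curves; a smaller family has no
          touchings.\<close>
        case False
        interpret G: touching_system G al H "T \<inter> G \<times> G" \<tau> K by (rule subsystem[OF G(1)])
        have "(a, b) \<notin> T \<inter> G \<times> G" for a b
        proof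
          assume ab: "(a, b) \<in> T \<inter> G \<times> G"
          then have "a = b" using False G.finite_F card_le_Suc0_iff_eq[OF G.finite_F] by auto
          then show False using ab G.touch_above G.touch_alive by (metis less_irrefl)
        qed
        then have "T \<inter> G \<times> G = {}" by auto
        then show ?thesis using \<rho>0 by simp
      qed
      have r: "\<rho> \<le> C * (Y / 4)"
      proof -
        have "(real (2 * h) * L) powr (1/3) \<le> (real n / 64 * L) powr (1/3)"
          using h2n big by (intro powr_mono2 mult_right_mono) auto
        also have "\<dots> = (real n * L / 64) powr (1/3)" by simp
        also have "\<dots> = Y / 64 powr (1/3)" unfolding Y_def by (rule powr_divide)
        also have "(64::real) powr (1/3) = (4 powr 3) powr (1/3)" by simp
        also have "\<dots> = 4" unfolding powr_powr by simp
        finally show ?thesis unfolding \<rho>_def using C0 by (intro mult_left_mono) auto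
      qed
      have n0: "0 < real n" and XN: "X \<le> real n" using n2 big X1 by auto
      have a: "real n + 4 * (real n)\<^sup>2 / real h \<le> 5 * (real n)\<^sup>2 / X"
      proof -
        have "4 * (real n)\<^sup>2 / real h \<le> 4 * (real n)\<^sup>2 / X" using h X1 by (intro divide_left_mono) auto
        moreover have "real n \<le> (real n)\<^sup>2 / X" using XN X1 n0 by (simp add: pos_le_divide_eq power2_eq_square)
        ultimately show ?thesis by (simp add: add_divide_distrib)
      qed
      have b: "L * (real n)\<^sup>2 / X = real n * Y"
      proof -
        have "L * (real n)\<^sup>2 = real n * (Y * Y\<^sup>2)" unfolding Y3 by (simp add: power2_eq_square)
        then show ?thesis using X1 unfolding XY by (simp add: field_simps)
      qed
      have "real (card T) \<le> (4 * real k + 4) * (real n + 4 * (real n)\<^sup>2 / real h) + (16 * w + 2 * \<rho>) * real n"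
        using card_T_recursion[OF h(1) k(1) w rec \<rho>0] by (simp add: n_def)
      also have "\<dots> \<le> (16 * L) * (5 * (real n)\<^sup>2 / X) + (16 * (2 * Y) + 2 * (C * (Y / 4))) * real n"
        using a k3 big w2 r X1 n0 h w(1) \<rho>0 C0(2) Y1 by (intro add_mono mult_mono) auto
      also have "\<dots> = 80 * (L * (real n)\<^sup>2 / X) + 32 * (real n * Y) + C / 2 * (real n * Y)"
        by (simp add: algebra_simps)
      also have "\<dots> = (112 + C / 2) * (real n * Y)" unfolding b by (simp add: algebra_simps)
      also have "\<dots> \<le> C * (real n * Y)" using C0 n0 Y1 by (intro mult_right_mono) auto
      finally show ?thesis by (simp add: n_def Y_def L_def)
    qed
  qed
  then show ?thesis using C0 by blast
qed

section \<open>Sampling a family of curves\<close>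

lemma sign_change_zero:
  fixes f g :: "real \<Rightarrow> real"
  assumes c: "continuous_on I f" "continuous_on J g" and i: "is_interval I" "is_interval J"
    and x: "x \<in> I" "x \<in> J" "f x < g x" and y: "y \<in> I" "y \<in> J" "g y < f y"
  shows "\<exists>z\<in>I \<inter> J. min x y < z \<and> z < max x y \<and> f z = g z"
proof -
  have sub: "{min x y..max x y} \<subseteq> I \<inter> J"
  proof
    fix z assume z: "z \<in> {min x y..max x y}"
    have "min x y \<in> I" "max x y \<in> I" "min x y \<in> J" "max x y \<in> J" using x y by (simp_all add: min_def max_def)
    then show "z \<in> I \<inter> J"
      using mem_is_interval_1_I[OF i(1), of "min x y" "max x y" z] mem_is_interval_1_I[OF i(2), of "min x y" "max x y" z] z by simp
  qed
  have cont: "continuous_on {min x y..max x y} (\<lambda>z. f z - g z)"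
    by (intro continuous_on_diff continuous_on_subset[OF c(1)] continuous_on_subset[OF c(2)]) (use sub in auto)
  have "\<exists>z. min x y \<le> z \<and> z \<le> max x y \<and> f z - g z = 0"
  proof (cases "x \<le> y")
    case True
    then show ?thesis using IVT'[of "\<lambda>z. f z - g z" x 0 y] cont x y by auto
  next
    case False
    then show ?thesis using IVT2'[of "\<lambda>z. f z - g z" x 0 y] cont x y by auto
  qed
  then obtain z where z: "min x y \<le> z" "z \<le> max x y" "f z = g z" by auto
  then have "z \<noteq> x" "z \<noteq> y" using x y by auto
  then have "min x y < z" "z < max x y" using z by (auto simp: min_def max_def split: if_splits)
  then show ?thesis using z sub by (intro bexI[of _ z]) auto
qed

locale curve_family =
  fixes F :: "(real \<times> real) set set" and I :: "(real \<times> real) set \<Rightarrow> real set" and f :: "(real \<times> real) set \<Rightarrow> real \<Rightarrow> real"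
  assumes fin: "finite F"
    and dom: "c \<in> F \<Longrightarrow> is_interval (I c)" "c \<in> F \<Longrightarrow> closed (I c)"
    and cont: "c \<in> F \<Longrightarrow> continuous_on (I c) (f c)"
    and graph: "c \<in> F \<Longrightarrow> c = (\<lambda>x. (x, f c x)) ` I c"
    and meet: "c \<in> F \<Longrightarrow> d \<in> F \<Longrightarrow> c \<noteq> d \<Longrightarrow> finite (c \<inter> d) \<and> card (c \<inter> d) \<le> 1"
    and triple: "c \<in> F \<Longrightarrow> d \<in> F \<Longrightarrow> e \<in> F \<Longrightarrow> c \<noteq> d \<Longrightarrow> c \<noteq> e \<Longrightarrow> d \<noteq> e \<Longrightarrow> c \<inter> d \<inter> e = {}"
begin

lemma mem_curve: "c \<in> F \<Longrightarrow> (x, y) \<in> c \<longleftrightarrow> x \<in> I c \<and> y = f c x"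
  by (subst graph) auto

lemma meet_unique:
  assumes "c \<in> F" "d \<in> F" "c \<noteq> d" "x \<in> I c" "x \<in> I d" "f c x = f d x" "y \<in> I c" "y \<in> I d" "f c y = f d y"
  shows "x = y"
proof -
  have "(x, f c x) \<in> c \<inter> d" "(y, f c y) \<in> c \<inter> d" using assms mem_curve by auto
  moreover have "\<forall>p\<in>c \<inter> d. \<forall>q\<in>c \<inter> d. p = q"
    using meet[OF assms(1-3)] card_le_Suc0_iff_eq[of "c \<inter> d"] by simp
  ultimately have "(x, f c x) = (y, f c y)" by blast
  then show ?thesis by simp
qed

lemma between_dom: "c \<in> F \<Longrightarrow> x \<in> I c \<Longrightarrow> y \<in> I c \<Longrightarrow> x \<le> z \<Longrightarrow> z \<le> y \<Longrightarrow> z \<in> I c"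
  using dom(1) mem_is_interval_1_I by blast

lemma cross_once_real:
  assumes cd: "c \<in> F" "d \<in> F" and st: "s < t" "t < x"
    and al: "s \<in> I c" "s \<in> I d" "x \<in> I c" "x \<in> I d"
    and h: "f c s < f d s" "f d t < f c t" "f c x < f d x"
  shows False
proof -
  have ne: "c \<noteq> d" using h by auto
  have t: "t \<in> I c" "t \<in> I d"
    using between_dom[of c s x t] between_dom[of d s x t] cd st al by simp_all
  obtain y where y: "y \<in> I c \<inter> I d" "y < t" "f c y = f d y"
    using sign_change_zero[OF cont[OF cd(1)] cont[OF cd(2)] dom(1)[OF cd(1)] dom(1)[OF cd(2)] al(1,2) h(1) t h(2)] st by auto
  obtain z where z: "z \<in> I c \<inter> I d" "t < z" "f c z = f d z"
    using sign_change_zero[OF cont[OF cd(1)] cont[OF cd(2)] dom(1)[OF cd(1)] dom(1)[OF cd(2)] al(3,4) h(3) t h(2)] st by auto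
  show False using meet_unique[OF cd ne, of y z] y z by auto
qed

text \<open>The single common point would lie between \<open>x\<close> and \<open>y\<close>. Apart
  from it the order cannot change, so the curves would pass from one side to the other exactly
  there, and the point would be a crossing.\<close>

lemma tangent_no_sign_change:
  assumes cd: "c \<in> F" "d \<in> F" and ne: "c \<noteq> d" and tan: "tangent c d"
    and x: "x \<in> I c" "x \<in> I d" "f c x < f d x" and y: "y \<in> I c" "y \<in> I d" "f d y < f c y"
  shows False
proof -
  obtain p where p: "c \<inter> d = {p}" "\<not> crossing_point c d p" using tan by (auto simp: tangent_def)
  obtain z where z: "z \<in> I c \<inter> I d" "min x y < z" "z < max x y" "f c z = f d z"
    using sign_change_zero[OF cont[OF cd(1)] cont[OF cd(2)] dom(1)[OF cd(1)] dom(1)[OF cd(2)] x y] by auto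
  have "(z, f c z) \<in> c \<inter> d" using z mem_curve cd by auto
  then have pz: "p = (z, f c z)" using p by auto
  \<comment> \<open>The order at \<open>u\<close> persists right up to \<open>z\<close>: an exchange
    on the way would produce a second common point.\<close>
  have below: "below_over X a b"
    if ab: "a \<in> F" "b \<in> F" "a \<noteq> b" "f a z = f b z" "z \<in> I a" "z \<in> I b" and u: "u \<in> I a" "u \<in> I b" "f a u < f b u"
      and X: "\<And>v. v \<in> X \<Longrightarrow> min u z \<le> v \<and> v \<le> max u z \<and> v \<noteq> z" for X a b u
    unfolding below_over_def
  proof
    fix v assume v: "v \<in> X"
    have vI: "v \<in> I a" "v \<in> I b"
    proof -
      have "min u z \<in> I a" "max u z \<in> I a" "min u z \<in> I b" "max u z \<in> I b" using ab u by (simp_all add: min_def max_def)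
      then show "v \<in> I a" "v \<in> I b"
        using between_dom[of a "min u z" "max u z" v] between_dom[of b "min u z" "max u z" v] X[OF v] ab by simp_all
    qed
    have "f a v < f b v"
    proof (rule ccontr)
      assume "\<not> ?thesis"
      then consider "f a v = f b v" | "f b v < f a v" by linarith
      then show False
      proof cases
        case 1
        then show False using meet_unique[OF ab(1-3) vI 1 ab(5,6,4)] X[OF v] by auto
      next
        case 2
        obtain z' where z': "z' \<in> I a \<inter> I b" "min u v < z'" "z' < max u v" "f a z' = f b z'"
          using sign_change_zero[OF cont[OF ab(1)] cont[OF ab(2)] dom(1)[OF ab(1)] dom(1)[OF ab(2)] u vI 2] by auto
        have "z' = z" using meet_unique[OF ab(1-3) _ _ z'(4) ab(5,6,4)] z'(1) by auto
        then show False using z'(2,3) X[OF v] by (auto simp: min_def max_def split: if_splits)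
      qed
    qed
    then show "\<exists>y z. (v, y) \<in> a \<and> (v, z) \<in> b \<and> y < z" using mem_curve ab vI by auto
  qed
  \<comment> \<open>Small enough for both one-sided neighbourhoods of \<open>z\<close> to stay
    between \<open>x\<close> and \<open>y\<close>, where both curves are defined.\<close>
  define e where "e = min (z - min x y) (max x y - z)"
  have e: "0 < e" using z by (auto simp: e_def)
  have zI: "z \<in> I c" "z \<in> I d" "z \<in> I d" using z by auto
  have "crossing_point c d p"
  proof (cases "x \<le> y")
    case True
    then have xy: "x < z" "z < y" using z by auto
    have ex: "e \<le> z - x" "e \<le> y - z" using True by (auto simp: e_def)
    have "below_over {fst p - e<..<fst p} c d"
      by (rule below[OF cd ne z(4) zI(1,2) x]) (use xy ex in \<open>auto simp: pz\<close>)
    moreover have "below_over {fst p<..<fst p + e} d c"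
      by (rule below[OF cd(2,1) ne[symmetric] z(4)[symmetric] zI(2,1) y(2,1,3)]) (use xy ex in \<open>auto simp: pz\<close>)
    ultimately show ?thesis using e p by (auto simp: crossing_point_def)
  next
    case False
    then have xy: "y < z" "z < x" using z by auto
    have ex: "e \<le> z - y" "e \<le> x - z" using False by (auto simp: e_def)
    have "below_over {fst p - e<..<fst p} d c"
      by (rule below[OF cd(2,1) ne[symmetric] z(4)[symmetric] zI(2,1) y(2,1,3)]) (use xy ex in \<open>auto simp: pz\<close>)
    moreover have "below_over {fst p<..<fst p + e} c d"
      by (rule below[OF cd ne z(4) zI(1,2) x]) (use xy ex in \<open>auto simp: pz\<close>)
    ultimately show ?thesis using e p by (auto simp: crossing_point_def)
  qed
  then show False using p by simp
qed

definition meets :: "real set" where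
  "meets = {x. \<exists>c\<in>F. \<exists>d\<in>F. c \<noteq> d \<and> x \<in> I c \<and> x \<in> I d \<and> f c x = f d x}"

lemma finite_meets: "finite meets"
proof (rule finite_subset)
  show "meets \<subseteq> (\<Union>c\<in>F. \<Union>d\<in>F - {c}. fst ` (c \<inter> d))"
  proof
    fix x assume "x \<in> meets"
    then obtain c d where cd: "c \<in> F" "d \<in> F" "c \<noteq> d" "x \<in> I c" "x \<in> I d" "f c x = f d x" by (auto simp: meets_def)
    then have "(x, f c x) \<in> c \<inter> d" using mem_curve by auto
    then have "x \<in> fst ` (c \<inter> d)" by (rule image_eqI[rotated]) simp
    then show "x \<in> (\<Union>c\<in>F. \<Union>d\<in>F - {c}. fst ` (c \<inter> d))" using cd by blast
  qed
  show "finite (\<Union>c\<in>F. \<Union>d\<in>F - {c}. fst ` (c \<inter> d))" using fin meet by auto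
qed

text \<open>If \<open>e\<close> is defined at \<open>x\<close>, it keeps a positive distance from
  the common point because no three curves meet; otherwise its closed domain misses a neighbourhood
  of \<open>x\<close>. Both orders of \<open>c\<close> and \<open>d\<close> are treated, since it is
  left open which of them is the upper one.\<close>

lemma eventually_not_between:
  assumes cd: "c \<in> F" "d \<in> F" "c \<noteq> d" and e: "e \<in> F" "e \<noteq> c" "e \<noteq> d"
    and x: "x \<in> I c" "x \<in> I d" "f c x = f d x"
  shows "\<exists>\<delta>>0. \<forall>t. x - \<delta> < t \<and> t < x \<and> t \<in> I c \<and> t \<in> I d \<and> t \<in> I e \<longrightarrow>
    \<not> (f c t < f e t \<and> f e t < f d t) \<and> \<not> (f d t < f e t \<and> f e t < f c t)"
proof (cases "x \<in> I e")
  case False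
  have "open (- I e)" using dom(2)[OF e(1)] by (rule open_Compl)
  then obtain \<delta> where "0 < \<delta>" "ball x \<delta> \<subseteq> - I e" using False by (auto simp: open_contains_ball)
  then have "t \<notin> I e" if "x - \<delta> < t" "t < x" for t using that by (auto simp: subset_eq dist_real_def)
  then show ?thesis using \<open>0 < \<delta>\<close> by blast
next
  case True
  have ne: "f e x \<noteq> f c x"
  proof
    assume "f e x = f c x"
    then have "(x, f c x) \<in> c \<inter> d \<inter> e" using mem_curve cd e x True by auto
    then show False using triple[OF cd(1,2) e(1) cd(3)] e by auto
  qed
  define r where "r = \<bar>f e x - f c x\<bar> / 2"
  have r: "0 < r" using ne by (simp add: r_def)
  have near: "\<exists>\<delta>>0. \<forall>t\<in>I a. \<bar>t - x\<bar> < \<delta> \<longrightarrow> \<bar>f a t - f a x\<bar> < r" if "a \<in> F" "x \<in> I a" for a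
    using cont[OF that(1)] that r unfolding continuous_on_iff dist_real_def by blast
  obtain d1 where d1: "0 < d1" "\<And>t. t \<in> I c \<Longrightarrow> \<bar>t - x\<bar> < d1 \<Longrightarrow> \<bar>f c t - f c x\<bar> < r" using near[OF cd(1) x(1)] by blast
  obtain d2 where d2: "0 < d2" "\<And>t. t \<in> I d \<Longrightarrow> \<bar>t - x\<bar> < d2 \<Longrightarrow> \<bar>f d t - f d x\<bar> < r" using near[OF cd(2) x(2)] by blast
  obtain d3 where d3: "0 < d3" "\<And>t. t \<in> I e \<Longrightarrow> \<bar>t - x\<bar> < d3 \<Longrightarrow> \<bar>f e t - f e x\<bar> < r" using near[OF e(1) True] by blast
  show ?thesis
  proof (intro exI[of _ "min d1 (min d2 d3)"] conjI allI impI)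
    show "0 < min d1 (min d2 d3)" using d1 d2 d3 by simp
    fix t assume t: "x - min d1 (min d2 d3) < t \<and> t < x \<and> t \<in> I c \<and> t \<in> I d \<and> t \<in> I e"
    then have "\<bar>f c t - f c x\<bar> < r" "\<bar>f d t - f d x\<bar> < r" "\<bar>f e t - f e x\<bar> < r" using d1(2)[of t] d2(2)[of t] d3(2)[of t] by auto
    then have b: "f c t < f c x + r" "f c x - r < f c t" "f d t < f d x + r" "f d x - r < f d t"
      "f e t < f e x + r" "f e x - r < f e t" by (simp_all add: abs_diff_less_iff)
    have "r = (f e x - f c x) / 2 \<or> r = (f c x - f e x) / 2" by (auto simp: r_def abs_if)
    then have "f e t < f c t \<and> f e t < f d t \<or> f c t < f e t \<and> f d t < f e t"
      using b x(3) by (elim disjE) (simp_all add: field_simps)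
    then show "\<not> (f c t < f e t \<and> f e t < f d t)" "\<not> (f d t < f e t \<and> f e t < f c t)" by auto
  qed
qed

text \<open>The points \<open>y\<close> and \<open>y'\<close> guarantee that both curves extend to
  the left of \<open>x\<close>. Each third curve excludes itself from some left neighbourhood of
  \<open>x\<close>, and removing the finitely many abscissae in \<open>meets\<close> leaves a point
  in the smallest of these.\<close>

lemma sampling_time:
  assumes cd: "c \<in> F" "d \<in> F" "c \<noteq> d" and x: "x \<in> I c" "x \<in> I d" "f c x = f d x"
    and left: "y \<in> I c" "y < x" "y' \<in> I d" "y' < x"
  shows "\<exists>t. t \<in> I c \<and> t \<in> I d \<and> t \<notin> meets \<and>
    (\<forall>e\<in>F. t \<in> I e \<longrightarrow> \<not> (f c t < f e t \<and> f e t < f d t) \<and> \<not> (f d t < f e t \<and> f e t < f c t))"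
proof -
  have "\<forall>e\<in>F - {c, d}. \<exists>\<delta>>0. \<forall>t. x - \<delta> < t \<and> t < x \<and> t \<in> I c \<and> t \<in> I d \<and> t \<in> I e \<longrightarrow>
    \<not> (f c t < f e t \<and> f e t < f d t) \<and> \<not> (f d t < f e t \<and> f e t < f c t)"
    using eventually_not_between[OF cd _ _ _ x] by blast
  then obtain \<delta> where \<delta>: "\<And>e. e \<in> F - {c, d} \<Longrightarrow> 0 < \<delta> e"
    "\<And>e t. e \<in> F - {c, d} \<Longrightarrow> x - \<delta> e < t \<Longrightarrow> t < x \<Longrightarrow> t \<in> I c \<Longrightarrow> t \<in> I d \<Longrightarrow> t \<in> I e \<Longrightarrow>
    \<not> (f c t < f e t \<and> f e t < f d t) \<and> \<not> (f d t < f e t \<and> f e t < f c t)"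
    unfolding bchoice_iff by blast
  define \<delta>0 where "\<delta>0 = Min (insert (x - y) (insert (x - y') (\<delta> ` (F - {c, d}))))"
  have fin': "finite (insert (x - y) (insert (x - y') (\<delta> ` (F - {c, d}))))" using fin by simp
  have "0 < \<delta>0" unfolding \<delta>0_def using fin' \<delta>(1) left by (subst Min_gr_iff) auto
  then have "infinite {x - \<delta>0<..<x}" by (simp add: infinite_Ioo)
  then have "infinite ({x - \<delta>0<..<x} - meets)" using finite_meets by (rule Diff_infinite_finite[rotated])
  then obtain t where t: "x - \<delta>0 < t" "t < x" "t \<notin> meets" by (metis Diff_iff ex_in_conv finite.emptyI greaterThanLessThan_iff)
  have le: "\<delta>0 \<le> x - y" "\<delta>0 \<le> x - y'" unfolding \<delta>0_def by (rule Min_le[OF fin'], simp)+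
  have le': "\<delta>0 \<le> \<delta> e" if "e \<in> F - {c, d}" for e unfolding \<delta>0_def using fin' that by (intro Min_le) auto
  have tI: "t \<in> I c" "t \<in> I d" using between_dom[of c y x t] between_dom[of d y' x t] cd x left t le by auto
  have "\<not> (f c t < f e t \<and> f e t < f d t) \<and> \<not> (f d t < f e t \<and> f e t < f c t)" if "e \<in> F" "t \<in> I e" for e
    using \<delta>(2)[of e t] le'[of e] that t tI by (cases "e = c \<or> e = d") auto
  then show ?thesis using t tI by blast
qed

end

section \<open>From tangencies to a touching system\<close>

context curve_family
begin

definition sample :: "(real \<times> real) set \<Rightarrow> (real \<times> real) set \<Rightarrow> real \<Rightarrow> bool" where
  "sample a b t \<longleftrightarrow> t \<in> I a \<and> t \<in> I b \<and> t \<notin> meets \<and> f b t < f a t \<and>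
     (\<forall>e\<in>F. t \<in> I e \<longrightarrow> \<not> (f b t < f e t \<and> f e t < f a t))"

definition touching :: "((real \<times> real) set \<times> (real \<times> real) set) set" where
  "touching = {(a, b). a \<in> F \<and> b \<in> F \<and> tangent a b \<and> (\<exists>t. sample a b t)}"

definition sample_time :: "(real \<times> real) set \<Rightarrow> (real \<times> real) set \<Rightarrow> real" where
  "sample_time a b = (SOME t. sample a b t)"

lemma sample_time: "(a, b) \<in> touching \<Longrightarrow> sample a b (sample_time a b)"
  unfolding touching_def sample_time_def by (auto intro: someI_ex)

lemma finite_touching: "finite touching"
  by (rule finite_subset[of _ "F \<times> F"]) (use fin in \<open>auto simp: touching_def\<close>)

text \<open>Times are positions in the sorted list of samples, so that indices and abscissae are
  ordered alike. The samples avoid \<open>meets\<close>, which makes the heights of different curves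
  distinct.\<close>

lemma touching_bound:
  assumes sys: "\<And>al H T \<tau> K. touching_system F al H T \<tau> K \<Longrightarrow> real (card T) \<le> B"
  shows "real (card touching) \<le> B"
proof -
  define Z where "Z = (\<lambda>(a, b). sample_time a b) ` touching"
  define K where "K = card Z"
  define \<zeta> where "\<zeta> k = sorted_list_of_set Z ! k" for k
  have fZ: "finite Z" using finite_touching by (simp add: Z_def)
  have mono: "\<zeta> s < \<zeta> t" if "s < t" "t < K" for s t
    using that sorted_wrt_nth_less[OF strict_sorted_list_of_set[of Z], of s t] by (simp add: \<zeta>_def K_def)
  have mono': "\<zeta> s \<le> \<zeta> t" if "s \<le> t" "t < K" for s t using mono[of s t] that by (cases "s = t") auto
  have \<zeta>Z: "\<zeta> k \<in> Z" if "k < K" for k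
    using that nth_mem[of k "sorted_list_of_set Z"] fZ by (simp add: \<zeta>_def K_def)
  have surj: "\<exists>k<K. \<zeta> k = z" if "z \<in> Z" for z
    using that fZ in_set_conv_nth[of z "sorted_list_of_set Z"] by (simp add: \<zeta>_def K_def)
  have nomeet: "z \<notin> meets" if "z \<in> Z" for z using that sample_time by (auto simp: Z_def sample_def)
  define \<tau> where "\<tau> a b = (SOME k. k < K \<and> \<zeta> k = sample_time a b)" for a b
  have \<tau>: "\<tau> a b < K" "\<zeta> (\<tau> a b) = sample_time a b" if "(a, b) \<in> touching" for a b
  proof -
    have "sample_time a b \<in> Z" using that by (force simp: Z_def)
    then have "\<exists>k. k < K \<and> \<zeta> k = sample_time a b" using surj by blast
    then show "\<tau> a b < K" "\<zeta> (\<tau> a b) = sample_time a b" unfolding \<tau>_def by (metis (mono_tags, lifting) someI_ex)+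
  qed
  define al where "al c k \<longleftrightarrow> k < K \<and> \<zeta> k \<in> I c" for c k
  define H where "H c k = f c (\<zeta> k)" for c k
  have "touching_system F al H touching \<tau> K"
  proof
    show "finite F" by (rule fin)
    show "t < K" if "c \<in> F" "al c t" for c t using that by (simp add: al_def)
    show "al c x" if "c \<in> F" "al c s" "al c t" "s \<le> x" "x \<le> t" for c s t x
      using that mono'[of s x] mono'[of x t] between_dom[of c "\<zeta> s" "\<zeta> t" "\<zeta> x"] by (simp add: al_def)
    show "H c t \<noteq> H d t" if "c \<in> F" "d \<in> F" "c \<noteq> d" "al c t" "al d t" for c d t
      using that nomeet[of "\<zeta> t"] \<zeta>Z[of t] by (auto simp: al_def H_def meets_def)
    show False if "c \<in> F" "d \<in> F" "s < t" "t < x" "al c s" "al d s" "al c x" "al d x"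
      "H c s < H d s" "H d t < H c t" "H c x < H d x" for c d s t x
      using cross_once_real[of c d "\<zeta> s" "\<zeta> t" "\<zeta> x"] mono[of s t] mono[of t x] that by (simp add: al_def H_def)
    show "a \<in> F \<and> b \<in> F" if "(a, b) \<in> touching" for a b using that by (simp add: touching_def)
    show "al a (\<tau> a b) \<and> al b (\<tau> a b)" if "(a, b) \<in> touching" for a b
      using \<tau>[OF that] sample_time[OF that] by (simp add: al_def sample_def)
    show "H b t < H a t" if ab: "(a, b) \<in> touching" "al a t" "al b t" for a b t
    proof (rule ccontr)
      assume n: "\<not> ?thesis"
      have F: "a \<in> F" "b \<in> F" "tangent a b" using ab by (auto simp: touching_def)
      have s: "sample_time a b \<in> I a" "sample_time a b \<in> I b" "f b (sample_time a b) < f a (sample_time a b)"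
        using sample_time[OF ab(1)] by (auto simp: sample_def)
      have "a \<noteq> b" using s by auto
      then have "f a (\<zeta> t) \<noteq> f b (\<zeta> t)" using F nomeet[of "\<zeta> t"] \<zeta>Z[of t] ab by (auto simp: al_def meets_def)
      then have "f a (\<zeta> t) < f b (\<zeta> t)" using n by (simp add: H_def)
      then show False
        using tangent_no_sign_change[OF F(1,2) \<open>a \<noteq> b\<close> F(3), of "\<zeta> t" "sample_time a b"] ab s by (simp add: al_def)
    qed
    show False if "(a, b) \<in> touching" "c \<in> F" "al c (\<tau> a b)" "H b (\<tau> a b) < H c (\<tau> a b)"
      "H c (\<tau> a b) < H a (\<tau> a b)" for a b c
      using sample_time[OF that(1)] \<tau>[OF that(1)] that by (simp add: al_def H_def sample_def)
  qed
  then show ?thesis by (rule sys)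
qed

lemma tangent_sym: "tangent c d \<longleftrightarrow> tangent d c"
  by (auto simp: tangent_def crossing_point_def Int_commute)

text \<open>The third case is a tangency at the left end of one of the two curves, where no common
  abscissa further left can be sampled.\<close>

lemma tangent_cases:
  assumes cd: "c \<in> F" "d \<in> F" "c \<noteq> d" "tangent c d"
  obtains "(c, d) \<in> touching" | "(d, c) \<in> touching"
  | x where "x \<in> I c" "x \<in> I d" "f c x = f d x" "(\<forall>y\<in>I c. x \<le> y) \<or> (\<forall>y\<in>I d. x \<le> y)"
proof -
  obtain p where "c \<inter> d = {p}" using cd(4) by (auto simp: tangent_def)
  moreover obtain x y where "p = (x, y)" by (cases p)
  ultimately have "(x, y) \<in> c" "(x, y) \<in> d" by blast+
  then have x: "x \<in> I c" "x \<in> I d" "f c x = f d x" using mem_curve cd(1,2) by simp_all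
  show thesis
  proof (cases "(\<forall>y\<in>I c. x \<le> y) \<or> (\<forall>y\<in>I d. x \<le> y)")
    case True
    then show thesis using that(3) x by blast
  next
    case False
    then obtain y y' where "y \<in> I c" "y < x" "y' \<in> I d" "y' < x" by (auto simp: not_le)
    then obtain t where t: "t \<in> I c" "t \<in> I d" "t \<notin> meets"
      "\<forall>e\<in>F. t \<in> I e \<longrightarrow> \<not> (f c t < f e t \<and> f e t < f d t) \<and> \<not> (f d t < f e t \<and> f e t < f c t)"
      using sampling_time[OF cd(1-3) x] by blast
    then have "f c t \<noteq> f d t" using cd by (auto simp: meets_def)
    then have "sample c d t \<or> sample d c t" using t by (auto simp: sample_def)
    then show thesis using that cd tangent_sym by (auto simp: touching_def)
  qed
qed

text \<open>A pair that meets at the left end of one of its curves is charged to that curve. A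
  second such pair with the same curve would put three curves through this end.\<close>

lemma card_tangent_pairs: "card (tangent_pairs F) \<le> card touching + card F"
proof -
  define starts where "starts c P \<longleftrightarrow> (\<exists>d x. d \<in> F \<and> c \<noteq> d \<and> P = {c, d} \<and> x \<in> I c \<and> x \<in> I d \<and> f c x = f d x \<and> (\<forall>y\<in>I c. x \<le> y))" for c P
  define R where "R = {P. \<exists>c\<in>F. starts c P}"
  have sub: "tangent_pairs F \<subseteq> (\<lambda>(a, b). {a, b}) ` touching \<union> R"
  proof
    fix P assume "P \<in> tangent_pairs F"
    then obtain c d where cd: "P = {c, d}" "c \<in> F" "d \<in> F" "c \<noteq> d" "tangent c d" by (auto simp: tangent_pairs_def)
    show "P \<in> (\<lambda>(a, b). {a, b}) ` touching \<union> R"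
    proof (rule tangent_cases[OF cd(2-5)])
      assume "(c, d) \<in> touching"
      then show ?thesis using cd(1) by force
    next
      assume "(d, c) \<in> touching"
      then show ?thesis using cd(1) by (force simp: insert_commute)
    next
      fix x assume x: "x \<in> I c" "x \<in> I d" "f c x = f d x" "(\<forall>y\<in>I c. x \<le> y) \<or> (\<forall>y\<in>I d. x \<le> y)"
      have "starts c P \<or> starts d P"
        using x(4)
      proof
        assume "\<forall>y\<in>I c. x \<le> y"
        then have "starts c P" unfolding starts_def using cd x by blast
        then show ?thesis ..
      next
        assume "\<forall>y\<in>I d. x \<le> y"
        moreover have "P = {d, c}" using cd(1) by (simp add: insert_commute)
        ultimately have "starts d P" unfolding starts_def using cd x by metis
        then show ?thesis ..
      qed
      then show ?thesis using cd by (auto simp: R_def)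
    qed
  qed
  define g where "g P = (SOME c. c \<in> F \<and> starts c P)" for P
  have g: "g P \<in> F" "starts (g P) P" if "P \<in> R" for P
  proof -
    have "\<exists>c. c \<in> F \<and> starts c P" using that by (auto simp: R_def)
    then have "g P \<in> F \<and> starts (g P) P" unfolding g_def by (rule someI_ex)
    then show "g P \<in> F" "starts (g P) P" by auto
  qed
  have "inj_on g R"
  proof (rule inj_onI)
    fix P Q assume PQ: "P \<in> R" "Q \<in> R" "g P = g Q"
    let ?c = "g P"
    obtain d x where d: "d \<in> F" "?c \<noteq> d" "P = {?c, d}" "x \<in> I ?c" "x \<in> I d" "f ?c x = f d x" "\<forall>y\<in>I ?c. x \<le> y"
      using g(2)[OF PQ(1)] unfolding starts_def by blast
    obtain d' x' where d': "d' \<in> F" "?c \<noteq> d'" "Q = {?c, d'}" "x' \<in> I ?c" "x' \<in> I d'" "f ?c x' = f d' x'" "\<forall>y\<in>I ?c. x' \<le> y"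
      using g(2)[OF PQ(2)] PQ(3) unfolding starts_def by metis
    have x: "x' = x" using d(4,7) d'(4,7) by (meson order_antisym)
    have "(x, f ?c x) \<in> ?c \<inter> d \<inter> d'" using d d' x mem_curve g(1)[OF PQ(1)] by auto
    then have "d = d'" using triple[OF g(1)[OF PQ(1)] d(1) d'(1) d(2) d'(2)] by blast
    then show "P = Q" using d(3) d'(3) by simp
  qed
  moreover have "g ` R \<subseteq> F" using g(1) by blast
  ultimately have cR: "finite R" "card R \<le> card F" using fin by (auto intro: inj_on_finite card_inj_on_le)
  have "card (tangent_pairs F) \<le> card ((\<lambda>(a, b). {a, b}) ` touching \<union> R)"
    using sub cR(1) finite_touching by (intro card_mono) auto
  also have "\<dots> \<le> card ((\<lambda>(a, b). {a, b}) ` touching) + card R" by (rule card_Un_le)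
  also have "\<dots> \<le> card touching + card F" using cR(2) card_image_le[OF finite_touching] by (meson add_mono)
  finally show ?thesis .
qed

end

theorem theorem5:
  shows "\<exists>C::real. \<forall>n\<ge>(2::nat). \<forall>F::(real \<times> real) set set.
    finite F \<and> card F = n \<and>
    (\<forall>c\<in>F. x_monotone_curve c) \<and>
    (\<forall>c\<in>F. \<forall>d\<in>F. c \<noteq> d \<longrightarrow> finite (c \<inter> d) \<and> card (c \<inter> d) \<le> 1) \<and>
    (\<forall>c\<in>F. \<forall>d\<in>F. \<forall>e\<in>F. c \<noteq> d \<and> c \<noteq> e \<and> d \<noteq> e \<longrightarrow> c \<inter> d \<inter> e = {})
    \<longrightarrow> real (card (tangent_pairs F)) \<le> C * real n powr (4/3) * ln (real n) powr (1/3)"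
proof -
  obtain C where C: "0 \<le> C" "\<And>(F :: (real \<times> real) set set) al H T \<tau> K. touching_system F al H T \<tau> K \<Longrightarrow> 2 \<le> card F \<Longrightarrow>
     real (card T) \<le> C * (real (card F) * (real (card F) * ln (real (card F))) powr (1/3))"
    using card_touchings_bound by blast
  show ?thesis
  \<comment> \<open>The additional 1 pays for the tangencies at left ends: they number at most
    \<open>n\<close>, and \<open>n\<close> is at most the bound \<open>R\<close> introduced
    below.\<close>
  proof (intro exI[of _ "C + 1"] allI impI, elim conjE)
    fix n :: nat and F :: "(real \<times> real) set set"
    assume n: "2 \<le> n" and F: "finite F" "card F = n" and curves: "\<forall>c\<in>F. x_monotone_curve c"
      and meet: "\<forall>c\<in>F. \<forall>d\<in>F. c \<noteq> d \<longrightarrow> finite (c \<inter> d) \<and> card (c \<inter> d) \<le> 1"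
      and triple: "\<forall>c\<in>F. \<forall>d\<in>F. \<forall>e\<in>F. c \<noteq> d \<and> c \<noteq> e \<and> d \<noteq> e \<longrightarrow> c \<inter> d \<inter> e = {}"
    have "\<forall>c\<in>F. \<exists>p. is_interval (fst p) \<and> closed (fst p) \<and> continuous_on (fst p) (snd p) \<and> c = (\<lambda>x. (x, snd p x)) ` fst p"
      using curves by (fastforce simp: x_monotone_curve_def)
    then obtain p where p: "\<forall>c\<in>F. is_interval (fst (p c)) \<and> closed (fst (p c)) \<and> continuous_on (fst (p c)) (snd (p c)) \<and>
      c = (\<lambda>x. (x, snd (p c) x)) ` fst (p c)"
      unfolding bchoice_iff by blast
    interpret curve_family F "\<lambda>c. fst (p c)" "\<lambda>c. snd (p c)"
    proof
      show "finite F" by (rule F(1))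
      fix c assume c: "c \<in> F"
      note pc = bspec[OF p c]
      show "is_interval (fst (p c))" using pc by (rule conjunct1)
      show "closed (fst (p c))" using pc by (elim conjE)
      show "continuous_on (fst (p c)) (snd (p c))" using pc by (elim conjE)
      show "c = (\<lambda>x. (x, snd (p c) x)) ` fst (p c)" using pc by (elim conjE)
      fix d assume d: "d \<in> F"
      show "finite (c \<inter> d) \<and> card (c \<inter> d) \<le> 1" if "c \<noteq> d" using meet c d that by blast
      show "c \<inter> d \<inter> e = {}" if "e \<in> F" "c \<noteq> d" "c \<noteq> e" "d \<noteq> e" for e using triple c d that by blast
    qed
    define R where "R = real n * (real n * ln (real n)) powr (1/3)"
    have "ln 2 \<le> ln (real n)" using n by simp
    then have ln2: "1/2 \<le> ln (real n)" using ln2_ge_two_thirds by linarith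
    have "1 \<le> real n * ln (real n)" using mult_mono[of 2 "real n" "1/2" "ln (real n)"] ln2 n by simp
    then have "1 \<le> (real n * ln (real n)) powr (1/3)" by (intro ge_one_powr_ge_zero) auto
    then have nR: "real n \<le> R" unfolding R_def using mult_left_mono[of 1 _ "real n"] by simp
    have "real (card touching) \<le> C * R"
    proof (rule touching_bound)
      fix al H T \<tau> K assume "touching_system F al H T \<tau> K"
      from C(2)[OF this] show "real (card T) \<le> C * R" using F(2) n unfolding R_def by blast
    qed
    then have "real (card (tangent_pairs F)) \<le> C * R + real n"
      using card_tangent_pairs F(2) by (simp add: algebra_simps flip: of_nat_add)
    also have "\<dots> \<le> (C + 1) * R" using nR by (simp add: algebra_simps)
    also have "R = real n powr (4/3) * ln (real n) powr (1/3)"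
    proof -
      have "R = real n powr 1 * (real n powr (1/3) * ln (real n) powr (1/3))"
        unfolding R_def using n ln2 by (simp add: powr_mult)
      also have "\<dots> = real n powr (1 + 1/3) * ln (real n) powr (1/3)" by (simp only: powr_add mult.assoc)
      finally show ?thesis by simp
    qed
    finally show "real (card (tangent_pairs F)) \<le> (C + 1) * real n powr (4/3) * ln (real n) powr (1/3)"
      by (simp add: mult.assoc)
  qed
qed

end
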